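(* Let $X$ be a geometric Brownian motion $dX_t=\mu X_t\,dt+\sigma X_t\,dW_t$ on $\mathbb X=(0,\infty)$ with $\sigma>0$, let $\delta(t)=\frac1{1+\beta t}$ with $\mu=\beta>0$, and let $f(x)=\min\{x,K\}$ for a constant $K>0$. Then $(0,\infty)$ is a weak equilibrium but not a strong equilibrium, while $[K,\infty)$ is the unique optimal mild equilibrium and is a strong equilibrium.
   Context: $W$ is a standard Brownian motion; $\mathbb P^x,\mathbb E^x$ refer to $X_0=x$. Closedness is relative to $\mathbb X$. For Borel $A\subset\mathbb X$, $\rho_A=\inf\{t>0:X_t\in A\}$, and $J(x,A)=\mathbb E^x[\delta(\rho_A)f(X_{\rho_A})]$, the random variable being $0$ on $\{\rho_A=\infty\}$. For closed $S$ and $\varepsilon>0$, $\rho^{\varepsilon}_S=\inf\{t\ge\varepsilon:X_t\in S\}$. Mild equilibrium: a closed set $S\subset\mathbb X$ with $f(x)\le J(x,S)$ for all $x\notin S$ and $f(x)\ge J(x,S)$ for all $x\in S$. A mild equilibrium $S$ is optimal if $J(x,S)\ge J(x,R)$ for every mild equilibrium $R$ and every $x\in\mathbb X$. Weak equilibrium: a closed set $S\subset\mathbb X$ with $f(x)\le J(x,S)$ for all $x\notin S$ and $\liminf_{\varepsilon\searrow0}\frac{f(x)-\mathbb E^x[\delta(\rho_S^\varepsilon)f(X_{\rho_S^\varepsilon})]}{\varepsilon}\ge0$ for all $x\in S$. Strong equilibrium: a closed set $S\subset\mathbb X$ with $f(x)\le J(x,S)$ for all $x\notin S$ and such that for each $x\in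 S$ there is $\varepsilon(x)>0$ with $f(x)-\mathbb E^x[\delta(\rho_S^{\varepsilon'})f(X_{\rho_S^{\varepsilon'}})]\ge0$ for all $0<\varepsilon'\le\varepsilon(x)$. *)

theory Defs
  imports "HOL-Probability.Probability"
begin

section \<open>Brownian motion and stochastic differential equations\<close>

text \<open>Only times \<open>t \<ge> 0\<close> matter; values of processes at negative times are junk. Paths of \<open>W\<close>
  and of solutions are continuous for every \<open>\<omega>\<close>, so that hitting times are measurable although
  \<open>M\<close> need not be complete.\<close>

definition brownian_motion ::
  "'w measure \<Rightarrow> (real \<Rightarrow> 'w measure) \<Rightarrow> (real \<Rightarrow> 'w \<Rightarrow> real) \<Rightarrow> bool" where
  "brownian_motion M F W \<longleftrightarrow>
     prob_space M \<and> filtration (space M) F \<and> (\<forall>t. subalgebra M (F t)) \<and>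
     (\<forall>t\<ge>0. W t \<in> borel_measurable (F t)) \<and>
     (\<forall>\<omega>\<in>space M. continuous_on {0..} (\<lambda>t. W t \<omega>)) \<and>
     (AE \<omega> in M. W 0 \<omega> = 0) \<and>
     (\<forall>s\<ge>0. \<forall>t>s.
        distributed M lborel (\<lambda>\<omega>. W t \<omega> - W s \<omega>) (normal_density 0 (sqrt (t - s))) \<and>
        prob_space.indep_set M (sets (F s))
          (sets (vimage_algebra (space M) (\<lambda>\<omega>. W t \<omega> - W s \<omega>) borel)))"

definition progressively_measurable ::
  "(real \<Rightarrow> 'w measure) \<Rightarrow> (real \<Rightarrow> 'w \<Rightarrow> real) \<Rightarrow> bool" where
  "progressively_measurable F H \<longleftrightarrow>
     (\<forall>T\<ge>0. (\<lambda>(s, \<omega>). H s \<omega>) \<in> borel_measurable (restrict_space borel {0..T} \<Otimes>\<^sub>M F T))"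

definition converges_in_probability ::
  "'w measure \<Rightarrow> (nat \<Rightarrow> 'w \<Rightarrow> real) \<Rightarrow> ('w \<Rightarrow> real) \<Rightarrow> bool" where
  "converges_in_probability M Y Z \<longleftrightarrow>
     (\<forall>k. Y k \<in> borel_measurable M) \<and> Z \<in> borel_measurable M \<and>
     (\<forall>e>0. (\<lambda>k. measure M {\<omega> \<in> space M. e < \<bar>Y k \<omega> - Z \<omega>\<bar>}) \<longlonglongrightarrow> 0)"

text \<open>A simple integrand is given by times \<open>t 0 \<le> \<dots> \<le> t n\<close> and bounded random variables
  \<open>\<xi> 0, \<dots>, \<xi> (n - 1)\<close>, where \<open>\<xi> i\<close> is known at time \<open>t i\<close> and is the value of the
  integrand on the interval from \<open>t i\<close> (excluded) to \<open>t (i + 1)\<close> (included).\<close>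

definition simple_integrand ::
  "'w measure \<Rightarrow> (real \<Rightarrow> 'w measure) \<Rightarrow> nat \<Rightarrow> (nat \<Rightarrow> real) \<Rightarrow> (nat \<Rightarrow> 'w \<Rightarrow> real) \<Rightarrow> bool" where
  "simple_integrand M F n t \<xi> \<longleftrightarrow>
     0 \<le> t 0 \<and> (\<forall>i<n. t i \<le> t (Suc i)) \<and>
     (\<forall>i<n. \<xi> i \<in> borel_measurable (F (t i)) \<and> (\<exists>c. \<forall>\<omega>\<in>space M. \<bar>\<xi> i \<omega>\<bar> \<le> c))"

definition simple_value ::
  "nat \<Rightarrow> (nat \<Rightarrow> real) \<Rightarrow> (nat \<Rightarrow> 'w \<Rightarrow> real) \<Rightarrow> real \<Rightarrow> 'w \<Rightarrow> real" where
  "simple_value n t \<xi> s \<omega> = (\<Sum>i<n. \<xi> i \<omega> * indicator {t i<..t (Suc i)} s)"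

definition simple_ito_integral ::
  "(real \<Rightarrow> 'w \<Rightarrow> real) \<Rightarrow> nat \<Rightarrow> (nat \<Rightarrow> real) \<Rightarrow> (nat \<Rightarrow> 'w \<Rightarrow> real) \<Rightarrow> real \<Rightarrow> 'w \<Rightarrow> real" where
  "simple_ito_integral W n t \<xi> T \<omega> =
     (\<Sum>i<n. \<xi> i \<omega> * (W (min T (t (Suc i))) \<omega> - W (min T (t i)) \<omega>))"

text \<open>\<open>has_ito_integral M F W H T I\<close>: the random variable \<open>I\<close> is a version of the Ito integral of
  \<open>H\<close> against \<open>W\<close> over \<open>[0, T]\<close>. This is the usual definition for progressively measurable \<open>H\<close>
  with almost surely square integrable paths, by approximation with simple integrands.\<close>

definition has_ito_integral ::
  "'w measure \<Rightarrow> (real \<Rightarrow> 'w measure) \<Rightarrow> (real \<Rightarrow> 'w \<Rightarrow> real) \<Rightarrow> (real \<Rightarrow> 'w \<Rightarrow> real) \<Rightarrow> real \<Rightarrow>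
     ('w \<Rightarrow> real) \<Rightarrow> bool" where
  "has_ito_integral M F W H T I \<longleftrightarrow>
     progressively_measurable F H \<and>
     (AE \<omega> in M. set_integrable lborel {0..T} (\<lambda>s. (H s \<omega>)\<^sup>2)) \<and>
     (\<exists>n t \<xi>. (\<forall>k. simple_integrand M F (n k) (t k) (\<xi> k)) \<and>
        converges_in_probability M
          (\<lambda>k \<omega>. LINT s:{0..T}|lborel. (simple_value (n k) (t k) (\<xi> k) s \<omega> - H s \<omega>)\<^sup>2) (\<lambda>\<omega>. 0) \<and>
        converges_in_probability M
          (\<lambda>k. simple_ito_integral W (n k) (t k) (\<xi> k) T) I)"

text \<open>\<open>dX\<^sub>t = b(X\<^sub>t) dt + s(X\<^sub>t) dW\<^sub>t\<close>, in integrated form.\<close>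

definition solves_sde ::
  "'w measure \<Rightarrow> (real \<Rightarrow> 'w measure) \<Rightarrow> (real \<Rightarrow> 'w \<Rightarrow> real) \<Rightarrow> (real \<Rightarrow> real) \<Rightarrow> (real \<Rightarrow> real) \<Rightarrow>
     (real \<Rightarrow> 'w \<Rightarrow> real) \<Rightarrow> bool" where
  "solves_sde M F W b s X \<longleftrightarrow>
     (\<forall>t\<ge>0. X t \<in> borel_measurable (F t)) \<and>
     (\<forall>\<omega>\<in>space M. continuous_on {0..} (\<lambda>t. X t \<omega>)) \<and>
     (\<forall>T\<ge>0.
        (AE \<omega> in M. set_integrable lborel {0..T} (\<lambda>u. b (X u \<omega>))) \<and>
        has_ito_integral M F W (\<lambda>u \<omega>. s (X u \<omega>)) T
          (\<lambda>\<omega>. X T \<omega> - X 0 \<omega> - (LINT u:{0..T}|lborel. b (X u \<omega>))))"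

definition geometric_brownian_motion ::
  "'w measure \<Rightarrow> (real \<Rightarrow> 'w measure) \<Rightarrow> (real \<Rightarrow> 'w \<Rightarrow> real) \<Rightarrow> real \<Rightarrow> real \<Rightarrow>
     (real \<Rightarrow> 'w \<Rightarrow> real) \<Rightarrow> bool" where
  "geometric_brownian_motion M F W \<mu> \<sigma> X \<longleftrightarrow>
     (\<forall>\<omega>\<in>space M. \<forall>t\<ge>0. X t \<omega> \<in> {0<..}) \<and>
     solves_sde M F W (\<lambda>x. \<mu> * x) (\<lambda>x. \<sigma> * x) X"


section \<open>Stopping and equilibria\<close>

text \<open>Times are extended reals, so that the infimum of the empty set is \<open>\<infinity>\<close>.\<close>

definition hitting_time :: "(real \<Rightarrow> 'w \<Rightarrow> real) \<Rightarrow> real set \<Rightarrow> 'w \<Rightarrow> ereal" where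
  "hitting_time X A \<omega> = Inf (ereal ` {t. 0 < t \<and> X t \<omega> \<in> A})"

definition hitting_time_from :: "(real \<Rightarrow> 'w \<Rightarrow> real) \<Rightarrow> real \<Rightarrow> real set \<Rightarrow> 'w \<Rightarrow> ereal" where
  "hitting_time_from X \<epsilon> S \<omega> = Inf (ereal ` {t. \<epsilon> \<le> t \<and> X t \<omega> \<in> S})"

definition discounted_payoff ::
  "(real \<Rightarrow> 'w \<Rightarrow> real) \<Rightarrow> (real \<Rightarrow> real) \<Rightarrow> (real \<Rightarrow> real) \<Rightarrow> ('w \<Rightarrow> ereal) \<Rightarrow> 'w \<Rightarrow> real" where
  "discounted_payoff X \<delta> f \<tau> \<omega> =
     (if \<tau> \<omega> = \<infinity> then 0
      else \<delta> (real_of_ereal (\<tau> \<omega>)) * f (X (real_of_ereal (\<tau> \<omega>)) \<omega>))"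

text \<open>Below, \<open>P x\<close> is the law under which \<open>X\<close> starts in \<open>x\<close>, and \<open>D\<close> is the state space.\<close>

definition stopping_value ::
  "(real \<Rightarrow> 'w measure) \<Rightarrow> (real \<Rightarrow> 'w \<Rightarrow> real) \<Rightarrow> (real \<Rightarrow> real) \<Rightarrow> (real \<Rightarrow> real) \<Rightarrow>
     real \<Rightarrow> real set \<Rightarrow> real" where
  "stopping_value P X \<delta> f x A = (LINT \<omega>|P x. discounted_payoff X \<delta> f (hitting_time X A) \<omega>)"

definition delayed_value ::
  "(real \<Rightarrow> 'w measure) \<Rightarrow> (real \<Rightarrow> 'w \<Rightarrow> real) \<Rightarrow> (real \<Rightarrow> real) \<Rightarrow> (real \<Rightarrow> real) \<Rightarrow>
     real \<Rightarrow> real \<Rightarrow> real set \<Rightarrow> real" where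
  "delayed_value P X \<delta> f x \<epsilon> S =
     (LINT \<omega>|P x. discounted_payoff X \<delta> f (hitting_time_from X \<epsilon> S) \<omega>)"

definition mild_equilibrium ::
  "real set \<Rightarrow> (real \<Rightarrow> 'w measure) \<Rightarrow> (real \<Rightarrow> 'w \<Rightarrow> real) \<Rightarrow> (real \<Rightarrow> real) \<Rightarrow> (real \<Rightarrow> real) \<Rightarrow>
     real set \<Rightarrow> bool" where
  "mild_equilibrium D P X \<delta> f S \<longleftrightarrow>
     closedin (top_of_set D) S \<and>
     (\<forall>x\<in>D - S. f x \<le> stopping_value P X \<delta> f x S) \<and>
     (\<forall>x\<in>S. f x \<ge> stopping_value P X \<delta> f x S)"

definition optimal_mild_equilibrium ::
  "real set \<Rightarrow> (real \<Rightarrow> 'w measure) \<Rightarrow> (real \<Rightarrow> 'w \<Rightarrow> real) \<Rightarrow> (real \<Rightarrow> real) \<Rightarrow> (real \<Rightarrow> real) \<Rightarrow>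
     real set \<Rightarrow> bool" where
  "optimal_mild_equilibrium D P X \<delta> f S \<longleftrightarrow>
     mild_equilibrium D P X \<delta> f S \<and>
     (\<forall>R. mild_equilibrium D P X \<delta> f R \<longrightarrow>
        (\<forall>x\<in>D. stopping_value P X \<delta> f x S \<ge> stopping_value P X \<delta> f x R))"

definition weak_equilibrium ::
  "real set \<Rightarrow> (real \<Rightarrow> 'w measure) \<Rightarrow> (real \<Rightarrow> 'w \<Rightarrow> real) \<Rightarrow> (real \<Rightarrow> real) \<Rightarrow> (real \<Rightarrow> real) \<Rightarrow>
     real set \<Rightarrow> bool" where
  "weak_equilibrium D P X \<delta> f S \<longleftrightarrow>
     closedin (top_of_set D) S \<and>
     (\<forall>x\<in>D - S. f x \<le> stopping_value P X \<delta> f x S) \<and>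
     (\<forall>x\<in>S. Liminf (at_right 0)
        (\<lambda>\<epsilon>. ereal ((f x - delayed_value P X \<delta> f x \<epsilon> S) / \<epsilon>)) \<ge> 0)"

definition strong_equilibrium ::
  "real set \<Rightarrow> (real \<Rightarrow> 'w measure) \<Rightarrow> (real \<Rightarrow> 'w \<Rightarrow> real) \<Rightarrow> (real \<Rightarrow> real) \<Rightarrow> (real \<Rightarrow> real) \<Rightarrow>
     real set \<Rightarrow> bool" where
  "strong_equilibrium D P X \<delta> f S \<longleftrightarrow>
     closedin (top_of_set D) S \<and>
     (\<forall>x\<in>D - S. f x \<le> stopping_value P X \<delta> f x S) \<and>
     (\<forall>x\<in>S. \<exists>\<epsilon>>0. \<forall>\<epsilon>'. 0 < \<epsilon>' \<and> \<epsilon>' \<le> \<epsilon> \<longrightarrow>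
        f x - delayed_value P X \<delta> f x \<epsilon>' S \<ge> 0)"

end

theory Submission
  imports Defs
begin

text \<open>
  Let \<open>g\<close> be a discount factor with \<open>g t * exp (\<mu> * t)\<close> nondecreasing; both the hyperbolic
  factor \<open>1 / (1 + \<mu> * t)\<close> and the exponential factor \<open>exp (- \<mu> * t)\<close> are of this kind. Since
  \<open>X\<close> grows at rate \<open>\<mu>\<close> in the mean, \<open>g t * X t\<close> is a submartingale, so later stopping is better
  as long as the path stays below \<open>K\<close>, where the payoff \<open>min x K\<close> is \<open>x\<close>. Hence, from
  a starting point up to \<open>K\<close>, waiting for \<open>{K..}\<close> is at least as good as waiting for any larger
  closed set (\<open>payoff_le_threshold\<close>). Taking the whole state space as the larger set compares with
  immediate stopping (\<open>start_le_threshold_value\<close>), and comparing the hyperbolic with the exponential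
  factor shows that below \<open>K\<close> waiting is strictly better (\<open>threshold_value_strict\<close>). On the other
  hand the payoff never exceeds \<open>K\<close>, so that at and above \<open>K\<close> any positive wait is a loss
  (\<open>value_less_outside\<close>); therefore every mild equilibrium contains \<open>{K..}\<close>. Together these facts
  make \<open>{K..}\<close> an optimal mild equilibrium and a strong one. A second optimal mild equilibrium would
  contain a point below \<open>K\<close> at which stopping is accepted although waiting is strictly better.

  For the whole state space, a deviation means stopping after a fixed delay \<open>\<epsilon>\<close>. Starting from
  \<open>x < K\<close> its value is \<open>x * exp (\<mu> * \<epsilon>) / (1 + \<mu> * \<epsilon>)\<close> minus the loss from capping the payoff at
  \<open>K\<close>. The first part exceeds \<open>x\<close> by a term of order \<open>\<epsilon>\<^sup>2\<close>: too little to violate the weak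
  condition (\<open>delay_upper_bound\<close>), but more than the loss, which is smaller than every power of
  \<open>\<epsilon>\<close>, and so enough to violate the strong one (\<open>short_delay_gains\<close>).

  The process is given only as a solution of its stochastic differential equation, and the Ito
  integral only as a limit in probability of simple integrals. The moments and the submartingale
  property come from the explicit solution (\<open>explicit_solution\<close>), which is the case of the logarithm
  in Ito's formula. Its proof freezes \<open>X\<close> along a partition and bounds the error by a domination
  inequality for simple integrands (\<open>domination\<close>), which needs no integrability of \<open>X\<close>. Optional
  sampling is reduced to a time grid (\<open>sampled_mono\<close>).
\<close>

section \<open>Brownian increments\<close>

lemma monotone_steps:
  fixes u :: "nat \<Rightarrow> real"
  assumes u: "\<And>l. l < N \<Longrightarrow> u l \<le> u (Suc l)" and "k \<le> l" "l \<le> N"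
  shows "u k \<le> u l"
  using assms(2,3)
proof (induction l)
  case (Suc l)
  then show ?case using u[of l] by (cases "k = Suc l") auto
qed simp

locale brownian =
  fixes M :: "'w measure" and F :: "real \<Rightarrow> 'w measure" and W :: "real \<Rightarrow> 'w \<Rightarrow> real"
  assumes brownian: "brownian_motion M F W"
begin

sublocale prob_space M
  using brownian by (simp add: brownian_motion_def)

lemma subalgebra_F: "subalgebra M (F t)"
  using brownian by (simp add: brownian_motion_def)

lemma space_F [simp]: "space (F t) = space M"
  using subalgebra_F by (simp add: subalgebra_def)

lemma measurable_F_mono:
  assumes "Y \<in> borel_measurable (F s)" "s \<le> t"
  shows "Y \<in> borel_measurable (F t)"
proof -
  have "sets (F s) \<subseteq> sets (F t)"
    using brownian assms(2) filtration.sets_F_mono unfolding brownian_motion_def by metis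
  then have "subalgebra (F t) (F s)" by (simp add: subalgebra_def)
  then show ?thesis using assms(1) measurable_from_subalg by blast
qed

lemma measurable_F_M:
  assumes "Y \<in> borel_measurable (F s)"
  shows "Y \<in> borel_measurable M"
  using measurable_from_subalg[OF subalgebra_F] assms by blast

lemma W_measurable_F: "0 \<le> t \<Longrightarrow> W t \<in> borel_measurable (F t)"
  using brownian by (simp add: brownian_motion_def)

lemma W_measurable [measurable]: "0 \<le> t \<Longrightarrow> W t \<in> borel_measurable M"
  using W_measurable_F measurable_F_M by blast

lemma increment_measurable_F:
  assumes "0 \<le> s" "s \<le> t"
  shows "(\<lambda>\<omega>. W t \<omega> - W s \<omega>) \<in> borel_measurable (F t)"
  using assms W_measurable_F[of t] measurable_F_mono[OF W_measurable_F[of s], of t] by simp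

lemma increment_distributed:
  assumes "0 \<le> s" "s < t"
  shows "distributed M lborel (\<lambda>\<omega>. W t \<omega> - W s \<omega>) (normal_density 0 (sqrt (t - s)))"
  using brownian assms by (simp add: brownian_motion_def)

text \<open>The independence of the increment is given for sigma algebras; products of random variables
  need it for the variables themselves.\<close>

lemma indep_past_increment:
  assumes "0 \<le> s" "s < t" and Y: "Y \<in> borel_measurable (F s)"
  shows "indep_var borel Y borel (\<lambda>\<omega>. W t \<omega> - W s \<omega>)"
proof -
  let ?D = "\<lambda>\<omega>. W t \<omega> - W s \<omega>"
  have ind: "indep_set (sets (F s)) (sets (vimage_algebra (space M) ?D borel))"
    using brownian assms by (simp add: brownian_motion_def)
  have sub1: "sigma_sets (space M) {Y -` A \<inter> space M |A. A \<in> sets borel} \<subseteq> sets (F s)"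
  proof -
    have "{Y -` A \<inter> space M |A. A \<in> sets borel} \<subseteq> sets (F s)"
      using measurable_sets[OF Y] by auto
    then show ?thesis using sets.sigma_sets_subset[of _ "F s"] by simp
  qed
  have sub2: "sigma_sets (space M) {?D -` A \<inter> space M |A. A \<in> sets borel}
      \<subseteq> sets (vimage_algebra (space M) ?D borel)"
    by (simp add: sets_vimage_algebra)
  have D: "?D \<in> borel_measurable M" using assms by simp
  have "indep_set (sigma_sets (space M) {Y -` A \<inter> space M |A. A \<in> sets borel})
     (sigma_sets (space M) {?D -` A \<inter> space M |A. A \<in> sets borel})"
    using ind unfolding indep_set_def
    by (rule indep_sets_mono_sets) (use sub1 sub2 in \<open>auto split: bool.split\<close>)
  then show ?thesis
    using D measurable_F_M[OF Y] by (simp add: indep_var_eq)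
qed

lemma expectation_past_times_increment:
  fixes g :: "real \<Rightarrow> real"
  assumes "0 \<le> s" "s < t" and Y: "Y \<in> borel_measurable (F s)" "integrable M Y"
    and g: "g \<in> borel_measurable borel" "integrable M (\<lambda>\<omega>. g (W t \<omega> - W s \<omega>))"
  shows "integrable M (\<lambda>\<omega>. Y \<omega> * g (W t \<omega> - W s \<omega>))"
    and "expectation (\<lambda>\<omega>. Y \<omega> * g (W t \<omega> - W s \<omega>)) =
      expectation Y * expectation (\<lambda>\<omega>. g (W t \<omega> - W s \<omega>))"
proof -
  have "indep_var borel Y borel (\<lambda>\<omega>. g (W t \<omega> - W s \<omega>))"
    using indep_var_compose[OF indep_past_increment[OF assms(1-3)], of "\<lambda>y. y" borel g borel] g(1)
    by (simp add: comp_def)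
  then show "integrable M (\<lambda>\<omega>. Y \<omega> * g (W t \<omega> - W s \<omega>))"
    "expectation (\<lambda>\<omega>. Y \<omega> * g (W t \<omega> - W s \<omega>)) =
      expectation Y * expectation (\<lambda>\<omega>. g (W t \<omega> - W s \<omega>))"
    using indep_var_integrable indep_var_lebesgue_integral Y(2) g(2) by blast+
qed

lemma increment_moment:
  assumes "0 \<le> s" "s < t"
  shows "integrable M (\<lambda>\<omega>. (W t \<omega> - W s \<omega>) ^ k)"
    and "expectation (\<lambda>\<omega>. (W t \<omega> - W s \<omega>) ^ (2 * k)) = fact (2 * k) / (2 ^ k * fact k) * (t - s) ^ k"
    and "expectation (\<lambda>\<omega>. (W t \<omega> - W s \<omega>) ^ (2 * k + 1)) = 0"
proof -
  note D = increment_distributed[OF assms]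
  have pos: "0 < sqrt (t - s)" using assms by simp
  show "integrable M (\<lambda>\<omega>. (W t \<omega> - W s \<omega>) ^ k)"
    using integrable_normal_moment[OF pos, of 0 k] distributed_integrable[OF D, of "\<lambda>x. x ^ k"]
    by simp
  have "expectation (\<lambda>\<omega>. (W t \<omega> - W s \<omega>) ^ (2 * k)) = fact (2 * k) / ((2 / (t - s)) ^ k * fact k)"
    using integral_normal_moment_even[OF pos, of 0 k] distributed_integral[OF D, of "\<lambda>x. x ^ (2 * k)"] assms
    by simp
  then show "expectation (\<lambda>\<omega>. (W t \<omega> - W s \<omega>) ^ (2 * k)) = fact (2 * k) / (2 ^ k * fact k) * (t - s) ^ k"
    by (simp add: power_divide)
  show "expectation (\<lambda>\<omega>. (W t \<omega> - W s \<omega>) ^ (2 * k + 1)) = 0"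
    using integral_normal_moment_odd[OF pos, of 0 k] distributed_integral[OF D, of "\<lambda>x. x ^ (2 * k + 1)"]
    by simp
qed

lemma increment_exponential_moment:
  assumes "0 \<le> s" "s < t"
  shows "integrable M (\<lambda>\<omega>. exp (a * (W t \<omega> - W s \<omega>)))"
    and "expectation (\<lambda>\<omega>. exp (a * (W t \<omega> - W s \<omega>))) = exp (a\<^sup>2 * (t - s) / 2)"
proof -
  note D = increment_distributed[OF assms]
  have pos: "0 < sqrt (t - s)" using assms by simp
  let ?v = "t - s"
  have v: "?v > 0" using assms by simp
  \<comment> \<open>Completing the square in the exponent turns the centred density into a shifted one.\<close>
  have eq: "normal_density 0 (sqrt ?v) x * exp (a * x) =
      exp (a\<^sup>2 * ?v / 2) * normal_density (a * ?v) (sqrt ?v) x" for x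
  proof -
    have "- (x - 0)\<^sup>2 / (2 * ?v) + a * x = a\<^sup>2 * ?v / 2 + - (x - a * ?v)\<^sup>2 / (2 * ?v)"
      using v by (simp add: field_simps power2_eq_square del: diff_gt_0_iff_gt)
        (simp add: algebra_simps)?
    then show ?thesis
      using v by (simp add: normal_density_def flip: exp_add)
  qed
  show "integrable M (\<lambda>\<omega>. exp (a * (W t \<omega> - W s \<omega>)))"
    using distributed_integrable[OF D, of "\<lambda>x. exp (a * x)"] pos by (simp add: eq)
  show "expectation (\<lambda>\<omega>. exp (a * (W t \<omega> - W s \<omega>))) = exp (a\<^sup>2 * (t - s) / 2)"
    using distributed_integral[OF D, of "\<lambda>x. exp (a * x)"] pos by (simp add: eq)
qed

section \<open>Sums of orthogonal increments\<close>

text \<open>Given the information at time \<open>a\<close>, the variable \<open>d\<close> has conditional mean 0 and conditional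
  variance \<open>v\<close>. Testing against integrable \<open>Y\<close> states this without conditional expectations, and
  covers both the Brownian increments and the centred squares of them.\<close>

definition centred_increment :: "real \<Rightarrow> real \<Rightarrow> ('w \<Rightarrow> real) \<Rightarrow> real \<Rightarrow> bool" where
  "centred_increment a b d v \<longleftrightarrow> d \<in> borel_measurable (F b) \<and>
     (\<forall>Y. Y \<in> borel_measurable (F a) \<longrightarrow> integrable M Y \<longrightarrow>
        integrable M (\<lambda>\<omega>. Y \<omega> * d \<omega>) \<and> expectation (\<lambda>\<omega>. Y \<omega> * d \<omega>) = 0 \<and>
        integrable M (\<lambda>\<omega>. Y \<omega> * (d \<omega>)\<^sup>2) \<and> expectation (\<lambda>\<omega>. Y \<omega> * (d \<omega>)\<^sup>2) = v * expectation Y)"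

lemma centred_incrementI:
  fixes g :: "real \<Rightarrow> real"
  assumes ab: "0 \<le> a" "a < b" and g [measurable]: "g \<in> borel_measurable borel"
    and i1: "integrable M (\<lambda>\<omega>. g (W b \<omega> - W a \<omega>))" and e1: "expectation (\<lambda>\<omega>. g (W b \<omega> - W a \<omega>)) = 0"
    and i2: "integrable M (\<lambda>\<omega>. (g (W b \<omega> - W a \<omega>))\<^sup>2)"
    and e2: "expectation (\<lambda>\<omega>. (g (W b \<omega> - W a \<omega>))\<^sup>2) = v"
  shows "centred_increment a b (\<lambda>\<omega>. g (W b \<omega> - W a \<omega>)) v"
  unfolding centred_increment_def
proof (intro conjI allI impI)
  show "(\<lambda>\<omega>. g (W b \<omega> - W a \<omega>)) \<in> borel_measurable (F b)"
    using measurable_compose[OF increment_measurable_F g, of a b] ab by simp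
  fix Y :: "'w \<Rightarrow> real" assume Y: "Y \<in> borel_measurable (F a)" "integrable M Y"
  note p1 = expectation_past_times_increment[OF ab Y, of g, OF g i1]
  have g2: "(\<lambda>x. (g x)\<^sup>2) \<in> borel_measurable borel" by measurable
  note p2 = expectation_past_times_increment[OF ab Y, of "\<lambda>x. (g x)\<^sup>2", OF g2 i2]
  show "integrable M (\<lambda>\<omega>. Y \<omega> * g (W b \<omega> - W a \<omega>))" by (rule p1(1))
  show "expectation (\<lambda>\<omega>. Y \<omega> * g (W b \<omega> - W a \<omega>)) = 0" unfolding p1(2) e1 by simp
  show "integrable M (\<lambda>\<omega>. Y \<omega> * (g (W b \<omega> - W a \<omega>))\<^sup>2)" by (rule p2(1))
  show "expectation (\<lambda>\<omega>. Y \<omega> * (g (W b \<omega> - W a \<omega>))\<^sup>2) = v * expectation Y" unfolding p2(2) e2 by simp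
qed

lemma centred_increment_W:
  assumes "0 \<le> a" "a \<le> b"
  shows "centred_increment a b (\<lambda>\<omega>. W b \<omega> - W a \<omega>) (b - a)"
proof (cases "a < b")
  case True
  note mom = increment_moment[OF assms(1) True]
  show ?thesis
    by (rule centred_incrementI[OF assms(1) True, of "\<lambda>x. x"])
      (use mom(1)[of 1] mom(1)[of 2] mom(2)[of 1] mom(3)[of 0] in simp_all)
next
  case False
  then have "b = a" using assms by simp
  then show ?thesis by (simp add: centred_increment_def)
qed

lemma centred_increment_W_square:
  assumes "0 \<le> a" "a < b"
  shows "centred_increment a b (\<lambda>\<omega>. (W b \<omega> - W a \<omega>)\<^sup>2 - (b - a)) (2 * (b - a)\<^sup>2)"
proof -
  note mom = increment_moment[OF assms]
  have 2: "expectation (\<lambda>\<omega>. (W b \<omega> - W a \<omega>)\<^sup>2) = b - a" using mom(2)[of 1] by simp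
  have 4: "expectation (\<lambda>\<omega>. (W b \<omega> - W a \<omega>) ^ 4) = 3 * (b - a)\<^sup>2"
    using mom(2)[of 2] by (simp add: fact_numeral)
  have i2: "integrable M (\<lambda>\<omega>. (W b \<omega> - W a \<omega>)\<^sup>2)" using mom(1)[of 2] by simp
  have i4: "integrable M (\<lambda>\<omega>. (W b \<omega> - W a \<omega>) ^ 4)" using mom(1)[of 4] by simp
  have eq: "(x\<^sup>2 - (b - a))\<^sup>2 = x ^ 4 - 2 * (b - a) * x\<^sup>2 + (b - a)\<^sup>2" for x :: real
    by (simp add: power2_eq_square power4_eq_xxxx algebra_simps)
  have i: "integrable M (\<lambda>\<omega>. (W b \<omega> - W a \<omega>)\<^sup>2 - (b - a))"
    "integrable M (\<lambda>\<omega>. ((W b \<omega> - W a \<omega>)\<^sup>2 - (b - a))\<^sup>2)"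
    using i2 i4 unfolding eq by auto
  have e: "expectation (\<lambda>\<omega>. (W b \<omega> - W a \<omega>)\<^sup>2 - (b - a)) = 0"
    "expectation (\<lambda>\<omega>. ((W b \<omega> - W a \<omega>)\<^sup>2 - (b - a))\<^sup>2) = 2 * (b - a)\<^sup>2"
    using i2 i4 2 4 unfolding eq by (simp_all add: prob_space power2_eq_square)
  show ?thesis
    by (rule centred_incrementI[OF assms, of "\<lambda>x. x\<^sup>2 - (b - a)"]) (use i e in simp_all)
qed

text \<open>The mixed terms vanish because the later increment is independent of everything before it;
  this is the finite form of the Ito isometry.\<close>

lemma orthogonal_sum:
  fixes N :: nat
  assumes u: "\<And>l. l < N \<Longrightarrow> u l \<le> u (Suc l)"
    and d: "\<And>l. l < N \<Longrightarrow> centred_increment (u l) (u (Suc l)) (d l) (v l)"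
    and z: "\<And>l. l < N \<Longrightarrow> z l \<in> borel_measurable (F (u l))"
    and b: "\<And>l \<omega>. l < N \<Longrightarrow> \<omega> \<in> space M \<Longrightarrow> \<bar>z l \<omega>\<bar> \<le> c l"
  shows "(\<lambda>\<omega>. \<Sum>l<N. z l \<omega> * d l \<omega>) \<in> borel_measurable (F (u N))
    \<and> integrable M (\<lambda>\<omega>. (\<Sum>l<N. z l \<omega> * d l \<omega>)\<^sup>2)
    \<and> expectation (\<lambda>\<omega>. (\<Sum>l<N. z l \<omega> * d l \<omega>)\<^sup>2) = (\<Sum>l<N. v l * expectation (\<lambda>\<omega>. (z l \<omega>)\<^sup>2))"
  using assms
proof (induction N)
  case 0
  then show ?case by simp
next
  case (Suc N)
  define S where "S = (\<lambda>\<omega>. \<Sum>l<N. z l \<omega> * d l \<omega>)"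
  have IH: "S \<in> borel_measurable (F (u N))" "integrable M (\<lambda>\<omega>. (S \<omega>)\<^sup>2)"
    "expectation (\<lambda>\<omega>. (S \<omega>)\<^sup>2) = (\<Sum>l<N. v l * expectation (\<lambda>\<omega>. (z l \<omega>)\<^sup>2))"
    using Suc unfolding S_def by auto
  have d: "centred_increment (u N) (u (Suc N)) (d N) (v N)" using Suc.prems(2) by simp
  have zF: "z N \<in> borel_measurable (F (u N))" using Suc.prems(3) by simp
  note SM [measurable] = measurable_F_M[OF IH(1)] and zM [measurable] = measurable_F_M[OF zF]
  have dF: "d N \<in> borel_measurable (F (u (Suc N)))" using d by (simp add: centred_increment_def)
  have bz: "AE \<omega> in M. \<bar>z N \<omega>\<bar> \<le> c N" using Suc.prems(4)[of N] by (auto intro!: AE_I2)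
  have iz2: "integrable M (\<lambda>\<omega>. (z N \<omega>)\<^sup>2)"
    by (rule integrable_const_bound[where B = "(c N)\<^sup>2"])
      (use bz in \<open>auto simp: abs_le_square_iff power2_le_iff_abs_le elim!: eventually_mono\<close>)
  have iS: "integrable M S"
    using square_integrable_imp_integrable[OF SM IH(2)] by simp
  have iSz: "integrable M (\<lambda>\<omega>. S \<omega> * z N \<omega>)"
    by (rule Bochner_Integration.integrable_bound[where f = "\<lambda>\<omega>. c N * S \<omega>"])
      (use iS bz in \<open>auto simp: abs_mult mult.commute[of "\<bar>c N\<bar>"] intro!: mult_left_mono elim!: eventually_mono\<close>)
  have F1: "(\<lambda>\<omega>. S \<omega> * z N \<omega>) \<in> borel_measurable (F (u N))"
    "(\<lambda>\<omega>. (z N \<omega>)\<^sup>2) \<in> borel_measurable (F (u N))" using IH(1) zF by auto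
  have c1: "integrable M (\<lambda>\<omega>. S \<omega> * z N \<omega> * d N \<omega>)" "expectation (\<lambda>\<omega>. S \<omega> * z N \<omega> * d N \<omega>) = 0"
    using d F1(1) iSz by (simp_all add: centred_increment_def)
  have c2: "integrable M (\<lambda>\<omega>. (z N \<omega>)\<^sup>2 * (d N \<omega>)\<^sup>2)"
    "expectation (\<lambda>\<omega>. (z N \<omega>)\<^sup>2 * (d N \<omega>)\<^sup>2) = v N * expectation (\<lambda>\<omega>. (z N \<omega>)\<^sup>2)"
    using d F1(2) iz2 by (simp_all add: centred_increment_def)
  have eq: "(\<Sum>l<Suc N. z l \<omega> * d l \<omega>)\<^sup>2
      = (S \<omega>)\<^sup>2 + 2 * (S \<omega> * z N \<omega> * d N \<omega>) + (z N \<omega>)\<^sup>2 * (d N \<omega>)\<^sup>2" for \<omega>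
    by (simp add: S_def power2_eq_square algebra_simps)
  have "(\<lambda>\<omega>. \<Sum>l<Suc N. z l \<omega> * d l \<omega>) \<in> borel_measurable (F (u (Suc N)))"
    using measurable_F_mono[OF IH(1), of "u (Suc N)"] measurable_F_mono[OF zF, of "u (Suc N)"]
      Suc.prems(1)[of N] dF
    by (simp add: S_def)
  then show ?case
    unfolding eq using IH c1 c2 by simp
qed

section \<open>A domination inequality\<close>

text \<open>An integrand with integrable square gives a small integral when the time integral of its square
  is small. Without any integrability this persists in the metric of convergence in probability: cut
  the integrand off as soon as the time integral of its square exceeds 1. The cut-off integrand is
  adapted and bounded, so the isometry applies to it, and the cut is visible only on the event where
  that time integral exceeds 1. The sum over blocks serves two purposes: with one block it controls the
  integral, with many blocks it controls the quadratic variation along a coarse partition.\<close>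

lemma domination:
  fixes m n :: nat
  assumes u0: "0 \<le> u 0" and u: "\<And>l. l < m * n \<Longrightarrow> u l \<le> u (Suc l)"
    and z: "\<And>l. l < m * n \<Longrightarrow> z l \<in> borel_measurable (F (u l))"
  defines "Z \<equiv> \<lambda>\<omega>. \<Sum>l<m * n. (z l \<omega>)\<^sup>2 * (u (Suc l) - u l)"
  shows "expectation (\<lambda>\<omega>. min 1 (\<Sum>i<m. (\<Sum>j<n. z (i * n + j) \<omega> * (W (u (Suc (i * n + j))) \<omega> - W (u (i * n + j)) \<omega>))\<^sup>2))
    \<le> 2 * expectation (\<lambda>\<omega>. min 1 (Z \<omega>))"
proof -
  define D where "D l = u (Suc l) - u l" for l
  define A where "A l \<omega> = (\<Sum>k<Suc l. (z k \<omega>)\<^sup>2 * D k)" for l \<omega>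
  define z' where "z' l \<omega> = (if A l \<omega> \<le> 1 \<and> 0 < D l then z l \<omega> else 0)" for l \<omega>
  have D0: "0 \<le> D l" if "l < m * n" for l using u[OF that] by (simp add: D_def)
  have umono: "u k \<le> u l" if "k \<le> l" "l \<le> m * n" for k l
    by (rule monotone_steps[where u = u, OF u that])
  have u_nn: "0 \<le> u l" if "l \<le> m * n" for l using umono[of 0 l] u0 that by simp
  have AF: "A l \<in> borel_measurable (F (u l))" if "l < m * n" for l
    unfolding A_def
  proof (rule borel_measurable_sum)
    fix k assume "k \<in> {..<Suc l}"
    then have "z k \<in> borel_measurable (F (u l))"
      using measurable_F_mono[OF z[of k]] umono[of k l] that by simp
    then show "(\<lambda>\<omega>. (z k \<omega>)\<^sup>2 * D k) \<in> borel_measurable (F (u l))" by simp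
  qed
  have z'F: "z' l \<in> borel_measurable (F (u l))" if "l < m * n" for l
  proof -
    note [measurable] = AF[OF that] z[OF that]
    show ?thesis unfolding z'_def by measurable
  qed
  have zM [measurable]: "z l \<in> borel_measurable M" if "l < m * n" for l
    using measurable_F_M[OF z[OF that]] .
  have z'b: "\<bar>z' l \<omega>\<bar> \<le> sqrt (1 / D l)" if "l < m * n" for l \<omega>
  proof (cases "A l \<omega> \<le> 1 \<and> 0 < D l")
    case True
    have "0 \<le> (\<Sum>k<l. (z k \<omega>)\<^sup>2 * D k)" using D0 that by (intro sum_nonneg) auto
    then have "(z l \<omega>)\<^sup>2 * D l \<le> 1" using True by (simp add: A_def)
    then have "(z l \<omega>)\<^sup>2 \<le> 1 / D l" using True by (simp add: field_simps)
    then show ?thesis using True by (simp add: z'_def real_le_rsqrt)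
  qed (use D0[OF that] in \<open>auto simp: z'_def\<close>)
  have sum_le: "(\<Sum>l<N. (z' l \<omega>)\<^sup>2 * D l) \<le> min 1 (\<Sum>l<N. (z l \<omega>)\<^sup>2 * D l)" if "N \<le> m * n" for N \<omega>
    using that
  proof (induction N)
    case (Suc N)
    have le: "(z' N \<omega>)\<^sup>2 * D N \<le> (z N \<omega>)\<^sup>2 * D N" using D0[of N] Suc.prems
      by (auto simp: z'_def)
    show ?case
    proof (cases "A N \<omega> \<le> 1")
      case True
      then show ?thesis using Suc le by (simp add: A_def)
    next
      case False
      then have "z' N \<omega> = 0" by (simp add: z'_def)
      then show ?thesis using Suc D0[of N] by (simp add: min_le_iff_disj) 
        (smt (verit) mult_nonneg_nonneg zero_le_power2)
    qed
  qed simp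
  define I where "I i \<omega> = (\<Sum>j<n. z' (i * n + j) \<omega> * (W (u (Suc (i * n + j))) \<omega> - W (u (i * n + j)) \<omega>))" for i \<omega>
  have idx: "i * n + j < m * n" if "i < m" "j < n" for i j
  proof -
    have "i * n + j < (Suc i) * n" using that by simp
    also have "\<dots> \<le> m * n" using that by (intro mult_le_mono1) simp
    finally show ?thesis .
  qed
  have iso: "integrable M (\<lambda>\<omega>. (I i \<omega>)\<^sup>2) \<and>
      expectation (\<lambda>\<omega>. (I i \<omega>)\<^sup>2) = (\<Sum>j<n. D (i * n + j) * expectation (\<lambda>\<omega>. (z' (i * n + j) \<omega>)\<^sup>2))"
    if "i < m" for i
  proof -
    have "Suc (i * n + j) = i * n + Suc j" for j by simp
    note idx = idx[OF that] and os = orthogonal_sum[of n "\<lambda>j. u (i * n + j)"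
        "\<lambda>j \<omega>. W (u (Suc (i * n + j))) \<omega> - W (u (i * n + j)) \<omega>"
        "\<lambda>j. D (i * n + j)" "\<lambda>j. z' (i * n + j)" "\<lambda>j. sqrt (1 / D (i * n + j))"]
    have "centred_increment (u (i * n + j)) (u (i * n + Suc j))
        (\<lambda>\<omega>. W (u (Suc (i * n + j))) \<omega> - W (u (i * n + j)) \<omega>) (D (i * n + j))" if "j < n" for j
      using centred_increment_W[OF u_nn u[OF idx[OF that]]] idx[OF that] by (simp add: D_def)
    moreover have "u (i * n + j) \<le> u (i * n + Suc j)" if "j < n" for j
      using u[OF idx[OF that]] by simp
    ultimately show ?thesis
      unfolding I_def using os z'F[OF idx] z'b[OF idx] by blast
  qed
  have iz': "integrable M (\<lambda>\<omega>. (z' l \<omega>)\<^sup>2)" if "l < m * n" for l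
  proof (rule integrable_const_bound[where B = "1 / D l"])
    show "(\<lambda>\<omega>. (z' l \<omega>)\<^sup>2) \<in> borel_measurable M"
      using measurable_F_M[OF z'F[OF that]] by simp
    have "(z' l \<omega>)\<^sup>2 \<le> 1 / D l" for \<omega>
      using power_mono[OF z'b[OF that, of \<omega>], of 2] D0[OF that] by simp
    then show "AE \<omega> in M. norm ((z' l \<omega>)\<^sup>2) \<le> 1 / D l" by simp
  qed
  have ZM [measurable]: "Z \<in> borel_measurable M" unfolding Z_def by measurable
  have Z0: "0 \<le> Z \<omega>" for \<omega> unfolding Z_def using D0 by (intro sum_nonneg) (auto simp: D_def)
  have imZ: "integrable M (\<lambda>\<omega>. min 1 (Z \<omega>))"
    by (rule integrable_const_bound[where B = 1]) (use Z0 in auto)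
  have E1: "expectation (\<lambda>\<omega>. \<Sum>i<m. (I i \<omega>)\<^sup>2) \<le> expectation (\<lambda>\<omega>. min 1 (Z \<omega>))"
  proof -
    have "expectation (\<lambda>\<omega>. \<Sum>i<m. (I i \<omega>)\<^sup>2) =
        (\<Sum>i<m. \<Sum>j<n. D (i * n + j) * expectation (\<lambda>\<omega>. (z' (i * n + j) \<omega>)\<^sup>2))"
      using iso by (subst Bochner_Integration.integral_sum) auto
    also have "\<dots> = (\<Sum>l<m * n. D l * expectation (\<lambda>\<omega>. (z' l \<omega>)\<^sup>2))"
      by (subst sum.nat_group[symmetric])
        (simp add: sum.shift_bounds_nat_ivl[of _ 0, simplified] lessThan_atLeast0 add.commute)
    also have "\<dots> = expectation (\<lambda>\<omega>. \<Sum>l<m * n. (z' l \<omega>)\<^sup>2 * D l)"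
      using iz' by (subst Bochner_Integration.integral_sum) (auto simp: mult.commute)
    also have "\<dots> \<le> expectation (\<lambda>\<omega>. min 1 (Z \<omega>))"
      using iz' imZ sum_le[of "m * n"] by (intro integral_mono) (auto simp: Z_def D_def)
    finally show ?thesis .
  qed
  have pt: "min 1 (\<Sum>i<m. (\<Sum>j<n. z (i * n + j) \<omega> * (W (u (Suc (i * n + j))) \<omega> - W (u (i * n + j)) \<omega>))\<^sup>2)
      \<le> (\<Sum>i<m. (I i \<omega>)\<^sup>2) + min 1 (Z \<omega>)" for \<omega>
  proof (cases "Z \<omega> \<le> 1")
    case True
    have "z' l \<omega> * (W (u (Suc l)) \<omega> - W (u l) \<omega>) = z l \<omega> * (W (u (Suc l)) \<omega> - W (u l) \<omega>)"
      if "l < m * n" for l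
    proof (cases "0 < D l")
      case True
      have "A l \<omega> \<le> Z \<omega>" unfolding A_def Z_def D_def[symmetric]
        using that D0 by (intro sum_mono2) auto
      then show ?thesis using True \<open>Z \<omega> \<le> 1\<close> by (simp add: z'_def)
    next
      case False
      then show ?thesis using D0[OF that] by (simp add: D_def)
    qed
    then have "(\<Sum>i<m. (I i \<omega>)\<^sup>2) =
        (\<Sum>i<m. (\<Sum>j<n. z (i * n + j) \<omega> * (W (u (Suc (i * n + j))) \<omega> - W (u (i * n + j)) \<omega>))\<^sup>2)"
      unfolding I_def using idx by (intro sum.cong refl arg_cong[where f = "\<lambda>x. x\<^sup>2"]) auto
    then show ?thesis using Z0[of \<omega>] by simp
  next
    case False
    have "0 \<le> (\<Sum>i<m. (I i \<omega>)\<^sup>2)" by (intro sum_nonneg) auto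
    then show ?thesis using False by simp
  qed
  have Wu [measurable]: "W (u l) \<in> borel_measurable M" if "l \<le> m * n" for l
    using u_nn[OF that] by simp
  have idx': "i * n + j \<le> m * n" "Suc (i * n + j) \<le> m * n" if "i < m" "j < n" for i j
    using idx[OF that] by auto
  have "expectation (\<lambda>\<omega>. min 1 (\<Sum>i<m. (\<Sum>j<n. z (i * n + j) \<omega> * (W (u (Suc (i * n + j))) \<omega> - W (u (i * n + j)) \<omega>))\<^sup>2))
    \<le> expectation (\<lambda>\<omega>. (\<Sum>i<m. (I i \<omega>)\<^sup>2) + min 1 (Z \<omega>))"
  proof (rule integral_mono[OF _ _ pt])
    show "integrable M (\<lambda>\<omega>. min 1 (\<Sum>i<m. (\<Sum>j<n. z (i * n + j) \<omega> *
        (W (u (Suc (i * n + j))) \<omega> - W (u (i * n + j)) \<omega>))\<^sup>2))"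
    proof (rule integrable_const_bound[where B = 1])
      show "(\<lambda>\<omega>. min 1 (\<Sum>i<m. (\<Sum>j<n. z (i * n + j) \<omega> *
        (W (u (Suc (i * n + j))) \<omega> - W (u (i * n + j)) \<omega>))\<^sup>2)) \<in> borel_measurable M"
        using idx idx' by (intro borel_measurable_min borel_measurable_sum borel_measurable_power
            borel_measurable_times borel_measurable_diff borel_measurable_const zM Wu) auto
    qed (auto simp: sum_nonneg)
    show "integrable M (\<lambda>\<omega>. (\<Sum>i<m. (I i \<omega>)\<^sup>2) + min 1 (Z \<omega>))"
      using iso imZ by (intro Bochner_Integration.integrable_add Bochner_Integration.integrable_sum) auto
  qed
  also have "\<dots> \<le> 2 * expectation (\<lambda>\<omega>. min 1 (Z \<omega>))"
    using iso imZ E1 by (subst Bochner_Integration.integral_add) auto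
  finally show ?thesis .
qed

end

section \<open>Simple integrands on a refined partition\<close>

lemma sum_blocks:
  fixes f :: "nat \<Rightarrow> 'a::comm_monoid_add"
  shows "(\<Sum>l<m * n. f l) = (\<Sum>i<m. \<Sum>j<n. f (i * n + j))"
  by (subst sum.nat_group[symmetric])
    (simp add: sum.shift_bounds_nat_ivl[of _ 0, simplified] lessThan_atLeast0 add.commute)

lemma step_integral:
  fixes w :: "nat \<Rightarrow> real" and h :: "real \<Rightarrow> real"
  assumes "\<And>j. j < n \<Longrightarrow> w j \<le> w (Suc j)"
    and "\<And>j \<tau>. j < n \<Longrightarrow> w j < \<tau> \<Longrightarrow> \<tau> \<le> w (Suc j) \<Longrightarrow> h \<tau> = c j"
  shows "w 0 \<le> w n \<and> set_integrable lborel {w 0<..w n} h \<and>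
    (LINT \<tau>:{w 0<..w n}|lborel. h \<tau>) = (\<Sum>j<n. c j * (w (Suc j) - w j))"
  using assms
proof (induction n)
  case 0
  then show ?case by (simp add: set_integrable_def set_lebesgue_integral_def)
next
  case (Suc n)
  then have IH: "w 0 \<le> w n" "set_integrable lborel {w 0<..w n} h"
    "(LINT \<tau>:{w 0<..w n}|lborel. h \<tau>) = (\<Sum>j<n. c j * (w (Suc j) - w j))" by auto
  have le: "w n \<le> w (Suc n)" using Suc.prems(1) by simp
  have const: "indicator {w n<..w (Suc n)} \<tau> *\<^sub>R h \<tau> = indicator {w n<..w (Suc n)} \<tau> *\<^sub>R c n" for \<tau>
    using Suc.prems(2)[of n \<tau>] by (auto simp: indicator_def)
  have last: "set_integrable lborel {w n<..w (Suc n)} h"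
    "(LINT \<tau>:{w n<..w (Suc n)}|lborel. h \<tau>) = c n * (w (Suc n) - w n)"
    unfolding set_integrable_def set_lebesgue_integral_def const using le by simp_all
  have Un: "{w 0<..w (Suc n)} = {w 0<..w n} \<union> {w n<..w (Suc n)}"
    using IH(1) le by auto
  show ?case
    unfolding Un using IH last le
    by (subst set_integral_Un) (auto intro!: set_integrable_Un)
qed

lemma simple_integrand_mono:
  assumes "simple_integrand M F n t \<xi>" "i \<le> j" "j \<le> n"
  shows "t i \<le> t j"
  using assms(1) by (intro monotone_steps[OF _ assms(2,3)]) (simp add: simple_integrand_def)

lemma simple_value_eq:
  assumes si: "simple_integrand M F n t \<xi>" and j: "j < n" "t j < \<tau>" "\<tau> \<le> t (Suc j)"
  shows "simple_value n t \<xi> \<tau> \<omega> = \<xi> j \<omega>"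
proof -
  have "\<tau> \<notin> {t i<..t (Suc i)}" if "i < n" "i \<noteq> j" for i
  proof (cases "i < j")
    case True
    then have "t (Suc i) \<le> t j" using simple_integrand_mono[OF si, of "Suc i" j] j by simp
    then show ?thesis using j by auto
  next
    case False
    then have "t (Suc j) \<le> t i" using simple_integrand_mono[OF si, of "Suc j" i] that by simp
    then show ?thesis using j by auto
  qed
  then have "simple_value n t \<xi> \<tau> \<omega> = (\<Sum>i<n. if i = j then \<xi> j \<omega> else 0)"
    unfolding simple_value_def using j by (intro sum.cong) auto
  then show ?thesis using j by simp
qed

text \<open>Padding with zero values makes the partition of a simple integrand start at time 0 and reach
  beyond any given time, so that it covers every coarse partition it is refined with.\<close>

lemma simple_integrand_extend:
  fixes T :: real
  assumes si: "simple_integrand M F n t \<xi>"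
  obtains n' t' \<xi>' where "simple_integrand M F n' t' \<xi>'" "0 < n'" "t' 0 = 0" "T \<le> t' n'"
    "\<And>\<tau> \<omega>. simple_value n' t' \<xi>' \<tau> \<omega> = simple_value n t \<xi> \<tau> \<omega>"
    "\<And>\<tau> \<omega>. simple_ito_integral W n' t' \<xi>' \<tau> \<omega> = simple_ito_integral W n t \<xi> \<tau> \<omega>"
proof -
  define t' where "t' i = (if i = 0 then 0 else if i \<le> Suc n then t (i - 1) else max T (t n))" for i
  define \<xi>' where "\<xi>' i = (if 0 < i \<and> i \<le> n then \<xi> (i - 1) else (\<lambda>_. 0))" for i
  have sums: "(\<Sum>i<Suc (Suc n). f i) = f 0 + (\<Sum>i<n. f (Suc i)) + f (Suc n)" for f :: "nat \<Rightarrow> real"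
    using sum.lessThan_Suc_shift[of f n] by simp
  have "simple_integrand M F (Suc (Suc n)) t' \<xi>'"
    unfolding simple_integrand_def
  proof (intro conjI allI impI)
    show "0 \<le> t' 0" by (simp add: t'_def)
    fix i assume i: "i < Suc (Suc n)"
    consider "i = 0" | k where "i = Suc k" "k < n" | "i = Suc n" using i by (cases i) (auto simp: less_Suc_eq)
    note split = this
    show "t' i \<le> t' (Suc i)"
      using split si by cases (auto simp: t'_def simple_integrand_def)
    show "\<xi>' i \<in> borel_measurable (F (t' i))"
      using split si by cases (auto simp: t'_def \<xi>'_def simple_integrand_def)
    show "\<exists>c. \<forall>\<omega>\<in>space M. \<bar>\<xi>' i \<omega>\<bar> \<le> c"
      using split si by cases (auto simp: \<xi>'_def simple_integrand_def)
  qed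
  moreover have "simple_value (Suc (Suc n)) t' \<xi>' \<tau> \<omega> = simple_value n t \<xi> \<tau> \<omega>" for \<tau> \<omega>
    unfolding simple_value_def sums by (simp add: t'_def \<xi>'_def)
  moreover have "simple_ito_integral W (Suc (Suc n)) t' \<xi>' \<tau> \<omega> = simple_ito_integral W n t \<xi> \<tau> \<omega>" for \<tau> \<omega>
    unfolding simple_ito_integral_def sums by (simp add: t'_def \<xi>'_def)
  ultimately show ?thesis
    using that[of "Suc (Suc n)" t' \<xi>'] by (simp add: t'_def)
qed

context brownian
begin

text \<open>Inside the interval from \<open>s i\<close> to \<open>s (i + 1)\<close> of a coarse partition the integrand is
  \<open>\<phi> i\<close> times a given simple integrand minus \<open>\<psi> i\<close>. This is a simple integrand on the common
  refinement, whose points are the \<open>t j\<close> clamped to the coarse intervals, block by block. The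
  random variables \<open>\<phi> i\<close> and \<open>\<psi> i\<close> need not be bounded.\<close>

lemma refinement_domination:
  fixes m n :: nat and s t :: "nat \<Rightarrow> real" and \<xi> \<phi> \<psi> :: "nat \<Rightarrow> 'w \<Rightarrow> real"
  assumes si: "simple_integrand M F n t \<xi>"
    and s0: "0 \<le> s 0" and s: "\<And>i. i < m \<Longrightarrow> s i \<le> s (Suc i)"
    and \<phi>: "\<And>i. i < m \<Longrightarrow> \<phi> i \<in> borel_measurable (F (s i))"
    and \<psi>: "\<And>i. i < m \<Longrightarrow> \<psi> i \<in> borel_measurable (F (s i))"
  defines "I \<equiv> \<lambda>i \<omega>. \<phi> i \<omega> * (simple_ito_integral W n t \<xi> (s (Suc i)) \<omega> - simple_ito_integral W n t \<xi> (s i) \<omega>)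
      - \<psi> i \<omega> * (W (s (Suc i)) \<omega> - W (s i) \<omega>)"
    and "Z \<equiv> \<lambda>\<omega>. \<Sum>i<m. LINT \<tau>:{s i<..s (Suc i)}|lborel. (\<phi> i \<omega> * simple_value n t \<xi> \<tau> \<omega> - \<psi> i \<omega>)\<^sup>2"
  shows "Z \<in> borel_measurable M"
    and "expectation (\<lambda>\<omega>. min 1 (\<Sum>i<m. (I i \<omega>)\<^sup>2)) \<le> 2 * expectation (\<lambda>\<omega>. min 1 (Z \<omega>))"
    and "expectation (\<lambda>\<omega>. min 1 ((\<Sum>i<m. I i \<omega>)\<^sup>2)) \<le> 2 * expectation (\<lambda>\<omega>. min 1 (Z \<omega>))"
proof -
  obtain n' t' \<xi>' where si': "simple_integrand M F n' t' \<xi>'" and n'0: "0 < n'"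
    and t0: "t' 0 = 0" and tn: "s m \<le> t' n'"
    and sv: "\<And>\<tau> \<omega>. simple_value n' t' \<xi>' \<tau> \<omega> = simple_value n t \<xi> \<tau> \<omega>"
    and sii: "\<And>\<tau> \<omega>. simple_ito_integral W n' t' \<xi>' \<tau> \<omega> = simple_ito_integral W n t \<xi> \<tau> \<omega>"
    using simple_integrand_extend[OF si, of "s m" W] by metis
  define cl where "cl i x = max (s i) (min (s (Suc i)) x)" for i x
  define u where "u l = cl (l div n') (t' (l mod n'))" for l
  define z where "z l \<omega> = (let i = l div n'; j = l mod n' in
      \<phi> i \<omega> * (if t' j \<le> s (Suc i) then \<xi>' j \<omega> else 0) - \<psi> i \<omega>)" for l \<omega>
  have smono: "s i \<le> s k" if "i \<le> k" "k \<le> m" for i k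
    by (rule monotone_steps[where u = s, OF s that])
  have s_nn: "0 \<le> s i" if "i \<le> m" for i using smono[of 0 i] s0 that by simp
  have u1: "u (i * n' + j) = cl i (t' j)" if "j < n'" for i j
    using that by (simp add: u_def)
  have u2: "u (Suc (i * n' + j)) = cl i (t' (Suc j))" if "i < m" "j < n'" for i j
  proof (cases "Suc j < n'")
    case True
    then show ?thesis using u1[of "Suc j" i] by simp
  next
    case False
    then have j: "Suc j = n'" using that by simp
    have "u (Suc (i * n' + j)) = u (Suc i * n' + 0)" by (simp add: ac_simps flip: j)
    also have "\<dots> = s (Suc i)"
      using u1[of 0 "Suc i"] n'0 t0 s_nn[of "Suc i"] that by (simp add: cl_def)
    also have "\<dots> = cl i (t' (Suc j))"
      using j tn smono[of "Suc i" m] s[of i] that by (simp add: cl_def)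
    finally show ?thesis .
  qed
  have split: "\<exists>i j. l = i * n' + j \<and> i < m \<and> j < n'" if "l < m * n'" for l
    using that n'0 by (intro exI[of _ "l div n'"] exI[of _ "l mod n'"]) (simp add: less_mult_imp_div_less)
  have u0: "0 \<le> u 0"
    using u1[of 0 0] n'0 s0 by (simp add: cl_def)
  have t'mono: "t' j \<le> t' (Suc j)" if "j < n'" for j
    using simple_integrand_mono[OF si', of j "Suc j"] that by simp
  have clmono: "cl i (t' j) \<le> cl i (t' (Suc j))" if "j < n'" for i j
    unfolding cl_def by (intro max.mono min.mono order_refl t'mono that)
  have u: "u l \<le> u (Suc l)" if l: "l < m * n'" for l
  proof -
    obtain i j where ij: "l = i * n' + j" "i < m" "j < n'" using split[OF l] by blast
    then show ?thesis
      using u1[of j i] u2[of i j] clmono[of j i] by simp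
  qed
  have zF: "z l \<in> borel_measurable (F (u l))" if l: "l < m * n'" for l
  proof -
    obtain i j where ij: "l = i * n' + j" "i < m" "j < n'" using split[OF l] by blast
    have ul: "u l = cl i (t' j)" using u1 ij by simp
    have m1: "\<phi> i \<in> borel_measurable (F (u l))" "\<psi> i \<in> borel_measurable (F (u l))"
      using measurable_F_mono[OF \<phi>] measurable_F_mono[OF \<psi>] ij(2) ul by (simp_all add: cl_def)
    have "(\<lambda>\<omega>. if t' j \<le> s (Suc i) then \<xi>' j \<omega> else 0) \<in> borel_measurable (F (u l))"
    proof (cases "t' j \<le> s (Suc i)")
      case True
      have "\<xi>' j \<in> borel_measurable (F (t' j))" using si' ij(3) by (simp add: simple_integrand_def)
      moreover have "t' j \<le> u l" unfolding ul cl_def using True by linarith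
      ultimately have "\<xi>' j \<in> borel_measurable (F (u l))" by (rule measurable_F_mono)
      then show ?thesis using True by (simp only: if_True)
    qed simp
    moreover have "l div n' = i" "l mod n' = j" using ij by simp_all
    ultimately show ?thesis using m1 by (simp add: z_def[abs_def])
  qed
  have z1: "z (i * n' + j) \<omega> = \<phi> i \<omega> * \<xi>' j \<omega> - \<psi> i \<omega>"
    if "i < m" "j < n'" "u (i * n' + j) < u (Suc (i * n' + j))" for i j \<omega>
  proof -
    have "t' j \<le> s (Suc i)"
    proof (rule ccontr)
      assume "\<not> t' j \<le> s (Suc i)"
      then have "cl i (t' j) = cl i (t' (Suc j))" using t'mono[OF that(2)] by (simp add: cl_def)
      then show False using that u1[OF that(2)] u2[OF that(1,2)] by simp
    qed
    then show ?thesis using that by (simp add: z_def)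
  qed
  have ends: "cl i (t' 0) = s i" "cl i (t' n') = s (Suc i)" if "i < m" for i
    using that t0 tn s[of i] s_nn[of i] s_nn[of "Suc i"] smono[of "Suc i" m] by (auto simp: cl_def max_def min_def)
  \<comment> \<open>Between two refined points the simple integrand has one value, so the block integrals are
    the finite sums of the domination inequality.\<close>
  have blockZ: "(LINT \<tau>:{s i<..s (Suc i)}|lborel. (\<phi> i \<omega> * simple_value n t \<xi> \<tau> \<omega> - \<psi> i \<omega>)\<^sup>2)
      = (\<Sum>j<n'. (z (i * n' + j) \<omega>)\<^sup>2 * (u (Suc (i * n' + j)) - u (i * n' + j)))" if i: "i < m" for i \<omega>
  proof -
    have "(\<phi> i \<omega> * simple_value n t \<xi> \<tau> \<omega> - \<psi> i \<omega>)\<^sup>2 = (z (i * n' + j) \<omega>)\<^sup>2"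
      if j: "j < n'" and \<tau>: "cl i (t' j) < \<tau>" "\<tau> \<le> cl i (t' (Suc j))" for j \<tau>
    proof -
      have "t' j < \<tau>" "\<tau> \<le> t' (Suc j)" using \<tau> s[OF i] by (auto simp: cl_def max_def min_def split: if_splits)
      then have "simple_value n t \<xi> \<tau> \<omega> = \<xi>' j \<omega>" using simple_value_eq[OF si' j, of \<tau> \<omega>] sv by simp
      moreover have "z (i * n' + j) \<omega> = \<phi> i \<omega> * \<xi>' j \<omega> - \<psi> i \<omega>"
        using z1[OF i j] \<tau> u1[OF j, of i] u2[OF i j] by simp
      ultimately show ?thesis by simp
    qed
    then have "(LINT \<tau>:{cl i (t' 0)<..cl i (t' n')}|lborel. (\<phi> i \<omega> * simple_value n t \<xi> \<tau> \<omega> - \<psi> i \<omega>)\<^sup>2)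
        = (\<Sum>j<n'. (z (i * n' + j) \<omega>)\<^sup>2 * (cl i (t' (Suc j)) - cl i (t' j)))"
      by (intro step_integral[of n' "\<lambda>j. cl i (t' j)", THEN conjunct2, THEN conjunct2])
        (use clmono in auto)
    then show ?thesis using ends[OF i] u1 u2[OF i] by simp
  qed
  have blockI: "I i \<omega> = (\<Sum>j<n'. z (i * n' + j) \<omega> * (W (u (Suc (i * n' + j))) \<omega> - W (u (i * n' + j)) \<omega>))"
    if i: "i < m" for i \<omega>
  proof -
    have clamp: "W (min (s (Suc i)) x) \<omega> - W (min (s i) x) \<omega> = W (cl i x) \<omega> - W (s i) \<omega>" for x
      using s[OF i] by (auto simp: cl_def max_def min_def)
    have "(\<Sum>j<n'. z (i * n' + j) \<omega> * (W (u (Suc (i * n' + j))) \<omega> - W (u (i * n' + j)) \<omega>))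
        = (\<Sum>j<n'. (\<phi> i \<omega> * \<xi>' j \<omega> - \<psi> i \<omega>) * (W (cl i (t' (Suc j))) \<omega> - W (cl i (t' j)) \<omega>))"
    proof (rule sum.cong[OF refl])
      fix j assume "j \<in> {..<n'}"
      then have j: "j < n'" by simp
      show "z (i * n' + j) \<omega> * (W (u (Suc (i * n' + j))) \<omega> - W (u (i * n' + j)) \<omega>)
          = (\<phi> i \<omega> * \<xi>' j \<omega> - \<psi> i \<omega>) * (W (cl i (t' (Suc j))) \<omega> - W (cl i (t' j)) \<omega>)"
      proof (cases "u (i * n' + j) < u (Suc (i * n' + j))")
        case True
        then show ?thesis using z1[OF i j] u1[OF j, of i] u2[OF i j] by simp
      next
        case False
        have "i * n' + j < Suc i * n'" using j by simp
        also have "Suc i * n' \<le> m * n'" using i by (intro mult_le_mono1) simp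
        finally have "u (Suc (i * n' + j)) = u (i * n' + j)" using False u[of "i * n' + j"] by simp
        then show ?thesis using u1[OF j, of i] u2[OF i j] by simp
      qed
    qed
    also have "\<dots> = \<phi> i \<omega> * (\<Sum>j<n'. \<xi>' j \<omega> * (W (cl i (t' (Suc j))) \<omega> - W (cl i (t' j)) \<omega>))
        - \<psi> i \<omega> * (\<Sum>j<n'. W (cl i (t' (Suc j))) \<omega> - W (cl i (t' j)) \<omega>)"
      unfolding sum_distrib_left sum_subtractf[symmetric] by (simp only: left_diff_distrib mult.assoc)
    also have "(\<Sum>j<n'. W (cl i (t' (Suc j))) \<omega> - W (cl i (t' j)) \<omega>) = W (s (Suc i)) \<omega> - W (s i) \<omega>"
      using sum_lessThan_telescope[of "\<lambda>j. W (cl i (t' j)) \<omega>" n'] ends[OF i] by simp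
    also have "(\<Sum>j<n'. \<xi>' j \<omega> * (W (cl i (t' (Suc j))) \<omega> - W (cl i (t' j)) \<omega>))
        = simple_ito_integral W n' t' \<xi>' (s (Suc i)) \<omega> - simple_ito_integral W n' t' \<xi>' (s i) \<omega>"
      unfolding simple_ito_integral_def sum_subtractf[symmetric]
    proof (rule sum.cong[OF refl])
      fix j
      have "W (cl i (t' (Suc j))) \<omega> - W (cl i (t' j)) \<omega>
          = (W (min (s (Suc i)) (t' (Suc j))) \<omega> - W (min (s (Suc i)) (t' j)) \<omega>)
          - (W (min (s i) (t' (Suc j))) \<omega> - W (min (s i) (t' j)) \<omega>)"
        using clamp[of "t' (Suc j)"] clamp[of "t' j"] by simp
      then show "\<xi>' j \<omega> * (W (cl i (t' (Suc j))) \<omega> - W (cl i (t' j)) \<omega>)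
        = \<xi>' j \<omega> * (W (min (s (Suc i)) (t' (Suc j))) \<omega> - W (min (s (Suc i)) (t' j)) \<omega>)
        - \<xi>' j \<omega> * (W (min (s i) (t' (Suc j))) \<omega> - W (min (s i) (t' j)) \<omega>)"
        by (simp add: right_diff_distrib)
    qed
    finally show ?thesis by (simp add: I_def sii)
  qed
  have Z: "Z \<omega> = (\<Sum>l<m * n'. (z l \<omega>)\<^sup>2 * (u (Suc l) - u l))" for \<omega>
    unfolding Z_def sum_blocks using blockZ by (intro sum.cong) auto
  have "(\<lambda>\<omega>. \<Sum>l<m * n'. (z l \<omega>)\<^sup>2 * (u (Suc l) - u l)) \<in> borel_measurable M"
    using measurable_F_M[OF zF]
    by (intro borel_measurable_sum borel_measurable_times borel_measurable_power) auto
  then show "Z \<in> borel_measurable M" unfolding Z .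
  show "expectation (\<lambda>\<omega>. min 1 (\<Sum>i<m. (I i \<omega>)\<^sup>2)) \<le> 2 * expectation (\<lambda>\<omega>. min 1 (Z \<omega>))"
    using domination[of u m n' z, OF u0 u zF] blockI Z by simp
  have "(\<Sum>l<m * n'. z l \<omega> * (W (u (Suc l)) \<omega> - W (u l) \<omega>)) = (\<Sum>i<m. I i \<omega>)" for \<omega>
    unfolding sum_blocks using blockI by simp
  then show "expectation (\<lambda>\<omega>. min 1 ((\<Sum>i<m. I i \<omega>)\<^sup>2)) \<le> 2 * expectation (\<lambda>\<omega>. min 1 (Z \<omega>))"
    using domination[of u 1 "m * n'" z] u0 u zF Z by simp
qed

end

section \<open>Convergence in probability as a mean\<close>

context prob_space
begin

lemma integrable_min_one:
  fixes Y :: "'a \<Rightarrow> real"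
  assumes "Y \<in> borel_measurable M" "\<And>\<omega>. 0 \<le> Y \<omega>"
  shows "integrable M (\<lambda>\<omega>. min 1 (Y \<omega>))"
  by (rule integrable_const_bound[where B = 1]) (use assms in auto)

lemma tendsto_expectation_min_one:
  fixes Y :: "nat \<Rightarrow> 'a \<Rightarrow> real"
  assumes [measurable]: "\<And>k. Y k \<in> borel_measurable M" "Z \<in> borel_measurable M"
    and nn: "\<And>k \<omega>. 0 \<le> Y k \<omega>"
    and lim: "AE \<omega> in M. (\<lambda>k. Y k \<omega>) \<longlonglongrightarrow> Z \<omega>"
  shows "(\<lambda>k. expectation (\<lambda>\<omega>. min 1 (Y k \<omega>))) \<longlonglongrightarrow> expectation (\<lambda>\<omega>. min 1 (Z \<omega>))"
proof (rule integral_dominated_convergence[where w = "\<lambda>_. 1"])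
  show "AE \<omega> in M. (\<lambda>k. min 1 (Y k \<omega>)) \<longlonglongrightarrow> min 1 (Z \<omega>)"
    using lim by eventually_elim (intro tendsto_min tendsto_const)
qed (use nn in auto)

text \<open>Convergence in probability is convergence in the mean of the distances cut off at 1. In this
  form it is compatible with the domination inequality and yields almost surely convergent
  subsequences.\<close>

lemma converges_in_probability_imp_mean:
  assumes "converges_in_probability M Y Z"
  shows "(\<lambda>k. expectation (\<lambda>\<omega>. min 1 \<bar>Y k \<omega> - Z \<omega>\<bar>)) \<longlonglongrightarrow> 0"
proof (rule LIMSEQ_I)
  have [measurable]: "\<And>k. Y k \<in> borel_measurable M" "Z \<in> borel_measurable M"
    using assms by (auto simp: converges_in_probability_def)
  fix e :: real assume e: "0 < e"
  have "(\<lambda>k. prob {\<omega> \<in> space M. e / 2 < \<bar>Y k \<omega> - Z \<omega>\<bar>}) \<longlonglongrightarrow> 0"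
    using assms e unfolding converges_in_probability_def by (auto simp only: half_gt_zero)
  then have "eventually (\<lambda>k. prob {\<omega> \<in> space M. e / 2 < \<bar>Y k \<omega> - Z \<omega>\<bar>} < e / 2) sequentially"
    using e by (intro order_tendstoD(2)) auto
  then obtain N where N: "\<And>k. N \<le> k \<Longrightarrow> prob {\<omega> \<in> space M. e / 2 < \<bar>Y k \<omega> - Z \<omega>\<bar>} < e / 2"
    unfolding eventually_sequentially by blast
  show "\<exists>N. \<forall>k\<ge>N. norm (expectation (\<lambda>\<omega>. min 1 \<bar>Y k \<omega> - Z \<omega>\<bar>) - 0) < e"
  proof (intro exI allI impI)
    fix k assume k: "N \<le> k"
    let ?B = "{\<omega> \<in> space M. e / 2 < \<bar>Y k \<omega> - Z \<omega>\<bar>}"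
    have "?B \<in> events" by measurable
    then have iB: "integrable M (indicator ?B :: 'a \<Rightarrow> real)"
      by (intro integrable_real_indicator) (auto simp: emeasure_eq_measure)
    have "expectation (\<lambda>\<omega>. min 1 \<bar>Y k \<omega> - Z \<omega>\<bar>) \<le> expectation (\<lambda>\<omega>. e / 2 + indicator ?B \<omega>)"
    proof (rule integral_mono)
      show "integrable M (\<lambda>\<omega>. min 1 \<bar>Y k \<omega> - Z \<omega>\<bar>)" by (rule integrable_min_one) auto
      show "integrable M (\<lambda>\<omega>. e / 2 + indicator ?B \<omega>)"
        by (intro Bochner_Integration.integrable_add integrable_const iB)
      show "min 1 \<bar>Y k \<omega> - Z \<omega>\<bar> \<le> e / 2 + indicator ?B \<omega>" if "\<omega> \<in> space M" for \<omega>
        using that e by (auto simp: indicator_def min_def)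
    qed
    also have "\<dots> = e / 2 + prob ?B"
      using \<open>?B \<in> events\<close> by (simp only: Bochner_Integration.integral_add[OF integrable_const iB])
        (simp add: prob_space)
    also have "\<dots> < e" using N[OF k] by simp
    finally have "expectation (\<lambda>\<omega>. min 1 \<bar>Y k \<omega> - Z \<omega>\<bar>) < e" .
    moreover have "0 \<le> expectation (\<lambda>\<omega>. min 1 \<bar>Y k \<omega> - Z \<omega>\<bar>)" by (rule integral_nonneg_AE) simp
    ultimately show "norm (expectation (\<lambda>\<omega>. min 1 \<bar>Y k \<omega> - Z \<omega>\<bar>) - 0) < e" by simp
  qed
qed

end

lemma tendsto_zero_of_min_one:
  fixes g :: "nat \<Rightarrow> real"
  assumes lim: "(\<lambda>k. min 1 (g k)) \<longlonglongrightarrow> 0"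
  shows "g \<longlonglongrightarrow> 0"
proof -
  have "eventually (\<lambda>k. min 1 (g k) < 1) sequentially"
    using lim by (rule order_tendstoD) simp
  then have "eventually (\<lambda>k. min 1 (g k) = g k) sequentially"
    by eventually_elim (auto simp: min_def split: if_splits)
  then show ?thesis using lim by (simp add: tendsto_cong)
qed

lemma tendsto_zero_of_scaled_bound:
  fixes a :: "nat \<Rightarrow> real"
  assumes C: "0 \<le> C"
    and a: "\<And>\<eta>. 0 < \<eta> \<Longrightarrow> \<eta> \<le> 1 / 2 \<Longrightarrow> eventually (\<lambda>k. \<bar>a k\<bar> \<le> C * \<eta>) sequentially"
  shows "a \<longlonglongrightarrow> 0"
proof (rule LIMSEQ_I)
  fix e :: real assume e: "0 < e"
  define \<eta> where "\<eta> = min (1 / 2) (e / (2 * (C + 1)))"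
  have \<eta>: "0 < \<eta>" "\<eta> \<le> 1 / 2" using C e unfolding \<eta>_def by (simp, intro min.cobounded1)
  have "C * \<eta> \<le> (C + 1) * (e / (2 * (C + 1)))" using C e \<eta>(1) by (intro mult_mono) (auto simp: \<eta>_def)
  also have "\<dots> = e / 2" using C by (simp add: field_simps)
  also have "\<dots> < e" using e by simp
  finally show "\<exists>no. \<forall>k\<ge>no. norm (a k - 0) < e"
    using a[OF \<eta>] unfolding eventually_sequentially by fastforce
qed

lemma tendsto_of_square_diff:
  fixes g :: "nat \<Rightarrow> real"
  assumes "(\<lambda>k. (g k - c)\<^sup>2) \<longlonglongrightarrow> 0"
  shows "g \<longlonglongrightarrow> c"
proof -
  have "(\<lambda>k. sqrt ((g k - c)\<^sup>2)) \<longlonglongrightarrow> sqrt 0" by (intro tendsto_real_sqrt assms)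
  then have "(\<lambda>k. \<bar>g k - c\<bar>) \<longlonglongrightarrow> 0" by simp
  then show ?thesis using LIM_zero_cancel tendsto_rabs_zero_iff by blast
qed

section \<open>Stochastic integrals along partitions\<close>

lemma simple_value_borel [measurable]: "(\<lambda>\<tau>. simple_value n t \<xi> \<tau> \<omega>) \<in> borel_measurable borel"
  unfolding simple_value_def by measurable

lemma simple_value_square_integrable:
  fixes h :: "real \<Rightarrow> real"
  assumes h: "continuous_on {a..b} h"
  shows "set_integrable lborel {a..b} (\<lambda>\<tau>. (c * simple_value n t \<xi> \<tau> \<omega> - h \<tau>)\<^sup>2)"
proof -
  have hi: "set_integrable lborel {a..b} h" using h by (rule borel_integrable_atLeastAtMost')
  obtain C where C: "\<And>\<tau>. \<tau> \<in> {a..b} \<Longrightarrow> \<bar>h \<tau>\<bar> \<le> C"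
    using compact_imp_bounded[OF compact_continuous_image[OF h]] unfolding bounded_iff by force
  define B where "B = (\<Sum>i<n. \<bar>\<xi> i \<omega>\<bar>)"
  have B: "\<bar>simple_value n t \<xi> \<tau> \<omega>\<bar> \<le> B" for \<tau>
    unfolding simple_value_def B_def
    by (rule order.trans[OF sum_abs]) (auto intro!: sum_mono simp: indicator_def)
  show ?thesis
  proof (rule set_integrable_bound[where f = "\<lambda>_. (\<bar>c\<bar> * B + C)\<^sup>2"])
    show "set_integrable lborel {a..b} (\<lambda>_. (\<bar>c\<bar> * B + C)\<^sup>2)"
      by (rule borel_integrable_atLeastAtMost') simp
    have [measurable]: "(\<lambda>\<tau>. indicator {a..b} \<tau> * h \<tau>) \<in> borel_measurable borel"
      using hi borel_measurable_integrable by (fastforce simp: set_integrable_def)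
    have "(\<lambda>\<tau>. (indicator {a..b} \<tau> * (c * simple_value n t \<xi> \<tau> \<omega>) - indicator {a..b} \<tau> * h \<tau>)\<^sup>2)
        \<in> borel_measurable borel" by measurable
    also have "(\<lambda>\<tau>. (indicator {a..b} \<tau> * (c * simple_value n t \<xi> \<tau> \<omega>) - indicator {a..b} \<tau> * h \<tau>)\<^sup>2)
        = (\<lambda>\<tau>. indicator {a..b} \<tau> *\<^sub>R (c * simple_value n t \<xi> \<tau> \<omega> - h \<tau>)\<^sup>2)"
      by (auto simp: indicator_def)
    finally show "set_borel_measurable lborel {a..b} (\<lambda>\<tau>. (c * simple_value n t \<xi> \<tau> \<omega> - h \<tau>)\<^sup>2)"
      by (simp add: set_borel_measurable_def)
    show "AE \<tau> in lborel. \<tau> \<in> {a..b} \<longrightarrow>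
        norm ((c * simple_value n t \<xi> \<tau> \<omega> - h \<tau>)\<^sup>2) \<le> norm ((\<bar>c\<bar> * B + C)\<^sup>2)"
    proof (intro AE_I2 impI)
      fix \<tau> assume "\<tau> \<in> {a..b}"
      have "\<bar>c * simple_value n t \<xi> \<tau> \<omega> - h \<tau>\<bar> \<le> \<bar>c\<bar> * \<bar>simple_value n t \<xi> \<tau> \<omega>\<bar> + \<bar>h \<tau>\<bar>"
        by (metis abs_mult abs_triangle_ineq4)
      also have "\<dots> \<le> \<bar>c\<bar> * B + C" using B C[OF \<open>\<tau> \<in> {a..b}\<close>] by (intro add_mono mult_left_mono) auto
      finally have "\<bar>c * simple_value n t \<xi> \<tau> \<omega> - h \<tau>\<bar>\<^sup>2 \<le> (\<bar>c\<bar> * B + C)\<^sup>2" by (intro power_mono) auto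
      then show "norm ((c * simple_value n t \<xi> \<tau> \<omega> - h \<tau>)\<^sup>2) \<le> norm ((\<bar>c\<bar> * B + C)\<^sup>2)" by simp
    qed
  qed
qed

lemma set_integral_blocks:
  fixes s :: "nat \<Rightarrow> real" and h :: "real \<Rightarrow> real"
  assumes "\<And>i. i < m \<Longrightarrow> s i \<le> s (Suc i)" and "set_integrable lborel {s 0<..s m} h"
  shows "s 0 \<le> s m \<and> (LINT \<tau>:{s 0<..s m}|lborel. h \<tau>) = (\<Sum>i<m. LINT \<tau>:{s i<..s (Suc i)}|lborel. h \<tau>)"
  using assms
proof (induction m)
  case 0
  then show ?case by (simp add: set_lebesgue_integral_def)
next
  case (Suc m)
  have le: "s m \<le> s (Suc m)" using Suc.prems(1) by simp
  have i1: "set_integrable lborel {s 0<..s m} h"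
    by (rule set_integrable_subset[OF Suc.prems(2)]) (use le in auto)
  then have IH: "s 0 \<le> s m" "(LINT \<tau>:{s 0<..s m}|lborel. h \<tau>) = (\<Sum>i<m. LINT \<tau>:{s i<..s (Suc i)}|lborel. h \<tau>)"
    using Suc by auto
  have i2: "set_integrable lborel {s m<..s (Suc m)} h"
    by (rule set_integrable_subset[OF Suc.prems(2)]) (use IH(1) in auto)
  have Un: "{s 0<..s (Suc m)} = {s 0<..s m} \<union> {s m<..s (Suc m)}" using IH(1) le by auto
  show ?case unfolding Un using IH le i1 i2 by (subst set_integral_Un) auto
qed

lemma set_integral_mono_nonneg_subset:
  fixes f :: "real \<Rightarrow> real"
  assumes i: "set_integrable lborel B f" and AB: "A \<subseteq> B" "A \<in> sets lborel" and nn: "\<And>x. 0 \<le> f x"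
  shows "(LINT x:A|lborel. f x) \<le> (LINT x:B|lborel. f x)"
proof -
  have "set_integrable lborel A f" by (rule set_integrable_subset[OF i]) (use AB in auto)
  then show ?thesis
    using i AB nn unfolding set_lebesgue_integral_def set_integrable_def
    by (intro integral_mono) (auto simp: indicator_def)
qed

lemma square_diff_le: "(a - c)\<^sup>2 \<le> 2 * (a - b)\<^sup>2 + 2 * (b - c)\<^sup>2" for a b c :: real
  using sum_squares_bound[of "a - b" "b - c"] by (simp add: power2_eq_square algebra_simps)

lemma min_one_add_le: "0 \<le> a \<Longrightarrow> 0 \<le> b \<Longrightarrow> c \<le> 2 * a + 2 * b \<Longrightarrow> min 1 c \<le> 2 * min 1 a + 2 * min 1 b"
  for a b c :: real
  by (auto simp: min_def)

context brownian
begin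

lemma simple_ito_integral_measurable:
  assumes "simple_integrand M F n t \<xi>" "0 \<le> T"
  shows "simple_ito_integral W n t \<xi> T \<in> borel_measurable M"
proof -
  have "\<xi> i \<in> borel_measurable M" if "i < n" for i
    using assms(1) that by (auto simp: simple_integrand_def intro: measurable_F_M)
  moreover have "0 \<le> t i" if "i \<le> n" for i
    using simple_integrand_mono[OF assms(1), of 0 i] that assms(1) by (simp add: simple_integrand_def)
  ultimately show ?thesis
    unfolding simple_ito_integral_def[abs_def] using assms(2)
    by (intro borel_measurable_sum borel_measurable_times borel_measurable_diff W_measurable) auto
qed

text \<open>The integral up to a later time restricts to the integral up to an earlier time: two
  approximating sequences differ by a simple integrand with small square integral, and the domination
  inequality makes the difference of the integrals small.\<close>

lemma ito_integral_restrict: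
  fixes n :: "nat \<Rightarrow> nat"
  assumes si: "\<And>k. simple_integrand M F (n k) (t k) (\<xi> k)"
    and app: "converges_in_probability M
      (\<lambda>k \<omega>. LINT s:{0..T}|lborel. (simple_value (n k) (t k) (\<xi> k) s \<omega> - H s \<omega>)\<^sup>2) (\<lambda>\<omega>. 0)"
    and H: "\<And>\<omega>. \<omega> \<in> space M \<Longrightarrow> continuous_on {0..} (\<lambda>s. H s \<omega>)"
    and S: "0 \<le> S" "S \<le> T" and ito: "has_ito_integral M F W H S I"
  shows "(\<lambda>k. expectation (\<lambda>\<omega>. min 1 ((simple_ito_integral W (n k) (t k) (\<xi> k) S \<omega> - I \<omega>)\<^sup>2))) \<longlonglongrightarrow> 0"
proof -
  obtain n' t' \<xi>' where si': "\<And>k. simple_integrand M F (n' k) (t' k) (\<xi>' k)"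
    and app': "converges_in_probability M
      (\<lambda>k \<omega>. LINT s:{0..S}|lborel. (simple_value (n' k) (t' k) (\<xi>' k) s \<omega> - H s \<omega>)\<^sup>2) (\<lambda>\<omega>. 0)"
    and conv': "converges_in_probability M (\<lambda>k. simple_ito_integral W (n' k) (t' k) (\<xi>' k) S) I"
    using ito unfolding has_ito_integral_def by blast
  define v where "v k \<tau> \<omega> = simple_value (n k) (t k) (\<xi> k) \<tau> \<omega>" for k \<tau> \<omega>
  define v' where "v' k \<tau> \<omega> = simple_value (n' k) (t' k) (\<xi>' k) \<tau> \<omega>" for k \<tau> \<omega>
  define A where "A k \<omega> = (LINT \<tau>:{0..T}|lborel. (v k \<tau> \<omega> - H \<tau> \<omega>)\<^sup>2)" for k \<omega>
  define B where "B k \<omega> = (LINT \<tau>:{0..S}|lborel. (v' k \<tau> \<omega> - H \<tau> \<omega>)\<^sup>2)" for k \<omega>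
  define J where "J k = simple_ito_integral W (n k) (t k) (\<xi> k) S" for k
  define J' where "J' k = simple_ito_integral W (n' k) (t' k) (\<xi>' k) S" for k
  have A0: "0 \<le> A k \<omega>" for k \<omega> unfolding A_def set_lebesgue_integral_def by (rule integral_nonneg_AE) auto
  have B0: "0 \<le> B k \<omega>" for k \<omega> unfolding B_def set_lebesgue_integral_def by (rule integral_nonneg_AE) auto
  have app: "converges_in_probability M A (\<lambda>\<omega>. 0)" using app by (simp add: A_def[abs_def] v_def)
  have app': "converges_in_probability M B (\<lambda>\<omega>. 0)" using app' by (simp add: B_def[abs_def] v'_def)
  have [measurable]: "A k \<in> borel_measurable M" "B k \<in> borel_measurable M" for k
    using app app' by (simp_all add: converges_in_probability_def)
  have [measurable]: "J k \<in> borel_measurable M" "J' k \<in> borel_measurable M" for k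
    unfolding J_def J'_def using simple_ito_integral_measurable si si' S by auto
  have [measurable]: "I \<in> borel_measurable M" using conv' by (simp add: converges_in_probability_def)
  have iA: "integrable M (\<lambda>\<omega>. min 1 (A k \<omega>))" for k by (rule integrable_min_one) (use A0 in auto)
  have iB: "integrable M (\<lambda>\<omega>. min 1 (B k \<omega>))" for k by (rule integrable_min_one) (use B0 in auto)
  have diff: "expectation (\<lambda>\<omega>. min 1 ((J k \<omega> - J' k \<omega>)\<^sup>2))
      \<le> 4 * expectation (\<lambda>\<omega>. min 1 (A k \<omega>)) + 4 * expectation (\<lambda>\<omega>. min 1 (B k \<omega>))" for k
  proof -
    obtain n2 t2 \<xi>2 where si2: "simple_integrand M F n2 t2 \<xi>2" and t20: "t2 0 = 0" and t2n: "S \<le> t2 n2"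
      and sv: "\<And>\<tau> \<omega>. simple_value n2 t2 \<xi>2 \<tau> \<omega> = v' k \<tau> \<omega>"
      and sii: "\<And>\<tau> \<omega>. simple_ito_integral W n2 t2 \<xi>2 \<tau> \<omega> = simple_ito_integral W (n' k) (t' k) (\<xi>' k) \<tau> \<omega>"
      unfolding v'_def using simple_integrand_extend[OF si'[of k], of S W] by metis
    define s where "s i = min S (t2 i)" for i
    define \<psi> where "\<psi> i = (if t2 i \<le> S then \<xi>2 i else (\<lambda>_. 0))" for i
    have s0: "s 0 = 0" and sn: "s n2 = S" using S t20 t2n by (auto simp: s_def)
    have s: "s i \<le> s (Suc i)" if "i < n2" for i
      using simple_integrand_mono[OF si2, of i "Suc i"] that by (auto simp: s_def)
    have \<psi>: "\<psi> i \<in> borel_measurable (F (s i))" if "i < n2" for i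
      using si2 that by (auto simp: simple_integrand_def \<psi>_def s_def min_absorb2)
    define Z where "Z \<omega> = (\<Sum>i<n2. LINT \<tau>:{s i<..s (Suc i)}|lborel. (1 * v k \<tau> \<omega> - \<psi> i \<omega>)\<^sup>2)" for \<omega>
    note RD = refinement_domination[OF si[of k], of s n2 "\<lambda>_ _. 1" \<psi>, folded v_def, folded Z_def]
    have ZM [measurable]: "Z \<in> borel_measurable M" using RD(1) s0 s \<psi> by (simp add: Z_def[abs_def])
    have sumI: "(\<Sum>i<n2. 1 * (simple_ito_integral W (n k) (t k) (\<xi> k) (s (Suc i)) \<omega> - simple_ito_integral W (n k) (t k) (\<xi> k) (s i) \<omega>)
        - \<psi> i \<omega> * (W (s (Suc i)) \<omega> - W (s i) \<omega>)) = J k \<omega> - J' k \<omega>" for \<omega>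
    proof -
      have "0 \<le> t k i" if "i \<le> n k" for i
        using simple_integrand_mono[OF si[of k], of 0 i] that si[of k] by (simp add: simple_integrand_def)
      then have "simple_ito_integral W (n k) (t k) (\<xi> k) 0 \<omega> = 0"
        by (simp add: simple_ito_integral_def min_absorb1)
      moreover have "(\<Sum>i<n2. \<psi> i \<omega> * (W (s (Suc i)) \<omega> - W (s i) \<omega>)) = simple_ito_integral W n2 t2 \<xi>2 S \<omega>"
        unfolding simple_ito_integral_def
      proof (intro sum.cong refl)
        fix i assume "i \<in> {..<n2}"
        then have "t2 i \<le> t2 (Suc i)" using simple_integrand_mono[OF si2, of i "Suc i"] by simp
        then show "\<psi> i \<omega> * (W (s (Suc i)) \<omega> - W (s i) \<omega>) = \<xi>2 i \<omega> * (W (min S (t2 (Suc i))) \<omega> - W (min S (t2 i)) \<omega>)"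
          by (auto simp: \<psi>_def s_def min_absorb1)
      qed
      ultimately show ?thesis
        using sum_lessThan_telescope[of "\<lambda>i. simple_ito_integral W (n k) (t k) (\<xi> k) (s i) \<omega>" n2]
        by (simp add: sum_subtractf s0 sn sii J_def J'_def)
    qed
    have le: "expectation (\<lambda>\<omega>. min 1 ((J k \<omega> - J' k \<omega>)\<^sup>2)) \<le> 2 * expectation (\<lambda>\<omega>. min 1 (Z \<omega>))"
      using RD(3) s0 s \<psi> unfolding sumI by (simp add: Z_def[abs_def])
    have Z: "Z \<omega> \<le> 2 * A k \<omega> + 2 * B k \<omega>" if \<omega>: "\<omega> \<in> space M" for \<omega>
    proof -
      have HT: "continuous_on {0..T} (\<lambda>\<tau>. H \<tau> \<omega>)" and HS: "continuous_on {0..S} (\<lambda>\<tau>. H \<tau> \<omega>)"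
        using continuous_on_subset[OF H[OF \<omega>]] by auto
      have IA: "set_integrable lborel {0..T} (\<lambda>\<tau>. (v k \<tau> \<omega> - H \<tau> \<omega>)\<^sup>2)"
        using simple_value_square_integrable[OF HT, of 1] by (simp add: v_def)
      have IB: "set_integrable lborel {0..S} (\<lambda>\<tau>. (v' k \<tau> \<omega> - H \<tau> \<omega>)\<^sup>2)"
        using simple_value_square_integrable[OF HS, of 1] by (simp add: v'_def)
      let ?g = "\<lambda>\<tau>. 2 * (v k \<tau> \<omega> - H \<tau> \<omega>)\<^sup>2 + 2 * (v' k \<tau> \<omega> - H \<tau> \<omega>)\<^sup>2"
      have IA': "set_integrable lborel {0<..S} (\<lambda>\<tau>. (v k \<tau> \<omega> - H \<tau> \<omega>)\<^sup>2)"
        by (rule set_integrable_subset[OF IA]) (use S in auto)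
      have IB': "set_integrable lborel {0<..S} (\<lambda>\<tau>. (v' k \<tau> \<omega> - H \<tau> \<omega>)\<^sup>2)"
        by (rule set_integrable_subset[OF IB]) (use S in auto)
      have Ig: "set_integrable lborel {0<..S} ?g" using IA' IB' by auto
      have "Z \<omega> \<le> (\<Sum>i<n2. LINT \<tau>:{s i<..s (Suc i)}|lborel. ?g \<tau>)"
        unfolding Z_def
      proof (rule sum_mono)
        fix i assume "i \<in> {..<n2}"
        then have i: "i < n2" by simp
        have sub: "{s i<..s (Suc i)} \<subseteq> {0<..S}"
          using simple_integrand_mono[OF si2, of 0 i] i t20 S by (auto simp: s_def)
        have "set_integrable lborel {s i<..s (Suc i)} (\<lambda>\<tau>. (1 * v k \<tau> \<omega> - \<psi> i \<omega>)\<^sup>2)"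
          unfolding v_def
          by (rule set_integrable_subset[OF simple_value_square_integrable[where a = 0 and b = S]])
            (use sub in auto)
        moreover have "set_integrable lborel {s i<..s (Suc i)} ?g"
          by (rule set_integrable_subset[OF Ig]) (use sub in auto)
        moreover have "(1 * v k \<tau> \<omega> - \<psi> i \<omega>)\<^sup>2 \<le> ?g \<tau>" if "\<tau> \<in> {s i<..s (Suc i)}" for \<tau>
        proof -
          have "t2 i < \<tau>" "\<tau> \<le> t2 (Suc i)" "t2 i \<le> S" using that by (auto simp: s_def min_def split: if_splits)
          then have "\<psi> i \<omega> = v' k \<tau> \<omega>" using simple_value_eq[OF si2 i] sv by (simp add: \<psi>_def)
          then show ?thesis
            using square_diff_le[of "v k \<tau> \<omega>" "v' k \<tau> \<omega>" "H \<tau> \<omega>"] by (simp add: power2_commute[of "H \<tau> \<omega>"])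
        qed
        ultimately show "(LINT \<tau>:{s i<..s (Suc i)}|lborel. (1 * v k \<tau> \<omega> - \<psi> i \<omega>)\<^sup>2)
            \<le> (LINT \<tau>:{s i<..s (Suc i)}|lborel. ?g \<tau>)"
          by (rule set_integral_mono)
      qed
      also have "\<dots> = (LINT \<tau>:{0<..S}|lborel. ?g \<tau>)"
        using set_integral_blocks[of n2 s ?g] s Ig s0 sn by simp
      also have "\<dots> = 2 * (LINT \<tau>:{0<..S}|lborel. (v k \<tau> \<omega> - H \<tau> \<omega>)\<^sup>2) + 2 * (LINT \<tau>:{0<..S}|lborel. (v' k \<tau> \<omega> - H \<tau> \<omega>)\<^sup>2)"
        using IA' IB' by (subst set_integral_add) auto
      also have "\<dots> \<le> 2 * A k \<omega> + 2 * B k \<omega>"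
        unfolding A_def B_def using S
        by (intro add_mono mult_left_mono set_integral_mono_nonneg_subset IA IB) auto
      finally show ?thesis .
    qed
    have Z0: "0 \<le> Z \<omega>" for \<omega>
      unfolding Z_def set_lebesgue_integral_def by (intro sum_nonneg integral_nonneg_AE) auto
    have "expectation (\<lambda>\<omega>. min 1 (Z \<omega>)) \<le> expectation (\<lambda>\<omega>. 2 * min 1 (A k \<omega>) + 2 * min 1 (B k \<omega>))"
      using iA iB A0 B0 Z Z0
      by (intro integral_mono min_one_add_le integrable_min_one) auto
    also have "\<dots> = 2 * expectation (\<lambda>\<omega>. min 1 (A k \<omega>)) + 2 * expectation (\<lambda>\<omega>. min 1 (B k \<omega>))"
      using iA iB by simp
    finally show ?thesis using le by simp
  qed
  have bound: "expectation (\<lambda>\<omega>. min 1 ((J k \<omega> - I \<omega>)\<^sup>2)) \<le>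
      8 * expectation (\<lambda>\<omega>. min 1 (A k \<omega>)) + 8 * expectation (\<lambda>\<omega>. min 1 (B k \<omega>))
      + 2 * expectation (\<lambda>\<omega>. min 1 \<bar>J' k \<omega> - I \<omega>\<bar>)" for k
  proof -
    have i1: "integrable M (\<lambda>\<omega>. min 1 ((J k \<omega> - J' k \<omega>)\<^sup>2))" by (rule integrable_min_one) auto
    have i2: "integrable M (\<lambda>\<omega>. min 1 \<bar>J' k \<omega> - I \<omega>\<bar>)" by (rule integrable_min_one) auto
    have "expectation (\<lambda>\<omega>. min 1 ((J k \<omega> - I \<omega>)\<^sup>2)) \<le>
        expectation (\<lambda>\<omega>. 2 * min 1 ((J k \<omega> - J' k \<omega>)\<^sup>2) + 2 * min 1 \<bar>J' k \<omega> - I \<omega>\<bar>)"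
    proof (rule integral_mono)
      fix \<omega>
      have "min 1 (y\<^sup>2) \<le> min 1 \<bar>y\<bar>" for y :: real
      proof (cases "\<bar>y\<bar> \<le> 1")
        case True
        then have "\<bar>y\<bar> * \<bar>y\<bar> \<le> \<bar>y\<bar> * 1" by (intro mult_left_mono) auto
        then show ?thesis by (simp add: power2_eq_square)
      qed auto
      then have "2 * min 1 ((J' k \<omega> - I \<omega>)\<^sup>2) \<le> 2 * min 1 \<bar>J' k \<omega> - I \<omega>\<bar>" by simp
      moreover have "min 1 ((J k \<omega> - I \<omega>)\<^sup>2) \<le> 2 * min 1 ((J k \<omega> - J' k \<omega>)\<^sup>2) + 2 * min 1 ((J' k \<omega> - I \<omega>)\<^sup>2)"
        by (rule min_one_add_le[OF _ _ square_diff_le]) auto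
      ultimately show "min 1 ((J k \<omega> - I \<omega>)\<^sup>2) \<le> 2 * min 1 ((J k \<omega> - J' k \<omega>)\<^sup>2) + 2 * min 1 \<bar>J' k \<omega> - I \<omega>\<bar>"
        by linarith
    qed (use i1 i2 in \<open>auto intro!: integrable_min_one\<close>)
    also have "\<dots> = 2 * expectation (\<lambda>\<omega>. min 1 ((J k \<omega> - J' k \<omega>)\<^sup>2)) + 2 * expectation (\<lambda>\<omega>. min 1 \<bar>J' k \<omega> - I \<omega>\<bar>)"
      using i1 i2 by simp
    finally show ?thesis using diff[of k] by simp
  qed
  have "(\<lambda>k. 8 * expectation (\<lambda>\<omega>. min 1 (A k \<omega>)) + 8 * expectation (\<lambda>\<omega>. min 1 (B k \<omega>))
      + 2 * expectation (\<lambda>\<omega>. min 1 \<bar>J' k \<omega> - I \<omega>\<bar>)) \<longlonglongrightarrow> 8 * 0 + 8 * 0 + 2 * 0"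
    using converges_in_probability_imp_mean[OF app] converges_in_probability_imp_mean[OF app']
      converges_in_probability_imp_mean[OF conv'] A0 B0
    by (intro tendsto_add tendsto_mult tendsto_const) (simp_all add: J'_def)
  then have up: "(\<lambda>k. 8 * expectation (\<lambda>\<omega>. min 1 (A k \<omega>)) + 8 * expectation (\<lambda>\<omega>. min 1 (B k \<omega>))
      + 2 * expectation (\<lambda>\<omega>. min 1 \<bar>J' k \<omega> - I \<omega>\<bar>)) \<longlonglongrightarrow> 0" by simp
  have "(\<lambda>k. expectation (\<lambda>\<omega>. min 1 ((J k \<omega> - I \<omega>)\<^sup>2))) \<longlonglongrightarrow> 0"
    by (rule tendsto_sandwich[OF _ _ tendsto_const up])
      (use bound in \<open>auto intro!: always_eventually integral_nonneg_AE\<close>)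
  then show ?thesis by (simp add: J_def)
qed

end

context brownian
begin

text \<open>The domination inequality passes to the limit along the approximating simple integrands, which
  by the restriction lemma approximate the integrals up to all points of the coarse partition at
  once. The multiplier \<open>\<phi> i\<close> is a finite random variable, so multiplying by it preserves almost
  sure convergence; this is why the limit is taken along an almost surely convergent subsequence.\<close>

lemma ito_block_error:
  fixes m :: nat and s :: "nat \<Rightarrow> real" and \<phi> \<psi> :: "nat \<Rightarrow> 'w \<Rightarrow> real" and I :: "real \<Rightarrow> 'w \<Rightarrow> real"
  assumes H: "\<And>\<omega>. \<omega> \<in> space M \<Longrightarrow> continuous_on {0..} (\<lambda>s. H s \<omega>)"
    and ito: "\<And>t. 0 \<le> t \<Longrightarrow> t \<le> T \<Longrightarrow> has_ito_integral M F W H t (I t)"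
    and s0: "0 \<le> s 0" and s: "\<And>i. i < m \<Longrightarrow> s i \<le> s (Suc i)" and sm: "s m \<le> T"
    and \<phi>: "\<And>i. i < m \<Longrightarrow> \<phi> i \<in> borel_measurable (F (s i))"
    and \<psi>: "\<And>i. i < m \<Longrightarrow> \<psi> i \<in> borel_measurable (F (s i))"
  defines "e \<equiv> \<lambda>i \<omega>. \<phi> i \<omega> * (I (s (Suc i)) \<omega> - I (s i) \<omega>) - \<psi> i \<omega> * (W (s (Suc i)) \<omega> - W (s i) \<omega>)"
    and "D \<equiv> \<lambda>\<omega>. \<Sum>i<m. LINT \<tau>:{s i<..s (Suc i)}|lborel. (\<phi> i \<omega> * H \<tau> \<omega> - \<psi> i \<omega>)\<^sup>2"
  assumes DM [measurable]: "D \<in> borel_measurable M"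
  shows "expectation (\<lambda>\<omega>. min 1 (\<Sum>i<m. (e i \<omega>)\<^sup>2)) \<le> 2 * expectation (\<lambda>\<omega>. min 1 (2 * D \<omega>))"
    and "expectation (\<lambda>\<omega>. min 1 ((\<Sum>i<m. e i \<omega>)\<^sup>2)) \<le> 2 * expectation (\<lambda>\<omega>. min 1 (2 * D \<omega>))"
proof -
  have smono: "s i \<le> s k" if "i \<le> k" "k \<le> m" for i k
    by (rule monotone_steps[where u = s, OF s that])
  have s_nn: "0 \<le> s i" and s_T: "s i \<le> T" if "i \<le> m" for i
    using smono[of 0 i] smono[of i m] s0 sm that by auto
  have T: "0 \<le> T" using s_nn[of 0] s_T[of 0] by simp
  obtain n t \<xi> where si: "\<And>k. simple_integrand M F (n k) (t k) (\<xi> k)"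
    and app: "converges_in_probability M
      (\<lambda>k \<omega>. LINT s:{0..T}|lborel. (simple_value (n k) (t k) (\<xi> k) s \<omega> - H s \<omega>)\<^sup>2) (\<lambda>\<omega>. 0)"
    using ito[OF T order_refl] unfolding has_ito_integral_def by blast
  define v where "v k \<tau> \<omega> = simple_value (n k) (t k) (\<xi> k) \<tau> \<omega>" for k \<tau> \<omega>
  define A where "A k \<omega> = (LINT \<tau>:{0..T}|lborel. (v k \<tau> \<omega> - H \<tau> \<omega>)\<^sup>2)" for k \<omega>
  define J where "J k i = simple_ito_integral W (n k) (t k) (\<xi> k) (s i)" for k i
  define C where "C \<omega> = (\<Sum>i<m. (\<phi> i \<omega>)\<^sup>2)" for \<omega>
  define Z where "Z k \<omega> = (\<Sum>i<m. LINT \<tau>:{s i<..s (Suc i)}|lborel. (\<phi> i \<omega> * v k \<tau> \<omega> - \<psi> i \<omega>)\<^sup>2)" for k \<omega>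
  define ek where "ek k i \<omega> = \<phi> i \<omega> * (J k (Suc i) \<omega> - J k i \<omega>) - \<psi> i \<omega> * (W (s (Suc i)) \<omega> - W (s i) \<omega>)" for k i \<omega>
  have A0: "0 \<le> A k \<omega>" for k \<omega> unfolding A_def set_lebesgue_integral_def by (rule integral_nonneg_AE) auto
  have D0: "0 \<le> D \<omega>" for \<omega>
    unfolding D_def set_lebesgue_integral_def by (intro sum_nonneg integral_nonneg_AE) auto
  have Z0: "0 \<le> Z k \<omega>" for k \<omega>
    unfolding Z_def set_lebesgue_integral_def by (intro sum_nonneg integral_nonneg_AE) auto
  have C0: "0 \<le> C \<omega>" for \<omega> unfolding C_def by (intro sum_nonneg) auto
  have app: "converges_in_probability M A (\<lambda>\<omega>. 0)" using app by (simp add: A_def[abs_def] v_def)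
  have AM [measurable]: "A k \<in> borel_measurable M" for k using app by (simp add: converges_in_probability_def)
  have JM [measurable]: "J k i \<in> borel_measurable M" if "i \<le> m" for k i
    unfolding J_def using simple_ito_integral_measurable[OF si s_nn[OF that]] .
  have IM [measurable]: "I (s i) \<in> borel_measurable M" if "i \<le> m" for i
    using ito[OF s_nn[OF that] s_T[OF that]] by (auto simp: has_ito_integral_def converges_in_probability_def)
  have \<phi>M [measurable]: "\<phi> i \<in> borel_measurable M" if "i < m" for i using measurable_F_M[OF \<phi>[OF that]] .
  have \<psi>M [measurable]: "\<psi> i \<in> borel_measurable M" if "i < m" for i using measurable_F_M[OF \<psi>[OF that]] .
  have WM [measurable]: "W (s i) \<in> borel_measurable M" if "i \<le> m" for i using s_nn[OF that] by simp
  have CM [measurable]: "C \<in> borel_measurable M" unfolding C_def[abs_def] by measurable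
  have eM [measurable]: "e i \<in> borel_measurable M" if "i < m" for i
    unfolding e_def using that by (intro borel_measurable_times borel_measurable_diff \<phi>M \<psi>M IM WM) auto
  have ekM [measurable]: "ek k i \<in> borel_measurable M" if "i < m" for k i
    unfolding ek_def[abs_def] using that by (intro borel_measurable_times borel_measurable_diff \<phi>M \<psi>M JM WM) auto
  note RD = refinement_domination[OF si, of s m \<phi> \<psi>, OF s0 s \<phi> \<psi>, folded v_def J_def]
  have ZM [measurable]: "Z k \<in> borel_measurable M" for k
    unfolding Z_def[abs_def] by (rule RD(1))
  have b1: "expectation (\<lambda>\<omega>. min 1 (\<Sum>i<m. (ek k i \<omega>)\<^sup>2)) \<le> 2 * expectation (\<lambda>\<omega>. min 1 (Z k \<omega>))" for k
    unfolding ek_def Z_def by (rule RD(2))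
  have b2: "expectation (\<lambda>\<omega>. min 1 ((\<Sum>i<m. ek k i \<omega>)\<^sup>2)) \<le> 2 * expectation (\<lambda>\<omega>. min 1 (Z k \<omega>))" for k
    unfolding ek_def Z_def by (rule RD(3))
  have Zle: "Z k \<omega> \<le> 2 * (C \<omega> * A k \<omega>) + 2 * D \<omega>" if \<omega>: "\<omega> \<in> space M" for k \<omega>
  proof -
    have HT: "continuous_on {0..T} (\<lambda>\<tau>. H \<tau> \<omega>)" using continuous_on_subset[OF H[OF \<omega>]] by auto
    have IA: "set_integrable lborel {0..T} (\<lambda>\<tau>. (v k \<tau> \<omega> - H \<tau> \<omega>)\<^sup>2)"
      using simple_value_square_integrable[OF HT, of 1] by (simp add: v_def)
    have "(LINT \<tau>:{s i<..s (Suc i)}|lborel. (\<phi> i \<omega> * v k \<tau> \<omega> - \<psi> i \<omega>)\<^sup>2)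
        \<le> 2 * ((\<phi> i \<omega>)\<^sup>2 * A k \<omega>) + 2 * (LINT \<tau>:{s i<..s (Suc i)}|lborel. (\<phi> i \<omega> * H \<tau> \<omega> - \<psi> i \<omega>)\<^sup>2)"
      if i: "i < m" for i
    proof -
      have sub: "{s i<..s (Suc i)} \<subseteq> {0..T}" using s_nn[of i] s_T[of "Suc i"] i by auto
      have IA': "set_integrable lborel {s i<..s (Suc i)} (\<lambda>\<tau>. (v k \<tau> \<omega> - H \<tau> \<omega>)\<^sup>2)"
        by (rule set_integrable_subset[OF IA]) (use sub in auto)
      have I1: "set_integrable lborel {s i<..s (Suc i)} (\<lambda>\<tau>. (\<phi> i \<omega> * v k \<tau> \<omega> - \<psi> i \<omega>)\<^sup>2)"
        unfolding v_def
        by (rule set_integrable_subset[OF simple_value_square_integrable[where a = 0 and b = T]])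
          (use sub in auto)
      have "continuous_on {0..T} (\<lambda>\<tau>. (\<phi> i \<omega> * H \<tau> \<omega> - \<psi> i \<omega>)\<^sup>2)"
        using HT by (intro continuous_intros)
      then have I2: "set_integrable lborel {s i<..s (Suc i)} (\<lambda>\<tau>. (\<phi> i \<omega> * H \<tau> \<omega> - \<psi> i \<omega>)\<^sup>2)"
        by (intro set_integrable_subset[OF borel_integrable_atLeastAtMost']) (use sub in auto)
      have "(LINT \<tau>:{s i<..s (Suc i)}|lborel. (\<phi> i \<omega> * v k \<tau> \<omega> - \<psi> i \<omega>)\<^sup>2)
          \<le> (LINT \<tau>:{s i<..s (Suc i)}|lborel. 2 * (\<phi> i \<omega>)\<^sup>2 * (v k \<tau> \<omega> - H \<tau> \<omega>)\<^sup>2 + 2 * (\<phi> i \<omega> * H \<tau> \<omega> - \<psi> i \<omega>)\<^sup>2)"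
      proof (rule set_integral_mono[OF I1])
        show "set_integrable lborel {s i<..s (Suc i)}
          (\<lambda>\<tau>. 2 * (\<phi> i \<omega>)\<^sup>2 * (v k \<tau> \<omega> - H \<tau> \<omega>)\<^sup>2 + 2 * (\<phi> i \<omega> * H \<tau> \<omega> - \<psi> i \<omega>)\<^sup>2)"
          using IA' I2 by auto
        fix \<tau>
        have "(\<phi> i \<omega> * v k \<tau> \<omega> - \<phi> i \<omega> * H \<tau> \<omega>)\<^sup>2 = (\<phi> i \<omega>)\<^sup>2 * (v k \<tau> \<omega> - H \<tau> \<omega>)\<^sup>2"
          by (simp add: power_mult_distrib flip: right_diff_distrib)
        then show "(\<phi> i \<omega> * v k \<tau> \<omega> - \<psi> i \<omega>)\<^sup>2
            \<le> 2 * (\<phi> i \<omega>)\<^sup>2 * (v k \<tau> \<omega> - H \<tau> \<omega>)\<^sup>2 + 2 * (\<phi> i \<omega> * H \<tau> \<omega> - \<psi> i \<omega>)\<^sup>2"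
          using square_diff_le[of "\<phi> i \<omega> * v k \<tau> \<omega>" "\<psi> i \<omega>" "\<phi> i \<omega> * H \<tau> \<omega>"] by simp
      qed
      also have "\<dots> = 2 * (\<phi> i \<omega>)\<^sup>2 * (LINT \<tau>:{s i<..s (Suc i)}|lborel. (v k \<tau> \<omega> - H \<tau> \<omega>)\<^sup>2)
          + 2 * (LINT \<tau>:{s i<..s (Suc i)}|lborel. (\<phi> i \<omega> * H \<tau> \<omega> - \<psi> i \<omega>)\<^sup>2)"
        using IA' I2 by (subst set_integral_add) auto
      also have "\<dots> \<le> 2 * (\<phi> i \<omega>)\<^sup>2 * A k \<omega>
          + 2 * (LINT \<tau>:{s i<..s (Suc i)}|lborel. (\<phi> i \<omega> * H \<tau> \<omega> - \<psi> i \<omega>)\<^sup>2)"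
        unfolding A_def
        by (intro add_right_mono mult_left_mono set_integral_mono_nonneg_subset[OF IA]) (use sub in auto)
      finally show ?thesis by simp
    qed
    then have "Z k \<omega> \<le> (\<Sum>i<m. 2 * ((\<phi> i \<omega>)\<^sup>2 * A k \<omega>)
        + 2 * (LINT \<tau>:{s i<..s (Suc i)}|lborel. (\<phi> i \<omega> * H \<tau> \<omega> - \<psi> i \<omega>)\<^sup>2))"
      unfolding Z_def by (intro sum_mono) auto
    also have "\<dots> = 2 * (C \<omega> * A k \<omega>) + 2 * D \<omega>"
      by (simp add: C_def D_def sum.distrib sum_distrib_left sum_distrib_right mult.assoc)
    finally show ?thesis .
  qed
  \<comment> \<open>One sequence collects everything that has to converge, so that a single subsequence converges
    almost surely.\<close>
  define G where "G k \<omega> = min 1 (A k \<omega>) + (\<Sum>i<Suc m. min 1 ((J k i \<omega> - I (s i) \<omega>)\<^sup>2))" for k \<omega>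
  have iA: "integrable M (\<lambda>\<omega>. min 1 (A k \<omega>))" for k by (rule integrable_min_one) (use A0 in auto)
  have iJ: "integrable M (\<lambda>\<omega>. min 1 ((J k i \<omega> - I (s i) \<omega>)\<^sup>2))" if "i \<le> m" for k i
    using that by (intro integrable_min_one borel_measurable_power borel_measurable_diff JM IM) auto
  have iG: "integrable M (G k)" for k
    unfolding G_def[abs_def] using iA iJ
    by (intro Bochner_Integration.integrable_add Bochner_Integration.integrable_sum) auto
  have G0: "0 \<le> G k \<omega>" for k \<omega> unfolding G_def using A0 by (intro add_nonneg_nonneg sum_nonneg) auto
  have EG: "expectation (G k) = expectation (\<lambda>\<omega>. min 1 (A k \<omega>)) + (\<Sum>i<Suc m. expectation (\<lambda>\<omega>. min 1 ((J k i \<omega> - I (s i) \<omega>)\<^sup>2)))" for k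
  proof -
    have "expectation (G k) = expectation (\<lambda>\<omega>. min 1 (A k \<omega>)) + expectation (\<lambda>\<omega>. \<Sum>i<Suc m. min 1 ((J k i \<omega> - I (s i) \<omega>)\<^sup>2))"
      unfolding G_def[abs_def] using iA iJ
      by (intro Bochner_Integration.integral_add Bochner_Integration.integrable_sum) auto
    also have "expectation (\<lambda>\<omega>. \<Sum>i<Suc m. min 1 ((J k i \<omega> - I (s i) \<omega>)\<^sup>2))
        = (\<Sum>i<Suc m. expectation (\<lambda>\<omega>. min 1 ((J k i \<omega> - I (s i) \<omega>)\<^sup>2)))"
      using iJ by (intro Bochner_Integration.integral_sum) auto
    finally show ?thesis .
  qed
  have "(\<lambda>k. expectation (\<lambda>\<omega>. min 1 (A k \<omega>))) \<longlonglongrightarrow> 0"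
    using converges_in_probability_imp_mean[OF app] A0 by simp
  moreover have "(\<lambda>k. expectation (\<lambda>\<omega>. min 1 ((J k i \<omega> - I (s i) \<omega>)\<^sup>2))) \<longlonglongrightarrow> 0" if "i \<le> m" for i
    unfolding J_def
    by (rule ito_integral_restrict[OF si _ H s_nn[OF that] s_T[OF that] ito[OF s_nn[OF that] s_T[OF that]]])
      (use app in \<open>simp_all add: A_def[abs_def] v_def\<close>)
  ultimately have "(\<lambda>k. expectation (G k)) \<longlonglongrightarrow> 0 + (\<Sum>i<Suc m. 0)"
    unfolding EG by (intro tendsto_add tendsto_sum) auto
  then have "(\<lambda>k. expectation (\<lambda>\<omega>. norm (G k \<omega>))) \<longlonglongrightarrow> 0" using G0 by simp
  then obtain r where r: "strict_mono r" and AE_G: "AE \<omega> in M. (\<lambda>k. G (r k) \<omega>) \<longlonglongrightarrow> 0"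
    using tendsto_L1_AE_subseq[of M G] iG by blast
  have pointwise: "(\<lambda>k. A (r k) \<omega>) \<longlonglongrightarrow> 0 \<and> (\<forall>i<m. (\<lambda>k. ek (r k) i \<omega>) \<longlonglongrightarrow> e i \<omega>)"
    if lim: "(\<lambda>k. G (r k) \<omega>) \<longlonglongrightarrow> 0" for \<omega>
  proof -
    have le1: "min 1 (A k \<omega>) \<le> G k \<omega>" for k unfolding G_def by (simp add: sum_nonneg)
    have "(\<lambda>k. min 1 (A (r k) \<omega>)) \<longlonglongrightarrow> 0"
      by (rule tendsto_sandwich[OF _ _ tendsto_const lim]) (use A0 le1 in auto)
    then have A: "(\<lambda>k. A (r k) \<omega>) \<longlonglongrightarrow> 0" by (rule tendsto_zero_of_min_one)
    have J: "(\<lambda>k. J (r k) i \<omega>) \<longlonglongrightarrow> I (s i) \<omega>" if i: "i \<le> m" for i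
    proof -
      have le2: "min 1 ((J k i \<omega> - I (s i) \<omega>)\<^sup>2) \<le> G k \<omega>" for k
      proof -
        have "min 1 ((J k i \<omega> - I (s i) \<omega>)\<^sup>2) \<le> (\<Sum>i<Suc m. min 1 ((J k i \<omega> - I (s i) \<omega>)\<^sup>2))"
          by (rule member_le_sum) (use i in auto)
        then show ?thesis unfolding G_def using A0[of k \<omega>] by linarith
      qed
      have "(\<lambda>k. min 1 ((J (r k) i \<omega> - I (s i) \<omega>)\<^sup>2)) \<longlonglongrightarrow> 0"
        by (rule tendsto_sandwich[OF _ _ tendsto_const lim]) (use le2 in auto)
      then show ?thesis by (rule tendsto_of_square_diff[OF tendsto_zero_of_min_one])
    qed
    show ?thesis
      unfolding ek_def e_def using A J by (intro conjI allI impI tendsto_intros) auto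
  qed
  have up: "(\<lambda>k. 2 * (expectation (\<lambda>\<omega>. min 1 (2 * (C \<omega> * A (r k) \<omega>))) + expectation (\<lambda>\<omega>. min 1 (2 * D \<omega>))))
      \<longlonglongrightarrow> 2 * (0 + expectation (\<lambda>\<omega>. min 1 (2 * D \<omega>)))"
  proof (intro tendsto_intros)
    have "(\<lambda>k. expectation (\<lambda>\<omega>. min 1 (2 * (C \<omega> * A (r k) \<omega>)))) \<longlonglongrightarrow> expectation (\<lambda>\<omega>. min 1 (0::real))"
    proof (rule tendsto_expectation_min_one)
      show "AE \<omega> in M. (\<lambda>k. 2 * (C \<omega> * A (r k) \<omega>)) \<longlonglongrightarrow> 0"
        using AE_G
      proof eventually_elim
        case (elim \<omega>)
        then have "(\<lambda>k. 2 * (C \<omega> * A (r k) \<omega>)) \<longlonglongrightarrow> 2 * (C \<omega> * 0)" 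
          using pointwise by (intro tendsto_intros) auto
        then show ?case by simp
      qed
    qed (use A0 C0 in auto)
    then show "(\<lambda>k. expectation (\<lambda>\<omega>. min 1 (2 * (C \<omega> * A (r k) \<omega>)))) \<longlonglongrightarrow> 0" by simp
  qed
  have EZ: "2 * expectation (\<lambda>\<omega>. min 1 (Z k \<omega>))
      \<le> 2 * (expectation (\<lambda>\<omega>. min 1 (2 * (C \<omega> * A k \<omega>))) + expectation (\<lambda>\<omega>. min 1 (2 * D \<omega>)))" for k
  proof -
    have i: "integrable M (\<lambda>\<omega>. min 1 (2 * (C \<omega> * A k \<omega>)))" "integrable M (\<lambda>\<omega>. min 1 (2 * D \<omega>))"
      "integrable M (\<lambda>\<omega>. min 1 (Z k \<omega>))"
      using A0 C0 D0 Z0 by (auto intro!: integrable_min_one)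
    have "expectation (\<lambda>\<omega>. min 1 (Z k \<omega>)) \<le> expectation (\<lambda>\<omega>. min 1 (2 * (C \<omega> * A k \<omega>)) + min 1 (2 * D \<omega>))"
    proof (rule integral_mono)
      fix \<omega> assume "\<omega> \<in> space M"
      moreover have "0 \<le> C \<omega> * A k \<omega>" using A0 C0 by simp
      ultimately show "min 1 (Z k \<omega>) \<le> min 1 (2 * (C \<omega> * A k \<omega>)) + min 1 (2 * D \<omega>)"
        using Zle[of \<omega> k] D0[of \<omega>] by (auto simp: min_def)
    qed (use i in auto)
    then show ?thesis using i by simp
  qed
  show "expectation (\<lambda>\<omega>. min 1 (\<Sum>i<m. (e i \<omega>)\<^sup>2)) \<le> 2 * expectation (\<lambda>\<omega>. min 1 (2 * D \<omega>))"
  proof -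
    have "(\<lambda>k. expectation (\<lambda>\<omega>. min 1 (\<Sum>i<m. (ek (r k) i \<omega>)\<^sup>2))) \<longlonglongrightarrow> expectation (\<lambda>\<omega>. min 1 (\<Sum>i<m. (e i \<omega>)\<^sup>2))"
    proof (rule tendsto_expectation_min_one)
      show "AE \<omega> in M. (\<lambda>k. \<Sum>i<m. (ek (r k) i \<omega>)\<^sup>2) \<longlonglongrightarrow> (\<Sum>i<m. (e i \<omega>)\<^sup>2)"
        using AE_G by eventually_elim (use pointwise in \<open>auto intro!: tendsto_intros\<close>)
    qed (auto intro!: sum_nonneg)
    then have "expectation (\<lambda>\<omega>. min 1 (\<Sum>i<m. (e i \<omega>)\<^sup>2)) \<le> 2 * (0 + expectation (\<lambda>\<omega>. min 1 (2 * D \<omega>)))"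
      by (rule LIMSEQ_le[OF _ up]) (use b1 EZ order.trans in blast)
    then show ?thesis by simp
  qed
  show "expectation (\<lambda>\<omega>. min 1 ((\<Sum>i<m. e i \<omega>)\<^sup>2)) \<le> 2 * expectation (\<lambda>\<omega>. min 1 (2 * D \<omega>))"
  proof -
    have "(\<lambda>k. expectation (\<lambda>\<omega>. min 1 ((\<Sum>i<m. ek (r k) i \<omega>)\<^sup>2))) \<longlonglongrightarrow> expectation (\<lambda>\<omega>. min 1 ((\<Sum>i<m. e i \<omega>)\<^sup>2))"
    proof (rule tendsto_expectation_min_one)
      show "AE \<omega> in M. (\<lambda>k. (\<Sum>i<m. ek (r k) i \<omega>)\<^sup>2) \<longlonglongrightarrow> (\<Sum>i<m. e i \<omega>)\<^sup>2"
        using AE_G by eventually_elim (use pointwise in \<open>auto intro!: tendsto_intros\<close>)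
    qed auto
    then have "expectation (\<lambda>\<omega>. min 1 ((\<Sum>i<m. e i \<omega>)\<^sup>2)) \<le> 2 * (0 + expectation (\<lambda>\<omega>. min 1 (2 * D \<omega>)))"
      by (rule LIMSEQ_le[OF _ up]) (use b2 EZ order.trans in blast)
    then show ?thesis by simp
  qed
qed

text \<open>The centred squares of the increments are orthogonal.\<close>

lemma quadratic_variation:
  fixes m :: nat and s :: "nat \<Rightarrow> real" and h :: real
  assumes s0: "0 \<le> s 0" and h: "0 < h" and s: "\<And>i. s (Suc i) = s i + h"
  shows "integrable M (\<lambda>\<omega>. ((\<Sum>i<m. (W (s (Suc i)) \<omega> - W (s i) \<omega>)\<^sup>2) - m * h)\<^sup>2)"
    and "expectation (\<lambda>\<omega>. ((\<Sum>i<m. (W (s (Suc i)) \<omega> - W (s i) \<omega>)\<^sup>2) - m * h)\<^sup>2) = 2 * real m * h\<^sup>2"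
proof -
  have s_nn: "0 \<le> s i" for i by (induction i) (use s0 s h in auto)
  have c: "centred_increment (s i) (s (Suc i)) (\<lambda>\<omega>. (W (s (Suc i)) \<omega> - W (s i) \<omega>)\<^sup>2 - h) (2 * h\<^sup>2)" for i
    using centred_increment_W_square[OF s_nn[of i], of "s (Suc i)"] s h by simp
  have eq: "(\<Sum>i<m. (W (s (Suc i)) \<omega> - W (s i) \<omega>)\<^sup>2) - m * h
      = (\<Sum>i<m. 1 * ((W (s (Suc i)) \<omega> - W (s i) \<omega>)\<^sup>2 - h))" for \<omega>
    by (simp add: sum_subtractf)
  have "s i \<le> s (Suc i)" for i using s h by simp
  then have os: "integrable M (\<lambda>\<omega>. (\<Sum>i<m. 1 * ((W (s (Suc i)) \<omega> - W (s i) \<omega>)\<^sup>2 - h))\<^sup>2)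
    \<and> expectation (\<lambda>\<omega>. (\<Sum>i<m. 1 * ((W (s (Suc i)) \<omega> - W (s i) \<omega>)\<^sup>2 - h))\<^sup>2)
      = (\<Sum>i<m. 2 * h\<^sup>2 * expectation (\<lambda>\<omega>. 1\<^sup>2))"
    by (intro conjunct2[OF orthogonal_sum[where c = "\<lambda>_. 1" and u = s]] c) auto
  show "integrable M (\<lambda>\<omega>. ((\<Sum>i<m. (W (s (Suc i)) \<omega> - W (s i) \<omega>)\<^sup>2) - m * h)\<^sup>2)"
    unfolding eq using os by simp
  show "expectation (\<lambda>\<omega>. ((\<Sum>i<m. (W (s (Suc i)) \<omega> - W (s i) \<omega>)\<^sup>2) - m * h)\<^sup>2) = 2 * real m * h\<^sup>2"
    unfolding eq using os by (simp add: prob_space)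
qed

end

section \<open>Geometric Brownian motion is the exponential of Brownian motion with drift\<close>

lemma ln_second_order:
  fixes r :: real
  assumes r: "\<bar>r\<bar> \<le> 1 / 2"
  shows "\<bar>ln (1 + r) - r + r\<^sup>2 / 2\<bar> \<le> 2 * \<bar>r\<bar> * r\<^sup>2"
proof -
  define g where "g x = ln (1 + x) - x + x\<^sup>2 / 2" for x :: real
  have "norm (g r - g 0) \<le> 2 * r\<^sup>2 * norm (r - 0)"
  proof (rule field_differentiable_bound[where S = "{-\<bar>r\<bar>..\<bar>r\<bar>}" and f' = "\<lambda>x. x\<^sup>2 / (1 + x)"])
    fix x assume x: "x \<in> {-\<bar>r\<bar>..\<bar>r\<bar>}"
    then have x1: "1 / 2 \<le> 1 + x" using r by auto
    show "(g has_field_derivative x\<^sup>2 / (1 + x)) (at x within {-\<bar>r\<bar>..\<bar>r\<bar>})"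
      unfolding g_def using x1
      by (auto intro!: derivative_eq_intros simp: field_simps power2_eq_square)
    have "\<bar>x\<bar> \<le> \<bar>r\<bar>" using x by auto
    then have "x\<^sup>2 \<le> r\<^sup>2" by (simp add: abs_le_square_iff)
    moreover have "x\<^sup>2 / (1 + x) \<le> x\<^sup>2 / (1 / 2)" using x1 by (intro divide_left_mono) auto
    ultimately show "norm (x\<^sup>2 / (1 + x)) \<le> 2 * r\<^sup>2" using x1 by simp
  qed auto
  then show ?thesis by (simp add: g_def mult_ac)
qed

text \<open>The logarithm of a product of factors \<open>1 + r\<close>, where \<open>r\<close> is a multiple of a Brownian
  increment up to errors: only the sum of \<open>r\<close> and half the sum of its squares survive.\<close>

lemma sum_ln_limit:
  fixes m :: "nat \<Rightarrow> nat" and r d e b :: "nat \<Rightarrow> nat \<Rightarrow> real"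
  assumes r: "\<And>k i. i < m k \<Longrightarrow> r k i = \<sigma> * d k i + e k i + b k i"
    and small: "\<And>\<eta>. 0 < \<eta> \<Longrightarrow> eventually (\<lambda>k. \<forall>i<m k. \<bar>r k i\<bar> \<le> \<eta>) sequentially"
    and e: "(\<lambda>k. \<Sum>i<m k. e k i) \<longlonglongrightarrow> 0" "(\<lambda>k. \<Sum>i<m k. (e k i)\<^sup>2) \<longlonglongrightarrow> 0"
    and b: "(\<lambda>k. \<Sum>i<m k. b k i) \<longlonglongrightarrow> c" "(\<lambda>k. \<Sum>i<m k. (b k i)\<^sup>2) \<longlonglongrightarrow> 0"
    and d: "\<And>k. (\<Sum>i<m k. d k i) = B" "(\<lambda>k. \<Sum>i<m k. (d k i)\<^sup>2) \<longlonglongrightarrow> T"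
    and L: "\<And>k. (\<Sum>i<m k. ln (1 + r k i)) = L"
  shows "L = c + \<sigma> * B - \<sigma>\<^sup>2 * T / 2"
proof -
  define g where "g k i = e k i + b k i" for k i
  have sum_r: "(\<lambda>k. \<Sum>i<m k. r k i) \<longlonglongrightarrow> \<sigma> * B + 0 + c"
  proof -
    have "(\<Sum>i<m k. r k i) = \<sigma> * B + (\<Sum>i<m k. e k i) + (\<Sum>i<m k. b k i)" for k
      using r d(1)[of k] by (simp add: sum.distrib flip: sum_distrib_left)
    then show ?thesis using e(1) b(1) by (simp only:) (intro tendsto_intros)
  qed
  have g2: "(\<lambda>k. \<Sum>i<m k. (g k i)\<^sup>2) \<longlonglongrightarrow> 0"
  proof (rule tendsto_sandwich[OF _ _ tendsto_const])
    show "eventually (\<lambda>k. 0 \<le> (\<Sum>i<m k. (g k i)\<^sup>2)) sequentially" by (simp add: sum_nonneg)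
    have "(g k i)\<^sup>2 \<le> 2 * (e k i)\<^sup>2 + 2 * (b k i)\<^sup>2" for k i
      using square_diff_le[of "e k i" "- b k i" 0] by (simp add: g_def)
    then have "(\<Sum>i<m k. (g k i)\<^sup>2) \<le> 2 * (\<Sum>i<m k. (e k i)\<^sup>2) + 2 * (\<Sum>i<m k. (b k i)\<^sup>2)" for k
      unfolding sum_distrib_left sum.distrib[symmetric] by (intro sum_mono)
    then show "eventually (\<lambda>k. (\<Sum>i<m k. (g k i)\<^sup>2) \<le> 2 * (\<Sum>i<m k. (e k i)\<^sup>2) + 2 * (\<Sum>i<m k. (b k i)\<^sup>2)) sequentially"
      by simp
    have "(\<lambda>k. 2 * (\<Sum>i<m k. (e k i)\<^sup>2) + 2 * (\<Sum>i<m k. (b k i)\<^sup>2)) \<longlonglongrightarrow> 2 * 0 + 2 * 0"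
      using e(2) b(2) by (intro tendsto_intros)
    then show "(\<lambda>k. 2 * (\<Sum>i<m k. (e k i)\<^sup>2) + 2 * (\<Sum>i<m k. (b k i)\<^sup>2)) \<longlonglongrightarrow> 0" by simp
  qed
  have dg: "(\<lambda>k. \<Sum>i<m k. d k i * g k i) \<longlonglongrightarrow> 0"
  proof (rule tendsto_of_square_diff)
    have "(\<lambda>k. (\<Sum>i<m k. (d k i)\<^sup>2) * (\<Sum>i<m k. (g k i)\<^sup>2)) \<longlonglongrightarrow> T * 0"
      using d(2) g2 by (rule tendsto_mult)
    then have up: "(\<lambda>k. (\<Sum>i<m k. (d k i)\<^sup>2) * (\<Sum>i<m k. (g k i)\<^sup>2)) \<longlonglongrightarrow> 0" by simp
    show "(\<lambda>k. ((\<Sum>i<m k. d k i * g k i) - 0)\<^sup>2) \<longlonglongrightarrow> 0"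
      by (rule tendsto_sandwich[OF _ _ tendsto_const up])
        (auto intro!: always_eventually Cauchy_Schwarz_ineq_sum)
  qed
  have sum_r2: "(\<lambda>k. \<Sum>i<m k. (r k i)\<^sup>2) \<longlonglongrightarrow> \<sigma>\<^sup>2 * T + 2 * \<sigma> * 0 + 0"
  proof -
    have "(r k i)\<^sup>2 = \<sigma>\<^sup>2 * (d k i)\<^sup>2 + 2 * \<sigma> * (d k i * g k i) + (g k i)\<^sup>2" if "i < m k" for k i
      using r[OF that] by (simp add: g_def power2_eq_square algebra_simps)
    then have "(\<Sum>i<m k. (r k i)\<^sup>2) = \<sigma>\<^sup>2 * (\<Sum>i<m k. (d k i)\<^sup>2) + 2 * \<sigma> * (\<Sum>i<m k. d k i * g k i) + (\<Sum>i<m k. (g k i)\<^sup>2)" for k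
      unfolding sum_distrib_left sum.distrib[symmetric] by (intro sum.cong) auto
    then show ?thesis using d(2) dg g2 by (simp only:) (intro tendsto_intros)
  qed
  define q where "q k = (\<Sum>i<m k. ln (1 + r k i) - r k i + (r k i)\<^sup>2 / 2)" for k
  define R where "R = \<bar>\<sigma>\<^sup>2 * T\<bar> + 1"
  have q: "q \<longlonglongrightarrow> 0"
  proof (rule tendsto_zero_of_scaled_bound)
    show "0 \<le> 2 * R" by (simp add: R_def)
    fix \<eta> :: real assume \<eta>: "0 < \<eta>" "\<eta> \<le> 1 / 2"
    have "eventually (\<lambda>k. (\<Sum>i<m k. (r k i)\<^sup>2) < R) sequentially"
      using sum_r2 by (rule order_tendstoD) (simp add: R_def)
    then show "eventually (\<lambda>k. \<bar>q k\<bar> \<le> 2 * R * \<eta>) sequentially"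
      using small[OF \<eta>(1)]
    proof eventually_elim
      case (elim k)
      have "\<bar>q k\<bar> \<le> (\<Sum>i<m k. \<bar>ln (1 + r k i) - r k i + (r k i)\<^sup>2 / 2\<bar>)" unfolding q_def by (rule sum_abs)
      also have "\<dots> \<le> (\<Sum>i<m k. 2 * \<eta> * (r k i)\<^sup>2)"
      proof (rule sum_mono)
        fix i assume "i \<in> {..<m k}"
        then have ri: "\<bar>r k i\<bar> \<le> \<eta>" using elim by simp
        then have "\<bar>r k i\<bar> \<le> 1 / 2" using \<eta>(2) by simp
        then have "\<bar>ln (1 + r k i) - r k i + (r k i)\<^sup>2 / 2\<bar> \<le> 2 * \<bar>r k i\<bar> * (r k i)\<^sup>2" by (rule ln_second_order)
        also have "\<dots> \<le> 2 * \<eta> * (r k i)\<^sup>2" using ri by (intro mult_right_mono) auto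
        finally show "\<bar>ln (1 + r k i) - r k i + (r k i)\<^sup>2 / 2\<bar> \<le> 2 * \<eta> * (r k i)\<^sup>2" .
      qed
      also have "\<dots> = 2 * \<eta> * (\<Sum>i<m k. (r k i)\<^sup>2)" by (simp add: sum_distrib_left)
      also have "\<dots> \<le> 2 * \<eta> * R" using elim \<eta> by (intro mult_left_mono) auto
      finally show ?case by (simp add: mult_ac)
    qed
  qed
  have "q k + (\<Sum>i<m k. r k i) - (\<Sum>i<m k. (r k i)\<^sup>2) / 2 = L" for k
    using L[of k] by (simp add: q_def sum.distrib sum_subtractf sum_divide_distrib)
  moreover have "(\<lambda>k. q k + (\<Sum>i<m k. r k i) - (\<Sum>i<m k. (r k i)\<^sup>2) / 2)
      \<longlonglongrightarrow> 0 + (\<sigma> * B + 0 + c) - (\<sigma>\<^sup>2 * T + 2 * \<sigma> * 0 + 0) / 2"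
    by (intro tendsto_intros q sum_r sum_r2) auto
  ultimately show ?thesis by (simp add: LIMSEQ_const_iff)
qed

lemma set_integral_close_to_constant:
  fixes h :: "real \<Rightarrow> real"
  assumes ab: "a \<le> b" and h: "continuous_on {a..b} h" and c: "\<And>\<tau>. \<tau> \<in> {a..b} \<Longrightarrow> \<bar>h \<tau> - c\<bar> \<le> \<eta>"
  shows "\<bar>(LINT \<tau>:{a<..b}|lborel. h \<tau>) - c * (b - a)\<bar> \<le> \<eta> * (b - a)"
proof -
  have const: "set_integrable lborel {a<..b} (\<lambda>_. k)" "(LINT \<tau>:{a<..b}|lborel. k) = k * (b - a)" for k :: real
    using ab by (simp_all add: set_integrable_def set_lebesgue_integral_def)
  have ih: "set_integrable lborel {a<..b} h"
    by (rule set_integrable_subset[OF borel_integrable_atLeastAtMost'[OF h]]) auto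
  have cc: "h \<tau> \<le> c + \<eta>" "c - \<eta> \<le> h \<tau>" if "a < \<tau>" "\<tau> \<le> b" for \<tau>
    using c[of \<tau>] that by auto
  have "(LINT \<tau>:{a<..b}|lborel. h \<tau>) \<le> (LINT \<tau>:{a<..b}|lborel. c + \<eta>)"
    using cc by (intro set_integral_mono ih const) auto
  moreover have "(LINT \<tau>:{a<..b}|lborel. c - \<eta>) \<le> (LINT \<tau>:{a<..b}|lborel. h \<tau>)"
    using cc by (intro set_integral_mono ih const) auto
  ultimately show ?thesis unfolding const by (simp add: abs_le_iff algebra_simps)
qed

context brownian
begin

text \<open>Progressive measurability enters only here, through Fubini's theorem.\<close>

lemma time_integral_measurable:
  fixes G :: "real \<Rightarrow> 'w \<Rightarrow> real"
  assumes G: "(\<lambda>(\<tau>, \<omega>). G \<tau> \<omega>) \<in> borel_measurable (restrict_space borel {0..T} \<Otimes>\<^sub>M F T)"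
    and ab: "0 \<le> a" "b \<le> T"
  shows "(\<lambda>\<omega>. LINT \<tau>:{a<..b}|lborel. G \<tau> \<omega>) \<in> borel_measurable (F T)"
proof -
  let ?R = "restrict_space lborel {0..T} :: real measure"
  interpret R: sigma_finite_measure ?R
    by (rule sigma_finite_measure_restrict_space) (auto intro: lborel.sigma_finite_measure_axioms)
  have sets_R: "sets ?R = sets (restrict_space borel {0..T})" by (intro sets_restrict_space_cong) simp
  have G': "(\<lambda>(\<omega>, \<tau>). G \<tau> \<omega>) \<in> borel_measurable (F T \<Otimes>\<^sub>M ?R)"
    using measurable_pair_swap[OF G] sets_R by (simp cong: measurable_cong_sets sets_pair_measure_cong)
  have "(\<lambda>\<omega>. \<integral>\<tau>. indicator {a<..b} \<tau> * G \<tau> \<omega> \<partial>?R) \<in> borel_measurable (F T)"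
  proof (rule R.borel_measurable_lebesgue_integral)
    have [measurable]: "(\<lambda>p. G (snd p) (fst p)) \<in> borel_measurable (F T \<Otimes>\<^sub>M ?R)"
      using G' by (simp add: case_prod_beta')
    have ind: "indicator {a<..b} \<in> borel_measurable ?R"
      by (rule measurable_restrict_space1) simp
    have [measurable]: "(\<lambda>p. indicator {a<..b} (snd p) :: real) \<in> borel_measurable (F T \<Otimes>\<^sub>M ?R)"
      by (rule measurable_compose[OF measurable_snd ind])
    show "(\<lambda>(\<omega>, \<tau>). indicator {a<..b} \<tau> * G \<tau> \<omega>) \<in> borel_measurable (F T \<Otimes>\<^sub>M ?R)"
      by (simp add: case_prod_beta')
  qed
  also have "(\<lambda>\<omega>. \<integral>\<tau>. indicator {a<..b} \<tau> * G \<tau> \<omega> \<partial>?R) = (\<lambda>\<omega>. LINT \<tau>:{a<..b}|lborel. G \<tau> \<omega>)"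
    using ab by (subst integral_restrict_space)
      (auto simp: set_lebesgue_integral_def indicator_def intro!: ext Bochner_Integration.integral_cong)
  finally show ?thesis .
qed

end

locale gbm = brownian M F W
  for M :: "'w measure" and F :: "real \<Rightarrow> 'w measure" and W :: "real \<Rightarrow> 'w \<Rightarrow> real" +
  fixes \<mu> \<sigma> :: real and X :: "real \<Rightarrow> 'w \<Rightarrow> real"
  assumes gbm: "geometric_brownian_motion M F W \<mu> \<sigma> X"
begin

lemma X_pos: "\<omega> \<in> space M \<Longrightarrow> 0 \<le> t \<Longrightarrow> 0 < X t \<omega>"
  using gbm by (simp add: geometric_brownian_motion_def)

lemma X_measurable_F: "0 \<le> t \<Longrightarrow> X t \<in> borel_measurable (F t)"
  using gbm by (simp add: geometric_brownian_motion_def solves_sde_def)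

lemma X_measurable [measurable]: "0 \<le> t \<Longrightarrow> X t \<in> borel_measurable M"
  using X_measurable_F measurable_F_M by blast

lemma X_continuous: "\<omega> \<in> space M \<Longrightarrow> continuous_on {0..} (\<lambda>t. X t \<omega>)"
  using gbm by (simp add: geometric_brownian_motion_def solves_sde_def)

lemma X_ratio_modulus:
  assumes \<omega>: "\<omega> \<in> space M" and T: "0 < T" and \<eta>: "0 < \<eta>"
  shows "eventually (\<lambda>k. \<forall>u\<in>{0..T}. \<forall>v\<in>{0..T}. \<bar>u - v\<bar> \<le> T / Suc k \<longrightarrow> \<bar>X u \<omega> / X v \<omega> - 1\<bar> \<le> \<eta>) sequentially"
proof -
  have cont: "continuous_on {0..T} (\<lambda>t. X t \<omega>)" using continuous_on_subset[OF X_continuous[OF \<omega>]] by auto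
  obtain z where z: "z \<in> {0..T}" "\<And>v. v \<in> {0..T} \<Longrightarrow> X z \<omega> \<le> X v \<omega>"
    using continuous_attains_inf[OF _ _ cont] T by auto
  have z0: "0 < X z \<omega>" using X_pos[OF \<omega>] z by simp
  obtain d where d: "0 < d"
    "\<And>u v. u \<in> {0..T} \<Longrightarrow> v \<in> {0..T} \<Longrightarrow> dist u v < d \<Longrightarrow> dist (X u \<omega>) (X v \<omega>) < \<eta> * X z \<omega>"
    using compact_uniformly_continuous[OF cont] \<eta> z0
    unfolding uniformly_continuous_on_def by (metis compact_Icc mult_pos_pos)
  have "(\<lambda>k. T / Suc k) \<longlonglongrightarrow> 0" using LIMSEQ_Suc[OF lim_const_over_n[of T]] by simp
  then have "eventually (\<lambda>k. T / Suc k < d) sequentially" using d(1) by (rule order_tendstoD)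
  then show ?thesis
  proof eventually_elim
    case (elim k)
    show ?case
    proof (intro ballI impI)
      fix u v assume uv: "u \<in> {0..T}" "v \<in> {0..T}" "\<bar>u - v\<bar> \<le> T / Suc k"
      have v0: "0 < X v \<omega>" using X_pos[OF \<omega>] uv by simp
      have "\<bar>X u \<omega> - X v \<omega>\<bar> \<le> \<eta> * X z \<omega>"
        using d(2)[OF uv(1,2)] uv(3) elim by (simp add: dist_real_def)
      also have "\<dots> \<le> \<eta> * X v \<omega>" using z(2)[OF uv(2)] \<eta> by (intro mult_left_mono) auto
      finally have "\<bar>X u \<omega> - X v \<omega>\<bar> / X v \<omega> \<le> \<eta>" using v0 by (simp add: field_simps)
      moreover have "\<bar>X u \<omega> / X v \<omega> - 1\<bar> = \<bar>X u \<omega> - X v \<omega>\<bar> / X v \<omega>"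
        using v0 by (simp add: field_simps flip: abs_divide) (simp add: abs_divide field_simps)?
      ultimately show "\<bar>X u \<omega> / X v \<omega> - 1\<bar> \<le> \<eta>" by simp
    qed
  qed
qed

text \<open>Along the partition of mesh \<open>T / (k + 1)\<close> the relative increments of \<open>X\<close> are
  \<open>\<sigma>\<close> times the Brownian increments, plus the drift, plus the error of freezing \<open>X\<close> in the
  stochastic integral over each interval. The time integral \<open>D\<close> of the squared freezing error of the
  integrand tends to 0 by uniform continuity of the path, hence so do the errors and the sum of their
  squares, in probability; a subsequence converges almost surely, where the second order expansion of
  the logarithm applies.\<close>

theorem explicit_solution:
  assumes T: "0 \<le> T"
  shows "AE \<omega> in M. X T \<omega> = X 0 \<omega> * exp ((\<mu> - \<sigma>\<^sup>2 / 2) * T + \<sigma> * (W T \<omega> - W 0 \<omega>))"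
proof (cases "T = 0")
  case False
  with T have T: "0 < T" by simp
  define H where "H t \<omega> = \<sigma> * X t \<omega>" for t \<omega>
  define I where "I t \<omega> = X t \<omega> - X 0 \<omega> - (LINT u:{0..t}|lborel. \<mu> * X u \<omega>)" for t \<omega>
  define s where "s k i = real i * (T / Suc k)" for k i
  define \<phi> where "\<phi> k i \<omega> = 1 / X (s k i) \<omega>" for k i \<omega>
  define d where "d k i \<omega> = W (s k (Suc i)) \<omega> - W (s k i) \<omega>" for k i \<omega>
  define e where "e k i \<omega> = \<phi> k i \<omega> * (I (s k (Suc i)) \<omega> - I (s k i) \<omega>) - \<sigma> * d k i \<omega>" for k i \<omega>
  define D where "D k \<omega> = (\<Sum>i<Suc k. LINT \<tau>:{s k i<..s k (Suc i)}|lborel. (\<phi> k i \<omega> * H \<tau> \<omega> - \<sigma>)\<^sup>2)" for k \<omega>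
  define b where "b k i \<omega> = (LINT u:{s k i<..s k (Suc i)}|lborel. \<mu> * (X u \<omega> / X (s k i) \<omega>))" for k i \<omega>
  have s_nn: "0 \<le> s k i" for k i using T by (simp add: s_def)
  have s_Suc: "s k (Suc i) = s k i + T / Suc k" for k i by (simp add: s_def algebra_simps add_divide_distrib)
  have s_le: "s k i \<le> s k (Suc i)" for k i using T by (simp add: s_Suc)
  have s_T: "s k i \<le> T" if "i \<le> Suc k" for k i
  proof -
    have "real i * (T / Suc k) \<le> real (Suc k) * (T / Suc k)" using that T by (intro mult_right_mono) auto
    then show ?thesis by (simp add: s_def)
  qed
  have s0: "s k 0 = 0" and sm: "s k (Suc k) = T" for k by (simp_all add: s_def)
  have ito: "has_ito_integral M F W H t (I t)" if "0 \<le> t" for t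
    using gbm that by (simp add: geometric_brownian_motion_def solves_sde_def H_def[abs_def] I_def[abs_def])
  have Hc: "continuous_on {0..} (\<lambda>t. H t \<omega>)" if "\<omega> \<in> space M" for \<omega>
    unfolding H_def using X_continuous[OF that] by (intro continuous_intros)
  have \<phi>F: "\<phi> k i \<in> borel_measurable (F (s k i))" for k i
    unfolding \<phi>_def[abs_def] using X_measurable_F[OF s_nn] by simp
  have Xc: "continuous_on {s k i..s k (Suc i)} (\<lambda>t. X t \<omega>)" if "\<omega> \<in> space M" for \<omega> k i
    using continuous_on_subset[OF X_continuous[OF that]] s_nn[of k i] by auto
  have DM [measurable]: "D k \<in> borel_measurable M" for k
  proof -
    have prog: "(\<lambda>(\<tau>, \<omega>). H \<tau> \<omega>) \<in> borel_measurable (restrict_space borel {0..T} \<Otimes>\<^sub>M F T)"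
      using ito[of T] T by (simp add: has_ito_integral_def progressively_measurable_def)
    then have [measurable]: "(\<lambda>p. H (fst p) (snd p)) \<in> borel_measurable (restrict_space borel {0..T} \<Otimes>\<^sub>M F T)"
      by (simp add: case_prod_beta')
    have "(\<lambda>\<omega>. LINT \<tau>:{s k i<..s k (Suc i)}|lborel. (\<phi> k i \<omega> * H \<tau> \<omega> - \<sigma>)\<^sup>2) \<in> borel_measurable (F T)"
      if i: "i < Suc k" for i
    proof (rule time_integral_measurable)
      have [measurable]: "\<phi> k i \<in> borel_measurable (F T)"
        using measurable_F_mono[OF \<phi>F s_T] i by simp
      show "(\<lambda>(\<tau>, \<omega>). (\<phi> k i \<omega> * H \<tau> \<omega> - \<sigma>)\<^sup>2) \<in> borel_measurable (restrict_space borel {0..T} \<Otimes>\<^sub>M F T)"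
        by (simp add: case_prod_beta')
    qed (use s_nn s_T i in auto)
    then show ?thesis
      unfolding D_def[abs_def] using measurable_F_M by (intro borel_measurable_sum) blast
  qed
  have modulus: "eventually (\<lambda>k. \<forall>i<Suc k. \<forall>u\<in>{s k i..s k (Suc i)}. \<bar>X u \<omega> / X (s k i) \<omega> - 1\<bar> \<le> \<eta>) sequentially"
    if \<omega>: "\<omega> \<in> space M" and \<eta>: "0 < \<eta>" for \<omega> \<eta>
    using X_ratio_modulus[OF \<omega> T \<eta>]
  proof eventually_elim
    case (elim k)
    show ?case
    proof (intro allI impI ballI)
      fix i u assume i: "i < Suc k" and u: "u \<in> {s k i..s k (Suc i)}"
      have "u \<in> {0..T}" "s k i \<in> {0..T}" "\<bar>u - s k i\<bar> \<le> T / Suc k"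
        using u s_nn[of k i] s_T[of "Suc i" k] s_T[of i k] i s_Suc[of k i] by auto
      then show "\<bar>X u \<omega> / X (s k i) \<omega> - 1\<bar> \<le> \<eta>" using elim by blast
    qed
  qed
  have D0: "0 \<le> D k \<omega>" for k \<omega>
    unfolding D_def set_lebesgue_integral_def by (intro sum_nonneg integral_nonneg_AE) auto
  have D_lim: "(\<lambda>k. D k \<omega>) \<longlonglongrightarrow> 0" if \<omega>: "\<omega> \<in> space M" for \<omega>
  proof (rule tendsto_zero_of_scaled_bound)
    show "0 \<le> \<sigma>\<^sup>2 * T" using T by simp
    fix \<eta> :: real assume \<eta>: "0 < \<eta>" "\<eta> \<le> 1 / 2"
    show "eventually (\<lambda>k. \<bar>D k \<omega>\<bar> \<le> \<sigma>\<^sup>2 * T * \<eta>) sequentially"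
      using modulus[OF \<omega> \<eta>(1)]
    proof eventually_elim
      case (elim k)
      have "D k \<omega> \<le> (\<Sum>i<Suc k. \<sigma>\<^sup>2 * \<eta> * (T / Suc k))"
        unfolding D_def
      proof (rule sum_mono)
        fix i assume "i \<in> {..<Suc k}"
        then have i: "i < Suc k" by simp
        have "\<bar>(LINT \<tau>:{s k i<..s k (Suc i)}|lborel. (\<phi> k i \<omega> * H \<tau> \<omega> - \<sigma>)\<^sup>2) - 0 * (s k (Suc i) - s k i)\<bar>
            \<le> \<sigma>\<^sup>2 * \<eta> * (s k (Suc i) - s k i)"
        proof (rule set_integral_close_to_constant[OF s_le])
          show "continuous_on {s k i..s k (Suc i)} (\<lambda>\<tau>. (\<phi> k i \<omega> * H \<tau> \<omega> - \<sigma>)\<^sup>2)"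
            unfolding H_def by (intro continuous_intros Xc[OF \<omega>])
          fix \<tau> assume "\<tau> \<in> {s k i..s k (Suc i)}"
          then have "\<bar>X \<tau> \<omega> / X (s k i) \<omega> - 1\<bar> \<le> \<eta>" using elim i by blast
          then have "(X \<tau> \<omega> / X (s k i) \<omega> - 1)\<^sup>2 \<le> \<eta>\<^sup>2" using \<eta>(1) by (simp add: abs_le_square_iff[symmetric])
          also have "\<eta>\<^sup>2 \<le> \<eta>" using \<eta> by (simp add: power2_eq_square mult_le_one)
          finally have "(X \<tau> \<omega> / X (s k i) \<omega> - 1)\<^sup>2 \<le> \<eta>" .
          moreover have "(\<phi> k i \<omega> * H \<tau> \<omega> - \<sigma>)\<^sup>2 = \<sigma>\<^sup>2 * (X \<tau> \<omega> / X (s k i) \<omega> - 1)\<^sup>2"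
            by (simp add: \<phi>_def H_def algebra_simps flip: power_mult_distrib)
          ultimately show "\<bar>(\<phi> k i \<omega> * H \<tau> \<omega> - \<sigma>)\<^sup>2 - 0\<bar> \<le> \<sigma>\<^sup>2 * \<eta>" by (simp add: mult_left_mono)
        qed
        then show "(LINT \<tau>:{s k i<..s k (Suc i)}|lborel. (\<phi> k i \<omega> * H \<tau> \<omega> - \<sigma>)\<^sup>2) \<le> \<sigma>\<^sup>2 * \<eta> * (T / Suc k)"
          by (simp add: s_Suc)
      qed
      then show ?case using D0[of k \<omega>] by (simp add: mult_ac)
    qed
  qed
  have b_close: "eventually (\<lambda>k. \<forall>i<Suc k. \<bar>b k i \<omega> - \<mu> * (T / Suc k)\<bar> \<le> \<bar>\<mu>\<bar> * \<eta> * (T / Suc k)) sequentially"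
    if \<omega>: "\<omega> \<in> space M" and \<eta>: "0 < \<eta>" for \<omega> \<eta>
    using modulus[OF \<omega> \<eta>]
  proof eventually_elim
    case (elim k)
    show ?case
    proof (intro allI impI)
      fix i assume i: "i < Suc k"
      have "\<bar>b k i \<omega> - \<mu> * (s k (Suc i) - s k i)\<bar> \<le> \<bar>\<mu>\<bar> * \<eta> * (s k (Suc i) - s k i)"
        unfolding b_def
      proof (rule set_integral_close_to_constant[OF s_le])
        have "0 < X (s k i) \<omega>" using X_pos[OF \<omega> s_nn] .
        then show "continuous_on {s k i..s k (Suc i)} (\<lambda>\<tau>. \<mu> * (X \<tau> \<omega> / X (s k i) \<omega>))"
          by (intro continuous_intros Xc[OF \<omega>]) auto
        fix \<tau> assume "\<tau> \<in> {s k i..s k (Suc i)}"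
        then have "\<bar>X \<tau> \<omega> / X (s k i) \<omega> - 1\<bar> \<le> \<eta>" using elim i by blast
        then have "\<bar>\<mu>\<bar> * \<bar>X \<tau> \<omega> / X (s k i) \<omega> - 1\<bar> \<le> \<bar>\<mu>\<bar> * \<eta>" by (intro mult_left_mono) auto
        then show "\<bar>\<mu> * (X \<tau> \<omega> / X (s k i) \<omega>) - \<mu>\<bar> \<le> \<bar>\<mu>\<bar> * \<eta>"
          by (simp add: right_diff_distrib flip: abs_mult)
      qed
      then show "\<bar>b k i \<omega> - \<mu> * (T / Suc k)\<bar> \<le> \<bar>\<mu>\<bar> * \<eta> * (T / Suc k)" by (simp add: s_Suc)
    qed
  qed
  have b1: "(\<lambda>k. \<Sum>i<Suc k. b k i \<omega>) \<longlonglongrightarrow> \<mu> * T" if \<omega>: "\<omega> \<in> space M" for \<omega>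
  proof (rule LIM_zero_cancel, rule tendsto_zero_of_scaled_bound)
    show "0 \<le> \<bar>\<mu>\<bar> * T" using T by simp
    fix \<eta> :: real assume \<eta>: "0 < \<eta>"
    show "eventually (\<lambda>k. \<bar>(\<Sum>i<Suc k. b k i \<omega>) - \<mu> * T\<bar> \<le> \<bar>\<mu>\<bar> * T * \<eta>) sequentially"
      using b_close[OF \<omega> \<eta>]
    proof eventually_elim
      case (elim k)
      have "(\<Sum>i<Suc k. b k i \<omega>) - \<mu> * T = (\<Sum>i<Suc k. b k i \<omega> - \<mu> * (T / Suc k))"
        by (simp only: sum_subtractf) simp
      then have "\<bar>(\<Sum>i<Suc k. b k i \<omega>) - \<mu> * T\<bar> \<le> (\<Sum>i<Suc k. \<bar>b k i \<omega> - \<mu> * (T / Suc k)\<bar>)"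
        by (simp only: sum_abs)
      also have "\<dots> \<le> (\<Sum>i<Suc k. \<bar>\<mu>\<bar> * \<eta> * (T / Suc k))" using elim by (intro sum_mono) auto
      finally show ?case by (simp add: mult_ac)
    qed
  qed
  have b2: "(\<lambda>k. \<Sum>i<Suc k. (b k i \<omega>)\<^sup>2) \<longlonglongrightarrow> 0" if \<omega>: "\<omega> \<in> space M" for \<omega>
  proof (rule tendsto_sandwich[OF _ _ tendsto_const])
    show "eventually (\<lambda>k. 0 \<le> (\<Sum>i<Suc k. (b k i \<omega>)\<^sup>2)) sequentially" 
      by (intro always_eventually allI sum_nonneg) simp
    show "eventually (\<lambda>k. (\<Sum>i<Suc k. (b k i \<omega>)\<^sup>2) \<le> (2 * \<mu> * T)\<^sup>2 / Suc k) sequentially"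
      using b_close[OF \<omega> zero_less_one]
    proof eventually_elim
      case (elim k)
      have "(\<Sum>i<Suc k. (b k i \<omega>)\<^sup>2) \<le> (\<Sum>i<Suc k. (2 * \<mu> * (T / Suc k))\<^sup>2)"
      proof (rule sum_mono)
        fix i assume "i \<in> {..<Suc k}"
        then have "\<bar>b k i \<omega> - \<mu> * (T / Suc k)\<bar> \<le> \<bar>\<mu>\<bar> * (T / Suc k)" using elim by auto
        moreover have "\<bar>\<mu> * (T / Suc k)\<bar> = \<bar>\<mu>\<bar> * (T / Suc k)" using T by (simp add: abs_mult)
        moreover have "\<bar>2 * \<mu> * (T / Suc k)\<bar> = 2 * \<bar>\<mu> * (T / Suc k)\<bar>" by (simp add: abs_mult)
        moreover have "\<bar>x\<bar> \<le> \<bar>w\<bar>" if "\<bar>x - y\<bar> \<le> z" "\<bar>y\<bar> = z" "\<bar>w\<bar> = 2 * \<bar>y\<bar>" for x y z w :: real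
          using that by linarith
        ultimately have "\<bar>b k i \<omega>\<bar> \<le> \<bar>2 * \<mu> * (T / Suc k)\<bar>" by blast
        then show "(b k i \<omega>)\<^sup>2 \<le> (2 * \<mu> * (T / Suc k))\<^sup>2" by (simp only: abs_le_square_iff)
      qed
      also have "\<dots> = Suc k * (2 * \<mu> * (T / Suc k))\<^sup>2" by simp
      also have "\<dots> = (2 * \<mu> * T)\<^sup>2 / Suc k"
        by (simp add: power2_eq_square del: of_nat_Suc)
      finally show ?case .
    qed
    show "(\<lambda>k. (2 * \<mu> * T)\<^sup>2 / Suc k) \<longlonglongrightarrow> 0" using LIMSEQ_Suc[OF lim_const_over_n] .
  qed
  have step: "X (s k (Suc i)) \<omega> / X (s k i) \<omega> - 1 = \<sigma> * d k i \<omega> + e k i \<omega> + b k i \<omega>" if \<omega>: "\<omega> \<in> space M" for k i \<omega>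
  proof -
    have p: "0 < X (s k i) \<omega>" using X_pos[OF \<omega> s_nn] .
    have "continuous_on {0..s k (Suc i)} (\<lambda>u. \<mu> * X u \<omega>)"
      using continuous_on_subset[OF X_continuous[OF \<omega>]] by (intro continuous_intros) auto
    then have i0: "set_integrable lborel {0..s k (Suc i)} (\<lambda>u. \<mu> * X u \<omega>)" by (rule borel_integrable_atLeastAtMost')
    have i1: "set_integrable lborel {0..s k i} (\<lambda>u. \<mu> * X u \<omega>)"
      "set_integrable lborel {s k i<..s k (Suc i)} (\<lambda>u. \<mu> * X u \<omega>)"
      by (rule set_integrable_subset[OF i0]; use s_le[of k i] s_nn[of k i] in force)+
    have Un: "{0..s k (Suc i)} = {0..s k i} \<union> {s k i<..s k (Suc i)}" using s_le[of k i] s_nn[of k i] by auto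
    have "(LINT u:{0..s k (Suc i)}|lborel. \<mu> * X u \<omega>)
        = (LINT u:{0..s k i}|lborel. \<mu> * X u \<omega>) + (LINT u:{s k i<..s k (Suc i)}|lborel. \<mu> * X u \<omega>)"
      unfolding Un using i1 by (intro set_integral_Un) auto
    moreover have "b k i \<omega> = (LINT u:{s k i<..s k (Suc i)}|lborel. \<mu> * X u \<omega>) / X (s k i) \<omega>"
      unfolding b_def times_divide_eq_right by (rule set_integral_divide_zero)
    ultimately show ?thesis
      using p by (simp add: e_def \<phi>_def I_def field_simps)
  qed
  have IM: "I (s k i) \<in> borel_measurable M" for k i
    using ito[OF s_nn] by (auto simp: has_ito_integral_def converges_in_probability_def)
  have eM [measurable]: "e k i \<in> borel_measurable M" for k i
    unfolding e_def[abs_def] d_def using s_nn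
    by (intro borel_measurable_diff borel_measurable_times IM W_measurable measurable_F_M[OF \<phi>F] borel_measurable_const)
  have dM [measurable]: "d k i \<in> borel_measurable M" for k i
    unfolding d_def[abs_def] using s_nn by simp
  note BE = ito_block_error[OF Hc ito, of T "s k" "Suc k" "\<phi> k" "\<lambda>_ _. \<sigma>" for k, folded d_def, folded e_def]
  have E1: "expectation (\<lambda>\<omega>. min 1 (\<Sum>i<Suc k. (e k i \<omega>)\<^sup>2)) \<le> 2 * expectation (\<lambda>\<omega>. min 1 (2 * D k \<omega>))"
    and E2: "expectation (\<lambda>\<omega>. min 1 ((\<Sum>i<Suc k. e k i \<omega>)\<^sup>2)) \<le> 2 * expectation (\<lambda>\<omega>. min 1 (2 * D k \<omega>))" for k
    unfolding D_def
    by (rule BE; use DM[of k] s_nn s_le sm \<phi>F in \<open>simp add: D_def[abs_def]\<close>)+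
  have ED: "(\<lambda>k. 2 * expectation (\<lambda>\<omega>. min 1 (2 * D k \<omega>))) \<longlonglongrightarrow> 0"
  proof -
    have "(\<lambda>k. expectation (\<lambda>\<omega>. min 1 (2 * D k \<omega>))) \<longlonglongrightarrow> expectation (\<lambda>\<omega>. min 1 (2 * (0::real)))"
      by (rule tendsto_expectation_min_one) (use D0 D_lim in \<open>auto intro!: AE_I2 tendsto_intros\<close>)
    then have "(\<lambda>k. 2 * expectation (\<lambda>\<omega>. min 1 (2 * D k \<omega>))) \<longlonglongrightarrow> 2 * expectation (\<lambda>\<omega>. min 1 (2 * (0::real)))"
      by (intro tendsto_intros)
    then show ?thesis by simp
  qed
  have EQ: "(\<lambda>k. expectation (\<lambda>\<omega>. min 1 (((\<Sum>i<Suc k. (d k i \<omega>)\<^sup>2) - T)\<^sup>2))) \<longlonglongrightarrow> 0"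
  proof (rule tendsto_sandwich[OF _ _ tendsto_const])
    show "(\<lambda>k. 2 * T\<^sup>2 / Suc k) \<longlonglongrightarrow> 0" using LIMSEQ_Suc[OF lim_const_over_n] .
    show "eventually (\<lambda>k. expectation (\<lambda>\<omega>. min 1 (((\<Sum>i<Suc k. (d k i \<omega>)\<^sup>2) - T)\<^sup>2)) \<le> 2 * T\<^sup>2 / Suc k) sequentially"
    proof (intro always_eventually allI)
      fix k
      note qv = quadratic_variation[where s = "s k" and h = "T / Suc k" and m = "Suc k", OF s_nn _ s_Suc, folded d_def]
      have h: "0 < T / Suc k" using T by simp
      have mh: "real (Suc k) * (T / Suc k) = T" by simp
      have mh2: "2 * real (Suc k) * (T / Suc k)\<^sup>2 = 2 * T\<^sup>2 / Suc k"
        by (simp add: power2_eq_square del: of_nat_Suc)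
      note qv = qv[OF h, unfolded mh mh2]
      have "integrable M (\<lambda>\<omega>. ((\<Sum>i<Suc k. (d k i \<omega>)\<^sup>2) - T)\<^sup>2)" by (rule qv(1))
      then have "expectation (\<lambda>\<omega>. min 1 (((\<Sum>i<Suc k. (d k i \<omega>)\<^sup>2) - T)\<^sup>2)) \<le> expectation (\<lambda>\<omega>. ((\<Sum>i<Suc k. (d k i \<omega>)\<^sup>2) - T)\<^sup>2)"
        by (intro integral_mono integrable_min_one) auto
      also have "\<dots> = 2 * T\<^sup>2 / Suc k" by (rule qv(2))
      finally show "expectation (\<lambda>\<omega>. min 1 (((\<Sum>i<Suc k. (d k i \<omega>)\<^sup>2) - T)\<^sup>2)) \<le> 2 * T\<^sup>2 / Suc k" .
    qed
  qed (auto intro!: always_eventually integral_nonneg_AE)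
  define G where "G k \<omega> = min 1 (\<Sum>i<Suc k. (e k i \<omega>)\<^sup>2) + min 1 ((\<Sum>i<Suc k. e k i \<omega>)\<^sup>2)
      + min 1 (((\<Sum>i<Suc k. (d k i \<omega>)\<^sup>2) - T)\<^sup>2)" for k \<omega>
  have parts: "integrable M (\<lambda>\<omega>. min 1 (\<Sum>i<Suc k. (e k i \<omega>)\<^sup>2))" "integrable M (\<lambda>\<omega>. min 1 ((\<Sum>i<Suc k. e k i \<omega>)\<^sup>2))"
    "integrable M (\<lambda>\<omega>. min 1 (((\<Sum>i<Suc k. (d k i \<omega>)\<^sup>2) - T)\<^sup>2))" for k
    by (rule integrable_min_one; use sum_nonneg in \<open>auto intro!: sum_nonneg simp del: sum.lessThan_Suc\<close>)+
  have G_parts: "0 \<le> min 1 (\<Sum>i<Suc k. (e k i \<omega>)\<^sup>2)" "0 \<le> min 1 ((\<Sum>i<Suc k. e k i \<omega>)\<^sup>2)"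
      "0 \<le> min 1 (((\<Sum>i<Suc k. (d k i \<omega>)\<^sup>2) - T)\<^sup>2)" for k \<omega>
    by (auto simp del: sum.lessThan_Suc intro!: sum_nonneg)
  have G0: "0 \<le> G k \<omega>" for k \<omega> unfolding G_def by (intro add_nonneg_nonneg G_parts)
  have iG: "integrable M (G k)" for k
    unfolding G_def[abs_def] by (intro Bochner_Integration.integrable_add parts)
  have "(\<lambda>k. expectation (G k)) \<longlonglongrightarrow> 0"
  proof (rule tendsto_sandwich[OF _ _ tendsto_const])
    show "eventually (\<lambda>k. expectation (G k) \<le> 2 * expectation (\<lambda>\<omega>. min 1 (2 * D k \<omega>)) + 2 * expectation (\<lambda>\<omega>. min 1 (2 * D k \<omega>))
        + expectation (\<lambda>\<omega>. min 1 (((\<Sum>i<Suc k. (d k i \<omega>)\<^sup>2) - T)\<^sup>2))) sequentially"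
    proof (intro always_eventually allI)
      fix k
      have "expectation (G k) = expectation (\<lambda>\<omega>. min 1 (\<Sum>i<Suc k. (e k i \<omega>)\<^sup>2)) + expectation (\<lambda>\<omega>. min 1 ((\<Sum>i<Suc k. e k i \<omega>)\<^sup>2))
        + expectation (\<lambda>\<omega>. min 1 (((\<Sum>i<Suc k. (d k i \<omega>)\<^sup>2) - T)\<^sup>2))"
        unfolding G_def[abs_def] using parts[of k]
        by (simp only: Bochner_Integration.integral_add Bochner_Integration.integrable_add)
      then show "expectation (G k) \<le> 2 * expectation (\<lambda>\<omega>. min 1 (2 * D k \<omega>)) + 2 * expectation (\<lambda>\<omega>. min 1 (2 * D k \<omega>))
        + expectation (\<lambda>\<omega>. min 1 (((\<Sum>i<Suc k. (d k i \<omega>)\<^sup>2) - T)\<^sup>2))"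
        using E1[of k] E2[of k] by linarith
    qed
    show "(\<lambda>k. 2 * expectation (\<lambda>\<omega>. min 1 (2 * D k \<omega>)) + 2 * expectation (\<lambda>\<omega>. min 1 (2 * D k \<omega>))
        + expectation (\<lambda>\<omega>. min 1 (((\<Sum>i<Suc k. (d k i \<omega>)\<^sup>2) - T)\<^sup>2))) \<longlonglongrightarrow> 0"
      using tendsto_add[OF tendsto_add[OF ED ED] EQ] by simp
  qed (use G0 in \<open>auto intro!: always_eventually integral_nonneg_AE\<close>)
  then have "(\<lambda>k. expectation (\<lambda>\<omega>. norm (G k \<omega>))) \<longlonglongrightarrow> 0" using G0 by simp
  then obtain r where r: "strict_mono r" and AE_G: "AE \<omega> in M. (\<lambda>k. G (r k) \<omega>) \<longlonglongrightarrow> 0"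
    using tendsto_L1_AE_subseq[of M G] iG by blast
  show ?thesis
    using AE_G AE_space
  proof eventually_elim
    case (elim \<omega>)
    note \<omega> = elim(2)
    have lim: "(\<lambda>k. g (r k)) \<longlonglongrightarrow> 0" if "\<And>k. 0 \<le> min 1 (g k)" "\<And>k. min 1 (g k) \<le> G k \<omega>" for g :: "nat \<Rightarrow> real"
      by (rule tendsto_zero_of_min_one, rule tendsto_sandwich[OF _ _ tendsto_const elim(1)]) (use that in auto)
    have "ln (X T \<omega>) - ln (X 0 \<omega>) = \<mu> * T + \<sigma> * (W T \<omega> - W 0 \<omega>) - \<sigma>\<^sup>2 * T / 2"
    proof (rule sum_ln_limit[where m = "\<lambda>k. Suc (r k)" and d = "\<lambda>k i. d (r k) i \<omega>" and e = "\<lambda>k i. e (r k) i \<omega>"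
          and b = "\<lambda>k i. b (r k) i \<omega>" and r = "\<lambda>k i. X (s (r k) (Suc i)) \<omega> / X (s (r k) i) \<omega> - 1"])
      show "X (s (r k) (Suc i)) \<omega> / X (s (r k) i) \<omega> - 1 = \<sigma> * d (r k) i \<omega> + e (r k) i \<omega> + b (r k) i \<omega>" for k i
        by (rule step[OF \<omega>])
      show "eventually (\<lambda>k. \<forall>i<Suc (r k). \<bar>X (s (r k) (Suc i)) \<omega> / X (s (r k) i) \<omega> - 1\<bar> \<le> \<eta>) sequentially"
        if \<eta>: "0 < \<eta>" for \<eta>
        using eventually_subseq[OF r modulus[OF \<omega> \<eta>]] by eventually_elim (use s_le in force)
      show "(\<lambda>k. \<Sum>i<Suc (r k). e (r k) i \<omega>) \<longlonglongrightarrow> 0"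
      proof (rule tendsto_of_square_diff)
        show "(\<lambda>k. ((\<Sum>i<Suc (r k). e (r k) i \<omega>) - 0)\<^sup>2) \<longlonglongrightarrow> 0"
          unfolding diff_zero
          by (rule lim[of "\<lambda>k. (\<Sum>i<Suc k. e k i \<omega>)\<^sup>2"]) 
            (use G_parts[of _ \<omega>] in \<open>simp_all only: G_def add_increasing2 add_increasing order_refl\<close>)
      qed
      show "(\<lambda>k. \<Sum>i<Suc (r k). (e (r k) i \<omega>)\<^sup>2) \<longlonglongrightarrow> 0"
        by (rule lim[of "\<lambda>k. \<Sum>i<Suc k. (e k i \<omega>)\<^sup>2"])
          (use G_parts[of _ \<omega>] in \<open>simp_all only: G_def add_increasing2 add_increasing order_refl\<close>)
      show "(\<lambda>k. \<Sum>i<Suc (r k). (d (r k) i \<omega>)\<^sup>2) \<longlonglongrightarrow> T"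
        by (rule tendsto_of_square_diff, rule lim[of "\<lambda>k. ((\<Sum>i<Suc k. (d k i \<omega>)\<^sup>2) - T)\<^sup>2"])
          (use G_parts[of _ \<omega>] in \<open>simp_all only: G_def add_increasing2 add_increasing add_nonneg_nonneg order_refl\<close>)
      show "(\<lambda>k. \<Sum>i<Suc (r k). b (r k) i \<omega>) \<longlonglongrightarrow> \<mu> * T"
        using LIMSEQ_subseq_LIMSEQ[OF b1[OF \<omega>] r] by (simp only: comp_def)
      show "(\<lambda>k. \<Sum>i<Suc (r k). (b (r k) i \<omega>)\<^sup>2) \<longlonglongrightarrow> 0"
        using LIMSEQ_subseq_LIMSEQ[OF b2[OF \<omega>] r] by (simp only: comp_def)
      show "(\<Sum>i<Suc (r k). d (r k) i \<omega>) = W T \<omega> - W 0 \<omega>" for k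
        unfolding d_def using sum_lessThan_telescope[of "\<lambda>i. W (s (r k) i) \<omega>" "Suc (r k)"] s0 sm by simp
      show "(\<Sum>i<Suc (r k). ln (1 + (X (s (r k) (Suc i)) \<omega> / X (s (r k) i) \<omega> - 1))) = ln (X T \<omega>) - ln (X 0 \<omega>)" for k
      proof -
        have "(\<Sum>i<Suc (r k). ln (1 + (X (s (r k) (Suc i)) \<omega> / X (s (r k) i) \<omega> - 1)))
            = (\<Sum>i<Suc (r k). ln (X (s (r k) (Suc i)) \<omega>) - ln (X (s (r k) i) \<omega>))"
          using X_pos[OF \<omega> s_nn] by (intro sum.cong refl) (simp add: ln_div order_less_imp_not_eq2)
        then show ?thesis
          using sum_lessThan_telescope[of "\<lambda>i. ln (X (s (r k) i) \<omega>)" "Suc (r k)"] s0 sm by simp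
      qed
    qed
    then have "ln (X T \<omega>) = ln (X 0 \<omega>) + ((\<mu> - \<sigma>\<^sup>2 / 2) * T + \<sigma> * (W T \<omega> - W 0 \<omega>))" by (simp add: algebra_simps)
    then have "exp (ln (X T \<omega>)) = exp (ln (X 0 \<omega>)) * exp ((\<mu> - \<sigma>\<^sup>2 / 2) * T + \<sigma> * (W T \<omega> - W 0 \<omega>))"
      by (simp only: exp_add)
    then show ?case using X_pos[OF \<omega>] T by simp
  qed
qed simp

text \<open>The power \<open>X ^ p\<close> is again a geometric Brownian motion; this is its drift.\<close>

definition growth_rate :: "nat \<Rightarrow> real" where
  "growth_rate p = p * \<mu> + p * (real p - 1) * \<sigma>\<^sup>2 / 2"

lemma increment_formula:
  assumes "0 \<le> s" "s \<le> t"
  shows "AE \<omega> in M. X t \<omega> = X s \<omega> * exp ((\<mu> - \<sigma>\<^sup>2 / 2) * (t - s) + \<sigma> * (W t \<omega> - W s \<omega>))"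
  using explicit_solution[OF assms(1)] explicit_solution[of t, OF order.trans[OF assms]]
proof eventually_elim
  case (elim \<omega>)
  have "(\<mu> - \<sigma>\<^sup>2 / 2) * t + \<sigma> * (W t \<omega> - W 0 \<omega>) =
    ((\<mu> - \<sigma>\<^sup>2 / 2) * s + \<sigma> * (W s \<omega> - W 0 \<omega>)) + ((\<mu> - \<sigma>\<^sup>2 / 2) * (t - s) + \<sigma> * (W t \<omega> - W s \<omega>))"
    by (simp add: field_simps)
  then show ?case using elim by (simp only: exp_add mult.assoc)
qed

text \<open>In other words, \<open>exp (- growth_rate p * t) * X t ^ p\<close> is a martingale: the factor by which
  \<open>X\<close> grows after time \<open>s\<close> is independent of the past.\<close>

lemma moment_growth:
  assumes st: "0 \<le> s" "s \<le> t" and Y: "Y \<in> borel_measurable (F s)" and i: "integrable M (\<lambda>\<omega>. X s \<omega> ^ p * Y \<omega>)"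
  shows "integrable M (\<lambda>\<omega>. X t \<omega> ^ p * Y \<omega>)"
    and "expectation (\<lambda>\<omega>. X t \<omega> ^ p * Y \<omega>) = exp (growth_rate p * (t - s)) * expectation (\<lambda>\<omega>. X s \<omega> ^ p * Y \<omega>)"
proof -
  have "integrable M (\<lambda>\<omega>. X t \<omega> ^ p * Y \<omega>) \<and>
    expectation (\<lambda>\<omega>. X t \<omega> ^ p * Y \<omega>) = exp (growth_rate p * (t - s)) * expectation (\<lambda>\<omega>. X s \<omega> ^ p * Y \<omega>)"
  proof (cases "s = t")
    case True
    then show ?thesis using i by simp
  next
    case False
    then have st': "0 \<le> s" "s < t" using st by auto
    define c where "c = exp (p * ((\<mu> - \<sigma>\<^sup>2 / 2) * (t - s)))"
    let ?g = "\<lambda>x. exp (p * \<sigma> * x)"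
    let ?Z = "\<lambda>\<omega>. (X s \<omega> ^ p * Y \<omega>) * ?g (W t \<omega> - W s \<omega>)"
    have YM [measurable]: "Y \<in> borel_measurable M" using measurable_F_M[OF Y] .
    have [measurable]: "X t \<in> borel_measurable M" "X s \<in> borel_measurable M"
      "W t \<in> borel_measurable M" "W s \<in> borel_measurable M"
      using st' by auto
    have AE: "AE \<omega> in M. X t \<omega> ^ p * Y \<omega> = c * ?Z \<omega>"
      using increment_formula[OF st]
    proof eventually_elim
      case (elim \<omega>)
      have "exp ((\<mu> - \<sigma>\<^sup>2 / 2) * (t - s) + \<sigma> * (W t \<omega> - W s \<omega>)) ^ p = c * ?g (W t \<omega> - W s \<omega>)"
        by (simp add: c_def algebra_simps flip: exp_of_nat_mult exp_add)
      then show ?case using elim by (simp add: power_mult_distrib mult_ac)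
    qed
    have F: "(\<lambda>\<omega>. X s \<omega> ^ p * Y \<omega>) \<in> borel_measurable (F s)"
      using X_measurable_F[OF st(1)] Y by simp
    note em = increment_exponential_moment[OF st', of "p * \<sigma>"]
    have g: "?g \<in> borel_measurable borel" by measurable
    note pe = expectation_past_times_increment[OF st' F i, of ?g, OF g em(1)]
    have "integrable M (\<lambda>\<omega>. X t \<omega> ^ p * Y \<omega>)"
      using pe(1) by (subst integrable_cong_AE[OF _ _ AE]) auto
    moreover have "expectation (\<lambda>\<omega>. X t \<omega> ^ p * Y \<omega>) = c * (expectation (\<lambda>\<omega>. X s \<omega> ^ p * Y \<omega>) * exp ((p * \<sigma>)\<^sup>2 * (t - s) / 2))"
      using pe(2) em(2) by (subst integral_cong_AE[OF _ _ AE]) auto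
    moreover have "c * exp ((p * \<sigma>)\<^sup>2 * (t - s) / 2) = exp (growth_rate p * (t - s))"
      unfolding c_def exp_add[symmetric]
      by (rule arg_cong[where f = exp]) (simp add: growth_rate_def power2_eq_square field_simps)
    ultimately show ?thesis by (simp add: mult_ac)
  qed
  then show "integrable M (\<lambda>\<omega>. X t \<omega> ^ p * Y \<omega>)"
    "expectation (\<lambda>\<omega>. X t \<omega> ^ p * Y \<omega>) = exp (growth_rate p * (t - s)) * expectation (\<lambda>\<omega>. X s \<omega> ^ p * Y \<omega>)"
    by auto
qed

end

section \<open>Optional sampling at hitting times\<close>

lemma hitting_time_le: "0 < t \<Longrightarrow> X t \<omega> \<in> A \<Longrightarrow> hitting_time X A \<omega> \<le> ereal t"
  unfolding hitting_time_def by (rule Inf_lower) auto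

lemma hitting_time_ge: "(\<And>s. 0 < s \<Longrightarrow> s \<le> t \<Longrightarrow> X s \<omega> \<notin> A) \<Longrightarrow> ereal t \<le> hitting_time X A \<omega>"
  unfolding hitting_time_def by (rule Inf_greatest) (force simp: not_less)

lemma hitting_time_nonneg: "0 \<le> hitting_time X A \<omega>"
  using hitting_time_ge[of 0 X \<omega> A] by (simp add: zero_ereal_def)

text \<open>Capping the hitting time keeps all times finite.\<close>

definition capped_time :: "(real \<Rightarrow> 'w \<Rightarrow> real) \<Rightarrow> real set \<Rightarrow> real \<Rightarrow> 'w \<Rightarrow> real" where
  "capped_time X A L \<omega> = real_of_ereal (min (hitting_time X A \<omega>) (ereal L))"

lemma capped_time_eq: "0 \<le> L \<Longrightarrow> ereal (capped_time X A L \<omega>) = min (hitting_time X A \<omega>) (ereal L)"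
  unfolding capped_time_def using hitting_time_nonneg[of X A \<omega>]
  by (cases "hitting_time X A \<omega>") (auto simp: min_def)

lemma capped_time_bounds: "0 \<le> L \<Longrightarrow> 0 \<le> capped_time X A L \<omega> \<and> capped_time X A L \<omega> \<le> L"
  using capped_time_eq[of L X A \<omega>] hitting_time_nonneg[of X A \<omega>]
  by (metis ereal_less_eq(3) min.cobounded2 min_def ereal_less_eq(5) zero_ereal_def)

definition hit_by :: "(real \<Rightarrow> 'w \<Rightarrow> real) \<Rightarrow> real set \<Rightarrow> real \<Rightarrow> 'w \<Rightarrow> bool" where
  "hit_by X A t \<omega> \<longleftrightarrow> (\<exists>s. 0 < s \<and> s \<le> t \<and> X s \<omega> \<in> A)"

text \<open>The value of \<open>v\<close> at the first point of the grid of mesh \<open>L / (n + 1)\<close> by which \<open>A\<close>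
  has been hit, and at \<open>L\<close> if there is none; written as a sum of increments because each of them is
  weighted with an event of its own past.\<close>

definition sampled :: "(real \<Rightarrow> 'w \<Rightarrow> real) \<Rightarrow> real set \<Rightarrow> real \<Rightarrow> nat \<Rightarrow> (real \<Rightarrow> 'w \<Rightarrow> real) \<Rightarrow> 'w \<Rightarrow> real" where
  "sampled X A L n v \<omega> = v 0 \<omega> + (\<Sum>i<Suc n. (v (Suc i * (L / Suc n)) \<omega> - v (i * (L / Suc n)) \<omega>)
     * (if hit_by X A (i * (L / Suc n)) \<omega> then 0 else 1))"

text \<open>The index \<open>k\<close> is the first one with \<open>A k\<close>, capped at \<open>m\<close>; it serves all sequences
  \<open>V\<close> at once, so that different processes are sampled at the same time.\<close>

lemma stopped_sum:
  fixes A :: "nat \<Rightarrow> bool"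
  assumes "\<And>i. A i \<Longrightarrow> A (Suc i)"
  shows "\<exists>k\<le>m. (\<forall>i<k. \<not> A i) \<and> (k < m \<longrightarrow> A k) \<and>
    (\<forall>V :: nat \<Rightarrow> real. V 0 + (\<Sum>i<m. (V (Suc i) - V i) * (if A i then 0 else 1)) = V k)"
proof (induction m)
  case (Suc m)
  then obtain k where k: "k \<le> m" "\<forall>i<k. \<not> A i" "k < m \<longrightarrow> A k"
    "\<And>V :: nat \<Rightarrow> real. V 0 + (\<Sum>i<m. (V (Suc i) - V i) * (if A i then 0 else 1)) = V k" by blast
  show ?case
  proof (cases "A m")
    case True
    then have "A k" using k(1,3) by (cases "k = m") auto
    then show ?thesis using k True by (intro exI[of _ k]) (simp add: add.assoc[symmetric])
  next
    case False
    have "A j" if "i \<le> j" "A i" for i j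
      using that by (induction j rule: dec_induct) (use assms in auto)
    then have "k = m" using False k(1,3) by (metis le_neq_implies_less less_imp_le)
    moreover have "\<forall>i<Suc m. \<not> A i" using False k(2) \<open>k = m\<close> by (auto simp: less_Suc_eq)
    ultimately show ?thesis using k(4) False by (intro exI[of _ "Suc m"]) (simp add: add.assoc[symmetric])
  qed
qed simp

lemma sampled_at:
  assumes L: "0 < L"
  shows "\<exists>t. 0 \<le> t \<and> t \<le> L \<and> \<bar>t - capped_time X A L \<omega>\<bar> \<le> L / Suc n \<and> (\<forall>v. sampled X A L n v \<omega> = v t \<omega>)"
proof -
  define h where "h = L / Suc n"
  have h: "0 < h" using L by (simp add: h_def)
  have mh: "real (Suc n) * h = L" by (simp add: h_def)
  have mono: "hit_by X A (real (Suc i) * h) \<omega>" if "hit_by X A (real i * h) \<omega>" for i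
  proof -
    have "real i * h \<le> real (Suc i) * h" using h by simp
    then show ?thesis using that unfolding hit_by_def by (meson order.trans)
  qed
  have "\<exists>k\<le>Suc n. (\<forall>i<k. \<not> hit_by X A (real i * h) \<omega>) \<and> (k < Suc n \<longrightarrow> hit_by X A (real k * h) \<omega>) \<and>
    (\<forall>V :: nat \<Rightarrow> real. V 0 + (\<Sum>i<Suc n. (V (Suc i) - V i) * (if hit_by X A (real i * h) \<omega> then 0 else 1)) = V k)"
    by (rule stopped_sum[where A = "\<lambda>i. hit_by X A (real i * h) \<omega>"]) (rule mono)
  then obtain k where k: "k \<le> Suc n" "\<forall>i<k. \<not> hit_by X A (real i * h) \<omega>"
    "k < Suc n \<longrightarrow> hit_by X A (real k * h) \<omega>"
    "\<forall>V :: nat \<Rightarrow> real. V 0 + (\<Sum>i<Suc n. (V (Suc i) - V i) * (if hit_by X A (real i * h) \<omega> then 0 else 1)) = V k"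
    by blast
  have k0: "0 < k" using k(3) by (cases k) (auto simp: hit_by_def)
  let ?\<rho> = "hitting_time X A \<omega>"
  have kL: "k * h \<le> L" using k(1) h mh by (metis mult_right_mono of_nat_le_iff less_imp_le)
  have lower: "ereal ((k - 1) * h) \<le> ?\<rho>"
    using k(2)[rule_format, of "k - 1"] k0 by (intro hitting_time_ge) (auto simp: hit_by_def)
  have "ereal (capped_time X A L \<omega>) \<le> ereal (k * h)"
  proof (cases "k < Suc n")
    case True
    then obtain s where s: "0 < s" "s \<le> k * h" "X s \<omega> \<in> A" using k(3) by (auto simp: hit_by_def)
    have "?\<rho> \<le> ereal s" using s by (intro hitting_time_le) auto
    also have "\<dots> \<le> ereal (k * h)" using s by simp
    finally show ?thesis using capped_time_eq[of L X A \<omega>] L by (simp add: min_le_iff_disj)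
  next
    case False
    then have "k = Suc n" using k(1) by simp
    then have "real k * h = L" using mh by (simp only:)
    then show ?thesis using capped_time_bounds[of L X A \<omega>] L by simp
  qed
  moreover have "ereal ((k - 1) * h) \<le> ereal (capped_time X A L \<omega>)"
  proof -
    have "(k - 1) * h \<le> L" using kL h by (smt (verit) diff_le_self mult_right_mono of_nat_le_iff)
    then show ?thesis using capped_time_eq[of L X A \<omega>] L lower by simp
  qed
  moreover have "real (k - 1) * h = k * h - h" using k0 by (simp add: of_nat_diff algebra_simps)
  ultimately have "\<bar>k * h - capped_time X A L \<omega>\<bar> \<le> h" using h by auto
  moreover have "sampled X A L n v \<omega> = v (k * h) \<omega>" for v
    using k(4)[rule_format, of "\<lambda>i. v (i * h) \<omega>"] by (simp only: sampled_def h_def[symmetric] mult_zero_left of_nat_0)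
  moreover have "0 \<le> k * h" using h by simp
  ultimately show ?thesis unfolding h_def[symmetric] using kL by blast
qed

text \<open>A path may start in \<open>A\<close> without hitting it at a positive time, and a hit at time 0 is not
  counted; the grid time converges to the hitting time from above in all cases.\<close>

lemma sampled_tendsto:
  assumes L: "0 < L" and v: "continuous_on {0..} (\<lambda>t. v t \<omega>)"
  shows "(\<lambda>n. sampled X A L n v \<omega>) \<longlonglongrightarrow> v (capped_time X A L \<omega>) \<omega>"
proof -
  obtain t where t: "\<And>n. 0 \<le> t n" "\<And>n. \<bar>t n - capped_time X A L \<omega>\<bar> \<le> L / Suc n"
    "\<And>n. sampled X A L n v \<omega> = v (t n) \<omega>"
    using sampled_at[OF L] by metis
  have "(\<lambda>n. L / Suc n) \<longlonglongrightarrow> 0" using LIMSEQ_Suc[OF lim_const_over_n[of L]] by simp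
  then have "(\<lambda>n. t n - capped_time X A L \<omega>) \<longlonglongrightarrow> 0"
    by (rule Lim_null_comparison[rotated]) (use t(2) in auto)
  then have "t \<longlonglongrightarrow> capped_time X A L \<omega>" by (rule LIM_zero_cancel)
  then have "(\<lambda>n. v (t n) \<omega>) \<longlonglongrightarrow> v (capped_time X A L \<omega>) \<omega>"
    by (rule continuous_on_tendsto_compose[OF v]) (use t(1) capped_time_bounds[of L X A \<omega>] L in auto)
  then show ?thesis using t(3) by simp
qed

context gbm
begin

text \<open>By continuity of the path, hitting a closed set during a compact time interval means
  coming arbitrarily close to it at rational times.\<close>

lemma hit_by_measurable:
  assumes A: "closedin (top_of_set {0<..}) A" and t: "0 \<le> t"
  shows "{\<omega> \<in> space M. hit_by X A t \<omega>} \<in> sets (F t)"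
proof -
  obtain C where C: "closed C" "A = {0<..} \<inter> C" using A by (auto simp: closedin_closed)
  show ?thesis
  proof (cases "C = {} \<or> t = 0")
    case True
    then have "{\<omega> \<in> space M. hit_by X A t \<omega>} = {}" using C by (auto simp: hit_by_def)
    then show ?thesis by (simp only: sets.empty_sets)
  next
    case False
    then have C0: "C \<noteq> {}" and t0: "0 < t" using t by auto
    define a where "a k = t / real (k + 2)" for k :: nat
    have a: "0 < a k" "a k < t" for k
    proof -
      have "t * 1 < t * real (k + 2)" using t0 by (intro mult_strict_left_mono) auto
      then show "0 < a k" "a k < t" using t0 by (simp_all add: a_def divide_less_eq)
    qed
    define N where "N n q = {\<omega> \<in> space M. infdist (X q \<omega>) C < 1 / Suc n}" for n :: nat and q
    have "{\<omega> \<in> space M. hit_by X A t \<omega>} = (\<Union>k. \<Inter>n. \<Union>q\<in>\<rat> \<inter> {a k..t}. N n q)"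
    proof (intro equalityI subsetI)
      fix \<omega> assume "\<omega> \<in> {\<omega> \<in> space M. hit_by X A t \<omega>}"
      then obtain s where \<omega>: "\<omega> \<in> space M" and s: "0 < s" "s \<le> t" "X s \<omega> \<in> C"
        using C by (auto simp: hit_by_def)
      obtain k where k: "a k \<le> s"
      proof -
        obtain k :: nat where "t / s \<le> k" using real_arch_simple by blast
        then have "t \<le> s * k" using s(1) by (simp add: field_simps)
        also have "\<dots> \<le> s * (k + 2)" using s(1) by (intro mult_left_mono) auto
        finally have "a k \<le> s" by (simp add: a_def field_simps)
        then show ?thesis using that by blast
      qed
      have "\<exists>q\<in>\<rat> \<inter> {a k..t}. \<omega> \<in> N n q" for n
      proof -
        have "continuous_on {a k..t} (\<lambda>s. infdist (X s \<omega>) C)"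
          using continuous_on_subset[OF X_continuous[OF \<omega>]] a(1)[of k] by (intro continuous_intros) auto
        moreover have "0 < 1 / real (Suc n)" by simp
        ultimately obtain d where d: "0 < d"
          "\<And>q. q \<in> {a k..t} \<Longrightarrow> dist q s < d \<Longrightarrow> dist (infdist (X q \<omega>) C) (infdist (X s \<omega>) C) < 1 / Suc n"
          using s k unfolding continuous_on_iff by (metis atLeastAtMost_iff)
        have "max (a k) (s - d) < min t (s + d)" using a(2)[of k] k s(2) d(1) by auto
        then obtain q where q: "q \<in> \<rat>" "max (a k) (s - d) < q" "q < min t (s + d)"
          using Rats_dense_in_real by blast
        then have "dist (infdist (X q \<omega>) C) (infdist (X s \<omega>) C) < 1 / Suc n"
          by (intro d(2)) (auto simp: dist_real_def)
        then have "infdist (X q \<omega>) C < 1 / Suc n" using s(3) by (simp add: dist_real_def)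
        then show ?thesis using q \<omega> by (auto simp: N_def)
      qed
      then show "\<omega> \<in> (\<Union>k. \<Inter>n. \<Union>q\<in>\<rat> \<inter> {a k..t}. N n q)" by blast
    next
      fix \<omega> assume "\<omega> \<in> (\<Union>k. \<Inter>n. \<Union>q\<in>\<rat> \<inter> {a k..t}. N n q)"
      then obtain k where "\<omega> \<in> (\<Inter>n. \<Union>q\<in>\<rat> \<inter> {a k..t}. N n q)" by (elim UN_E)
      then have k: "\<exists>q\<in>{a k..t}. \<omega> \<in> N n q" for n by blast
      have \<omega>: "\<omega> \<in> space M" using k[of 0] by (auto simp: N_def)
      have "continuous_on {a k..t} (\<lambda>s. infdist (X s \<omega>) C)"
        using continuous_on_subset[OF X_continuous[OF \<omega>]] a(1)[of k] by (intro continuous_intros) auto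
      then obtain s where s: "s \<in> {a k..t}" "\<And>q. q \<in> {a k..t} \<Longrightarrow> infdist (X s \<omega>) C \<le> infdist (X q \<omega>) C"
        using continuous_attains_inf[of "{a k..t}" "\<lambda>s. infdist (X s \<omega>) C"] a(2)[of k] by (auto simp: less_imp_le)
      have "infdist (X s \<omega>) C \<le> 1 / Suc n" for n using k[of n] s(2) by (force simp: N_def)
      then have "infdist (X s \<omega>) C \<le> 0"
        using LIMSEQ_le_const[OF LIMSEQ_Suc[OF lim_const_over_n[of 1]]] by auto
      then have "infdist (X s \<omega>) C = 0" using infdist_nonneg[of "X s \<omega>" C] by linarith
      then have "X s \<omega> \<in> C" using in_closed_iff_infdist_zero[OF C(1) C0] by simp
      moreover have "0 < s" using s(1) a(1)[of k] by auto
      ultimately show "\<omega> \<in> {\<omega> \<in> space M. hit_by X A t \<omega>}"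
        using \<omega> s(1) X_pos[OF \<omega>, of s] C by (auto simp: hit_by_def)
    qed
    also have "\<dots> \<in> sets (F t)"
    proof (rule sets.countable_UN'', simp, rule sets.countable_INT', simp, simp, rule image_subsetI,
        rule sets.countable_UN'', rule countable_Int1, rule countable_rat)
      fix k n q assume "q \<in> \<rat> \<inter> {a k..t}"
      then have "0 \<le> q" "q \<le> t" using a(1)[of k] by auto
      then have [measurable]: "X q \<in> borel_measurable (F t)" using measurable_F_mono[OF X_measurable_F] by blast
      have [measurable]: "(\<lambda>y. infdist y C) \<in> borel_measurable borel"
        by (intro borel_measurable_continuous_onI continuous_intros)
      have "{\<omega> \<in> space (F t). infdist (X q \<omega>) C < 1 / Suc n} \<in> sets (F t)" by measurable
      then show "N n q \<in> sets (F t)" by (simp add: N_def)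
    qed
    finally show ?thesis .
  qed
qed

lemma not_hit_measurable_F:
  assumes "closedin (top_of_set {0<..}) A" "0 \<le> t"
  shows "(\<lambda>\<omega>. if hit_by X A t \<omega> then 0 else 1 :: real) \<in> borel_measurable (F t)"
  using hit_by_measurable[OF assms] by (intro measurable_If) auto

lemma sampled_measurable:
  assumes A: "closedin (top_of_set {0<..}) A" and L: "0 < L" and v: "\<And>t. 0 \<le> t \<Longrightarrow> v t \<in> borel_measurable M"
  shows "sampled X A L n v \<in> borel_measurable M"
  unfolding sampled_def[abs_def] using L
  by (intro borel_measurable_add borel_measurable_sum borel_measurable_times borel_measurable_diff v
      measurable_F_M[OF not_hit_measurable_F[OF A]]) auto

lemma capped_measurable:
  fixes v :: "real \<Rightarrow> 'w \<Rightarrow> real"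
  assumes A: "closedin (top_of_set {0<..}) A" and L: "0 < L" and v: "\<And>t. 0 \<le> t \<Longrightarrow> v t \<in> borel_measurable M"
    and c: "\<And>\<omega>. \<omega> \<in> space M \<Longrightarrow> continuous_on {0..} (\<lambda>t. v t \<omega>)"
  shows "(\<lambda>\<omega>. v (capped_time X A L \<omega>) \<omega>) \<in> borel_measurable M"
proof (rule borel_measurable_LIMSEQ_real)
  show "(\<lambda>n. sampled X A L n v \<omega>) \<longlonglongrightarrow> v (capped_time X A L \<omega>) \<omega>" if "\<omega> \<in> space M" for \<omega>
    by (rule sampled_tendsto[where v = v, OF L c[OF that]])
  show "sampled X A L n v \<in> borel_measurable M" for n
    by (rule sampled_measurable[OF A L]) (rule v)
qed

end

text \<open>The last condition makes the discounted path \<open>g t * X t\<close> a submartingale, as \<open>X\<close> has growth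
  rate \<open>\<mu>\<close>.\<close>

definition slow_discount :: "real \<Rightarrow> (real \<Rightarrow> real) \<Rightarrow> bool" where
  "slow_discount r g \<longleftrightarrow> g 0 = 1 \<and> continuous_on {0..} g \<and> (g \<longlongrightarrow> 0) at_top \<and>
     (\<forall>t\<ge>0. 0 \<le> g t \<and> g t \<le> 1) \<and> (\<forall>s\<ge>0. \<forall>t\<ge>s. g s \<le> g t * exp (r * (t - s)))"

lemma slow_discountD:
  assumes "slow_discount r g"
  shows "g 0 = 1" "continuous_on {0..} g" "(g \<longlongrightarrow> 0) at_top"
    and "\<And>t. 0 \<le> t \<Longrightarrow> 0 \<le> g t \<and> g t \<le> 1"
    and "\<And>s t. 0 \<le> s \<Longrightarrow> s \<le> t \<Longrightarrow> g s \<le> g t * exp (r * (t - s))"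
  using assms by (auto simp: slow_discount_def)

locale started_gbm = gbm M F W \<mu> \<sigma> X
  for M :: "'w measure" and F :: "real \<Rightarrow> 'w measure" and W :: "real \<Rightarrow> 'w \<Rightarrow> real"
    and \<mu> \<sigma> :: real and X :: "real \<Rightarrow> 'w \<Rightarrow> real" +
  fixes x :: real
  assumes start: "AE \<omega> in M. X 0 \<omega> = x" and x_pos: "0 < x" and drift_pos: "0 < \<mu>"
begin

lemma moment:
  assumes "0 \<le> t"
  shows "integrable M (\<lambda>\<omega>. X t \<omega> ^ p)"
    and "expectation (\<lambda>\<omega>. X t \<omega> ^ p) = x ^ p * exp (growth_rate p * t)"
proof -
  have AE: "AE \<omega> in M. X 0 \<omega> ^ p = x ^ p" using start by eventually_elim simp
  have "integrable M (\<lambda>\<omega>. X 0 \<omega> ^ p)" using X_measurable[of 0] by (subst integrable_cong_AE[OF _ _ AE]) auto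
  moreover have "expectation (\<lambda>\<omega>. X 0 \<omega> ^ p) = x ^ p"
    using X_measurable[of 0] by (subst integral_cong_AE[OF _ _ AE]) (auto simp: prob_space)
  ultimately show "integrable M (\<lambda>\<omega>. X t \<omega> ^ p)" "expectation (\<lambda>\<omega>. X t \<omega> ^ p) = x ^ p * exp (growth_rate p * t)"
    using moment_growth[of 0 t "\<lambda>_. 1" p] assms by simp_all
qed

lemma weighted_increment:
  assumes st: "0 \<le> s" "s \<le> t"
    and Y: "Y \<in> borel_measurable (F s)" "\<And>\<omega>. Y \<omega> \<in> {0, 1}"
  shows "integrable M (\<lambda>\<omega>. (g t * X t \<omega> ^ p - g s * X s \<omega> ^ p) * Y \<omega>)"
    and "expectation (\<lambda>\<omega>. (g t * X t \<omega> ^ p - g s * X s \<omega> ^ p) * Y \<omega>)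
      = (g t * exp (growth_rate p * (t - s)) - g s) * expectation (\<lambda>\<omega>. X s \<omega> ^ p * Y \<omega>)"
proof -
  have [measurable]: "Y \<in> borel_measurable M" "X s \<in> borel_measurable M" using measurable_F_M[OF Y(1)] st by auto
  have "norm (X s \<omega> ^ p * Y \<omega>) \<le> norm (X s \<omega> ^ p)" for \<omega>
    using Y(2)[of \<omega>] by auto
  then have i: "integrable M (\<lambda>\<omega>. X s \<omega> ^ p * Y \<omega>)"
    by (intro Bochner_Integration.integrable_bound[OF moment(1)[OF st(1)]]) auto
  note m = moment_growth[OF st Y(1) i]
  have eq: "(\<lambda>\<omega>. (g t * X t \<omega> ^ p - g s * X s \<omega> ^ p) * Y \<omega>) = (\<lambda>\<omega>. g t * (X t \<omega> ^ p * Y \<omega>) - g s * (X s \<omega> ^ p * Y \<omega>))"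
    by (simp add: algebra_simps)
  show "integrable M (\<lambda>\<omega>. (g t * X t \<omega> ^ p - g s * X s \<omega> ^ p) * Y \<omega>)"
    unfolding eq using i m(1) by (intro Bochner_Integration.integrable_diff integrable_mult_right) auto
  show "expectation (\<lambda>\<omega>. (g t * X t \<omega> ^ p - g s * X s \<omega> ^ p) * Y \<omega>)
      = (g t * exp (growth_rate p * (t - s)) - g s) * expectation (\<lambda>\<omega>. X s \<omega> ^ p * Y \<omega>)"
  proof -
    have "expectation (\<lambda>\<omega>. g t * (X t \<omega> ^ p * Y \<omega>) - g s * (X s \<omega> ^ p * Y \<omega>))
        = g t * expectation (\<lambda>\<omega>. X t \<omega> ^ p * Y \<omega>) - g s * expectation (\<lambda>\<omega>. X s \<omega> ^ p * Y \<omega>)"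
      using i m(1) by (simp only: Bochner_Integration.integral_diff integrable_mult_right integral_mult_right_zero)
    then show ?thesis unfolding eq m(2) by (simp only: left_diff_distrib mult.assoc)
  qed
qed

lemma sampled_power_integrable:
  assumes A: "closedin (top_of_set {0<..}) A" and L: "0 < L"
  shows "integrable M (sampled X A L n (\<lambda>t \<omega>. g t * X t \<omega> ^ p))"
  unfolding sampled_def[abs_def]
proof (intro Bochner_Integration.integrable_add Bochner_Integration.integrable_sum integrable_mult_right moment)
  fix i :: nat
  have "real i * (L / Suc n) \<le> real (Suc i) * (L / Suc n)" using L by (intro mult_right_mono) auto
  then show "integrable M (\<lambda>\<omega>. (g (real (Suc i) * (L / Suc n)) * X (real (Suc i) * (L / Suc n)) \<omega> ^ p -
          g (real i * (L / Suc n)) * X (real i * (L / Suc n)) \<omega> ^ p) * (if hit_by X A (real i * (L / Suc n)) \<omega> then 0 else 1))"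
    using L by (intro weighted_increment not_hit_measurable_F[OF A]) auto
qed simp

text \<open>Sampling a discounted path later is better in the mean when the discount decays more slowly
  than \<open>X\<close> grows: the two samples differ by increments over the grid intervals between the hitting
  times, and being between them is an event of the past.\<close>

lemma sampled_mono:
  assumes A: "closedin (top_of_set {0<..}) A" and B: "closedin (top_of_set {0<..}) B" and BA: "B \<subseteq> A"
    and L: "0 < L" and g: "\<And>s t. 0 \<le> s \<Longrightarrow> s \<le> t \<Longrightarrow> g s \<le> g t * exp (\<mu> * (t - s))"
  shows "expectation (sampled X A L n (\<lambda>t \<omega>. g t * X t \<omega>)) \<le> expectation (sampled X B L n (\<lambda>t \<omega>. g t * X t \<omega>))"
proof -
  define h where "h = L / Suc n"
  have h: "0 < h" using L by (simp add: h_def)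
  let ?v = "\<lambda>t \<omega>. g t * X t \<omega>"
  have i: "integrable M (sampled X A L n ?v)" "integrable M (sampled X B L n ?v)"
    using sampled_power_integrable[OF A L, where p = 1] sampled_power_integrable[OF B L, where p = 1] by auto
  define Y where "Y i \<omega> = (if hit_by X B (real i * h) \<omega> then 0 else 1) - (if hit_by X A (real i * h) \<omega> then 0 else 1 :: real)"
    for i :: nat and \<omega>
  have Y01: "Y i \<omega> \<in> {0, 1}" for i \<omega> using BA by (auto simp: Y_def hit_by_def)
  have YF: "Y i \<in> borel_measurable (F (real i * h))" for i
    unfolding Y_def[abs_def] using h
    by (intro borel_measurable_diff not_hit_measurable_F A B) auto
  have step: "real i * h \<le> real (Suc i) * h" for i using h by simp
  note w = weighted_increment[OF _ step YF Y01, where p = 1 and g = g, unfolded power_one_right]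
  have diff: "sampled X B L n ?v \<omega> - sampled X A L n ?v \<omega>
      = (\<Sum>i<Suc n. (?v (real (Suc i) * h) \<omega> - ?v (real i * h) \<omega>) * Y i \<omega>)" for \<omega>
    unfolding sampled_def h_def[symmetric] Y_def by (simp only: right_diff_distrib sum_subtractf)
  have "0 \<le> (\<Sum>i<Suc n. expectation (\<lambda>\<omega>. (?v (real (Suc i) * h) \<omega> - ?v (real i * h) \<omega>) * Y i \<omega>))"
  proof (rule sum_nonneg)
    fix i
    have "0 \<le> expectation (\<lambda>\<omega>. X (real i * h) \<omega> * Y i \<omega>)"
    proof (rule integral_nonneg_AE, rule AE_I2)
      fix \<omega> assume "\<omega> \<in> space M"
      then show "0 \<le> X (real i * h) \<omega> * Y i \<omega>" using X_pos[of \<omega> "real i * h"] h Y01[of i \<omega>] by auto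
    qed
    moreover have "growth_rate 1 = \<mu>" by (simp add: growth_rate_def)
    moreover have "0 \<le> g (real (Suc i) * h) * exp (\<mu> * (real (Suc i) * h - real i * h)) - g (real i * h)"
      using g[of "real i * h" "real (Suc i) * h", OF _ step] h by simp
    moreover have "expectation (\<lambda>\<omega>. (?v (real (Suc i) * h) \<omega> - ?v (real i * h) \<omega>) * Y i \<omega>)
        = (g (real (Suc i) * h) * exp (growth_rate 1 * (real (Suc i) * h - real i * h)) - g (real i * h))
          * expectation (\<lambda>\<omega>. X (real i * h) \<omega> * Y i \<omega>)"
      by (rule w(2)) (use h in simp)
    ultimately show "0 \<le> expectation (\<lambda>\<omega>. (?v (real (Suc i) * h) \<omega> - ?v (real i * h) \<omega>) * Y i \<omega>)"
      by (simp only: mult_nonneg_nonneg)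
  qed
  also have "\<dots> = expectation (\<lambda>\<omega>. sampled X B L n ?v \<omega> - sampled X A L n ?v \<omega>)"
    unfolding diff using w(1) h by (intro Bochner_Integration.integral_sum[symmetric]) auto
  also have "\<dots> = expectation (sampled X B L n ?v) - expectation (sampled X A L n ?v)"
    using i by (intro Bochner_Integration.integral_diff)
  finally show ?thesis by simp
qed

lemma growth_rate_2_nonneg: "0 \<le> growth_rate 2"
  using drift_pos by (simp add: growth_rate_def)

text \<open>The second moment discounted at its own growth rate is a martingale, so sampling leaves its mean
  unchanged.\<close>

lemma sampled_second_moment:
  assumes A: "closedin (top_of_set {0<..}) A" and L: "0 < L"
  defines "v \<equiv> \<lambda>t \<omega>. exp (- growth_rate 2 * t) * X t \<omega> ^ 2"
  shows "expectation (sampled X A L n v) = x\<^sup>2"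
proof -
  define h where "h = L / Suc n"
  have h: "0 < h" using L by (simp add: h_def)
  define Y where "Y i \<omega> = (if hit_by X A (real i * h) \<omega> then 0 else 1 :: real)" for i :: nat and \<omega>
  have YF: "Y i \<in> borel_measurable (F (real i * h))" for i
    unfolding Y_def[abs_def] using h by (intro not_hit_measurable_F A) auto
  have Y01: "Y i \<omega> \<in> {0, 1}" for i \<omega> by (simp add: Y_def)
  have step: "real i * h \<le> real (Suc i) * h" for i using h by simp
  note w = weighted_increment[OF _ step YF Y01, where p = 2 and g = "\<lambda>t. exp (- growth_rate 2 * t)"]
  have e: "expectation (\<lambda>\<omega>. (v (real (Suc i) * h) \<omega> - v (real i * h) \<omega>) * Y i \<omega>) = 0" for i
  proof -
    have "exp (- growth_rate 2 * (real (Suc i) * h)) * exp (growth_rate 2 * (real (Suc i) * h - real i * h))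
        = exp (- growth_rate 2 * (real i * h))"
      unfolding exp_add[symmetric] by (simp add: algebra_simps)
    then show ?thesis unfolding v_def using h by (subst w(2)) auto
  qed
  have "expectation (sampled X A L n v) = expectation (v 0) + expectation (\<lambda>\<omega>. \<Sum>i<Suc n. (v (real (Suc i) * h) \<omega> - v (real i * h) \<omega>) * Y i \<omega>)"
    unfolding sampled_def[abs_def] h_def[symmetric] Y_def[symmetric]
    using w(1) h moment(1)[of 0 2]
    by (intro Bochner_Integration.integral_add Bochner_Integration.integrable_sum) (auto simp: v_def)
  also have "expectation (\<lambda>\<omega>. \<Sum>i<Suc n. (v (real (Suc i) * h) \<omega> - v (real i * h) \<omega>) * Y i \<omega>)
      = (\<Sum>i<Suc n. expectation (\<lambda>\<omega>. (v (real (Suc i) * h) \<omega> - v (real i * h) \<omega>) * Y i \<omega>))"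
    using w(1) h by (intro Bochner_Integration.integral_sum) (auto simp: v_def)
  also have "\<dots> = 0" unfolding e by simp
  finally show ?thesis using moment(2)[of 0 2] by (simp add: v_def)
qed


lemma capped_value_le:
  assumes K: "x \<le> K" and L: "0 < L"
  shows "AE \<omega> in M. X (capped_time X {K..} L \<omega>) \<omega> \<le> K"
  using start AE_space
proof eventually_elim
  case (elim \<omega>)
  define q where "q = capped_time X {K..} L \<omega>"
  have q: "0 \<le> q" "ereal q \<le> hitting_time X {K..} \<omega>"
    using capped_time_bounds[of L X "{K..}" \<omega>] capped_time_eq[of L X "{K..}" \<omega>] L by (simp_all add: q_def)
  show ?case unfolding q_def[symmetric]
  proof (rule ccontr)
    assume gt: "\<not> X q \<omega> \<le> K"
    then have q0: "0 < q" using q(1) elim(1) K by (cases "q = 0") auto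
    have "continuous_on {0..} (\<lambda>t. X t \<omega>)" using X_continuous[OF elim(2)] .
    then obtain d where d: "0 < d" "\<And>s. 0 \<le> s \<Longrightarrow> dist s q < d \<Longrightarrow> dist (X s \<omega>) (X q \<omega>) < X q \<omega> - K"
      using q(1) gt unfolding continuous_on_iff by (metis atLeast_iff diff_gt_0_iff_gt not_le)
    define s where "s = max (q / 2) (q - d / 2)"
    have s: "0 < s" "s < q" "dist s q < d" using q0 d(1) by (auto simp: s_def dist_real_def)
    then have "K \<le> X s \<omega>" using d(2)[of s] by (auto simp: dist_real_def)
    then have "hitting_time X {K..} \<omega> \<le> ereal s" using s by (intro hitting_time_le) auto
    then have "ereal q \<le> ereal s" using q(2) by (rule order.trans[rotated])
    then show False using s by simp
  qed
qed

text \<open>Before the hitting time of \<open>{K..}\<close> the path stays below \<open>K\<close>, but the grid overshoots. The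
  overshoot disappears in the limit because the second moments of the samples are bounded: above a
  level \<open>c\<close> the samples contribute at most a multiple of \<open>1 / c\<close>.\<close>

lemma capped_mono:
  assumes A: "closedin (top_of_set {0<..}) A" and KA: "{K..} \<subseteq> A" and K: "x \<le> K" and L: "0 < L"
    and g: "slow_discount \<mu> g"
  shows "expectation (\<lambda>\<omega>. g (capped_time X A L \<omega>) * min (X (capped_time X A L \<omega>) \<omega>) K)
    \<le> expectation (\<lambda>\<omega>. g (capped_time X {K..} L \<omega>) * min (X (capped_time X {K..} L \<omega>) \<omega>) K)"
proof -
  note gc = slow_discountD(2)[OF g] and g01 = slow_discountD(4)[OF g]
  have K0: "0 < K" using x_pos K by simp
  have B: "closedin (top_of_set {0<..}) {K..}"
    using K0 by (intro closed_subset) auto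
  define v where "v c t \<omega> = g t * min (X t \<omega>) c" for c t \<omega>
  have vc: "continuous_on {0..} (\<lambda>t. v c t \<omega>)" if "\<omega> \<in> space M" for c \<omega>
    unfolding v_def by (intro continuous_intros gc X_continuous that)
  have vM: "v c t \<in> borel_measurable M" if "0 \<le> t" for c t
    unfolding v_def[abs_def] using X_measurable[OF that] by measurable
  have v_bound: "0 \<le> v c t \<omega> \<and> v c t \<omega> \<le> c" if "\<omega> \<in> space M" "0 \<le> t" "0 \<le> c" for c t \<omega>
  proof -
    have "0 \<le> min (X t \<omega>) c" "min (X t \<omega>) c \<le> c" using X_pos[OF that(1,2)] that(3) by auto
    then show ?thesis using g01[OF that(2)] mult_mono[of "g t" 1 "min (X t \<omega>) c" c] by (simp add: v_def)
  qed
  have sampled_bound: "\<bar>sampled X S L n (v c) \<omega>\<bar> \<le> c" if "\<omega> \<in> space M" "0 \<le> c" for S n c \<omega>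
    using sampled_at[OF L, of X S \<omega> n] v_bound[OF that(1) _ that(2)] by (metis abs_of_nonneg)
  have lim: "(\<lambda>n. expectation (sampled X S L n (v c))) \<longlonglongrightarrow> expectation (\<lambda>\<omega>. v c (capped_time X S L \<omega>) \<omega>)"
    if S: "closedin (top_of_set {0<..}) S" and c: "0 \<le> c" for S c
  proof (rule integral_dominated_convergence[where w = "\<lambda>_. c"])
    show "(\<lambda>\<omega>. v c (capped_time X S L \<omega>) \<omega>) \<in> borel_measurable M" by (rule capped_measurable[OF S L vM vc])
    show "sampled X S L n (v c) \<in> borel_measurable M" for n by (rule sampled_measurable[OF S L vM])
    show "AE \<omega> in M. (\<lambda>n. sampled X S L n (v c) \<omega>) \<longlonglongrightarrow> v c (capped_time X S L \<omega>) \<omega>"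
      using sampled_tendsto[OF L vc] by (intro AE_I2)
    show "AE \<omega> in M. norm (sampled X S L n (v c) \<omega>) \<le> c" for n
      using sampled_bound[OF _ c] by (intro AE_I2) auto
  qed simp
  define C where "C = exp (growth_rate 2 * L) * x\<^sup>2"
  have i1: "integrable M (sampled X S L n (\<lambda>t \<omega>. g t * X t \<omega>))" if "closedin (top_of_set {0<..}) S" for S n
    using sampled_power_integrable[OF that L, where p = 1 and g = g] by simp
  have iv: "integrable M (sampled X S L n (v c))" if "closedin (top_of_set {0<..}) S" "0 \<le> c" for S n c
    by (rule integrable_const_bound[where B = c, OF AE_I2 sampled_measurable[OF that(1) L vM]])
      (use sampled_bound[OF _ that(2)] in auto)
  define w where "w t \<omega> = exp (- growth_rate 2 * t) * X t \<omega> ^ 2" for t \<omega>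
  have iw: "integrable M (sampled X {K..} L n w)" for n
    unfolding w_def[abs_def] by (rule sampled_power_integrable[OF B L])
  have key: "expectation (\<lambda>\<omega>. v K (capped_time X A L \<omega>) \<omega>)
      \<le> expectation (\<lambda>\<omega>. v K (capped_time X {K..} L \<omega>) \<omega>) + C / c" if c: "K \<le> c" for c
  proof -
    have c0: "0 < c" using c K0 by simp
    have le: "expectation (sampled X A L n (v K)) \<le> expectation (sampled X {K..} L n (v c)) + C / c" for n
    proof -
      have "expectation (sampled X A L n (v K)) \<le> expectation (sampled X A L n (\<lambda>t \<omega>. g t * X t \<omega>))"
      proof (rule integral_mono[OF iv[OF A] i1[OF A]])
        fix \<omega>
        obtain t where "0 \<le> t" "\<And>v. sampled X A L n v \<omega> = v t \<omega>" using sampled_at[OF L] by metis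
        then show "sampled X A L n (v K) \<omega> \<le> sampled X A L n (\<lambda>t \<omega>. g t * X t \<omega>) \<omega>"
          using g01[of t] by (simp add: v_def mult_left_mono)
      qed (use K0 in simp)
      also have "\<dots> \<le> expectation (sampled X {K..} L n (\<lambda>t \<omega>. g t * X t \<omega>))"
        by (rule sampled_mono[OF A B KA L slow_discountD(5)[OF g]])
      also have "\<dots> \<le> expectation (\<lambda>\<omega>. sampled X {K..} L n (v c) \<omega> + exp (growth_rate 2 * L) / c * sampled X {K..} L n w \<omega>)"
      proof (rule integral_mono[OF i1[OF B]])
        show "integrable M (\<lambda>\<omega>. sampled X {K..} L n (v c) \<omega> + exp (growth_rate 2 * L) / c * sampled X {K..} L n w \<omega>)"
          using iv[OF B, of c] iw c0 by (intro Bochner_Integration.integrable_add integrable_mult_right) auto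
        fix \<omega> assume \<omega>: "\<omega> \<in> space M"
        obtain t where t: "0 \<le> t" "t \<le> L" "\<And>v. sampled X {K..} L n v \<omega> = v t \<omega>" using sampled_at[OF L] by metis
        have X0: "0 < X t \<omega>" using X_pos[OF \<omega> t(1)] .
        have "X t \<omega> \<le> min (X t \<omega>) c + X t \<omega> ^ 2 / c"
        proof (cases "X t \<omega> \<le> c")
          case False
          then have "X t \<omega> * c \<le> X t \<omega> * X t \<omega>" using X0 by (intro mult_left_mono) auto
          then have "X t \<omega> \<le> X t \<omega> ^ 2 / c" using c0 by (simp add: field_simps power2_eq_square)
          then show ?thesis using False c0 by (auto simp: min_def)
        qed (use c0 in \<open>simp add: min_absorb1\<close>)
        then have "g t * X t \<omega> \<le> g t * (min (X t \<omega>) c + X t \<omega> ^ 2 / c)" using g01[OF t(1)] by (intro mult_left_mono) auto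
        also have "\<dots> = v c t \<omega> + g t * (X t \<omega> ^ 2 / c)" by (simp add: v_def distrib_left)
        also have "\<dots> \<le> v c t \<omega> + 1 * (X t \<omega> ^ 2 / c)" using g01[OF t(1)] c0 by (intro add_left_mono mult_right_mono) auto
        also have "X t \<omega> ^ 2 = exp (growth_rate 2 * t) * w t \<omega>"
          by (simp add: w_def mult.assoc[symmetric] flip: exp_add)
        also have "v c t \<omega> + 1 * (exp (growth_rate 2 * t) * w t \<omega> / c) \<le> v c t \<omega> + 1 * (exp (growth_rate 2 * L) * w t \<omega> / c)"
          using t growth_rate_2_nonneg c0
          by (intro add_left_mono mult_left_mono divide_right_mono mult_right_mono) (auto simp: w_def intro: mult_left_mono)
        finally show "sampled X {K..} L n (\<lambda>t \<omega>. g t * X t \<omega>) \<omega>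
            \<le> sampled X {K..} L n (v c) \<omega> + exp (growth_rate 2 * L) / c * sampled X {K..} L n w \<omega>"
          unfolding t(3) by simp
      qed
      also have "\<dots> = expectation (sampled X {K..} L n (v c)) + exp (growth_rate 2 * L) / c * expectation (sampled X {K..} L n w)"
        using iv[OF B, of c] iw c0 by simp
      also have "expectation (sampled X {K..} L n w) = x\<^sup>2"
        unfolding w_def[abs_def] by (rule sampled_second_moment[OF B L])
      finally show ?thesis by (simp add: C_def)
    qed
    have "expectation (\<lambda>\<omega>. v K (capped_time X A L \<omega>) \<omega>) \<le> expectation (\<lambda>\<omega>. v c (capped_time X {K..} L \<omega>) \<omega>) + C / c"
      by (rule LIMSEQ_le[OF lim[OF A] tendsto_add[OF lim[OF B] tendsto_const]]) (use le K0 c0 in auto)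
    also have "expectation (\<lambda>\<omega>. v c (capped_time X {K..} L \<omega>) \<omega>) = expectation (\<lambda>\<omega>. v K (capped_time X {K..} L \<omega>) \<omega>)"
    proof (rule integral_cong_AE)
      show "AE \<omega> in M. v c (capped_time X {K..} L \<omega>) \<omega> = v K (capped_time X {K..} L \<omega>) \<omega>"
        using capped_value_le[OF K L] by eventually_elim (use c in \<open>simp add: v_def min_def\<close>)
    qed (rule capped_measurable[OF B L vM vc]; simp)+
    finally show ?thesis .
  qed
  have "(\<lambda>k. expectation (\<lambda>\<omega>. v K (capped_time X {K..} L \<omega>) \<omega>) + C / (K + real k)) \<longlonglongrightarrow>
      expectation (\<lambda>\<omega>. v K (capped_time X {K..} L \<omega>) \<omega>) + 0"
  proof (intro tendsto_add tendsto_const tendsto_divide_0[OF tendsto_const])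
    show "filterlim (\<lambda>k. K + real k) at_infinity sequentially"
      by (intro filterlim_at_top_imp_at_infinity filterlim_tendsto_add_at_top[OF tendsto_const] filterlim_real_sequentially)
  qed
  then have "expectation (\<lambda>\<omega>. v K (capped_time X A L \<omega>) \<omega>) \<le> expectation (\<lambda>\<omega>. v K (capped_time X {K..} L \<omega>) \<omega>) + 0"
    by (rule LIMSEQ_le_const) (use key in auto)
  then show ?thesis by (simp add: v_def)
qed

abbreviation payoff :: "(real \<Rightarrow> real) \<Rightarrow> real \<Rightarrow> real set \<Rightarrow> 'w \<Rightarrow> real" where
  "payoff g K A \<equiv> discounted_payoff X g (\<lambda>y. min y K) (hitting_time X A)"

lemma capped_payoff_tendsto:
  assumes \<omega>: "\<omega> \<in> space M" and K: "0 < K" and g: "slow_discount \<mu> g"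
  shows "(\<lambda>n. g (capped_time X A (Suc n) \<omega>) * min (X (capped_time X A (Suc n) \<omega>) \<omega>) K)
    \<longlonglongrightarrow> payoff g K A \<omega>"
proof (cases "hitting_time X A \<omega> = \<infinity>")
  case True
  then have c: "capped_time X A (Suc n) \<omega> = Suc n" for n by (simp add: capped_time_def)
  have "filterlim (\<lambda>n. real (Suc n)) at_top sequentially"
    using filterlim_real_sequentially filterlim_Suc by (rule filterlim_compose)
  then have "(\<lambda>n. g (Suc n)) \<longlonglongrightarrow> 0" using slow_discountD(3)[OF g] by (rule filterlim_compose[rotated])
  then have "(\<lambda>n. g (Suc n) * K) \<longlonglongrightarrow> 0" by (rule tendsto_mult_left_zero)
  then have "(\<lambda>n. g (Suc n) * min (X (Suc n) \<omega>) K) \<longlonglongrightarrow> 0"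
  proof (rule Lim_null_comparison[rotated], intro always_eventually allI)
    fix n
    have "0 < X (Suc n) \<omega>" using X_pos[OF \<omega>] by simp
    moreover have "0 \<le> g (Suc n)" using slow_discountD(4)[OF g, of "Suc n"] by simp
    ultimately show "norm (g (Suc n) * min (X (Suc n) \<omega>) K) \<le> g (Suc n) * K"
      using K by (auto simp: abs_mult intro!: mult_left_mono)
  qed
  then show ?thesis unfolding c using True by (simp add: discounted_payoff_def)
next
  case False
  then obtain r where r: "hitting_time X A \<omega> = ereal r" "0 \<le> r"
    using hitting_time_nonneg[of X A \<omega>] by (cases "hitting_time X A \<omega>") auto
  obtain N :: nat where N: "r \<le> N" using real_arch_simple by blast
  have "capped_time X A (Suc n) \<omega> = r" if "N \<le> n" for n
    using that N r by (simp add: capped_time_def min_def)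
  then have "eventually (\<lambda>n. g (capped_time X A (Suc n) \<omega>) * min (X (capped_time X A (Suc n) \<omega>) \<omega>) K
      = payoff g K A \<omega>) sequentially"
    using r by (auto simp: eventually_sequentially discounted_payoff_def intro!: exI[of _ N])
  then show ?thesis by (rule tendsto_eventually)
qed

lemma payoff_bounds:
  assumes \<omega>: "\<omega> \<in> space M" and K: "0 < K" and g: "slow_discount \<mu> g"
    and \<tau>: "0 \<le> \<tau> \<omega>"
  shows "0 \<le> discounted_payoff X g (\<lambda>y. min y K) \<tau> \<omega> \<and> discounted_payoff X g (\<lambda>y. min y K) \<tau> \<omega> \<le> K"
proof (cases "\<tau> \<omega> = \<infinity>")
  case False
  then obtain r where r: "\<tau> \<omega> = ereal r" "0 \<le> r" using \<tau> by (cases "\<tau> \<omega>") auto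
  have "0 \<le> min (X r \<omega>) K" "min (X r \<omega>) K \<le> K" using X_pos[OF \<omega> r(2)] K by auto
  then show ?thesis
    using slow_discountD(4)[OF g r(2)] mult_mono[of "g r" 1 "min (X r \<omega>) K" K] K r by (simp add: discounted_payoff_def)
qed (use K in \<open>simp add: discounted_payoff_def\<close>)

lemma payoff_integrable:
  assumes A: "closedin (top_of_set {0<..}) A" and K: "0 < K" and g: "slow_discount \<mu> g"
  shows "integrable M (payoff g K A)"
    and "(\<lambda>n. expectation (\<lambda>\<omega>. g (capped_time X A (Suc n) \<omega>) * min (X (capped_time X A (Suc n) \<omega>) \<omega>) K))
      \<longlonglongrightarrow> expectation (payoff g K A)"
proof -
  define v where "v t \<omega> = g t * min (X t \<omega>) K" for t \<omega>
  have vM: "v t \<in> borel_measurable M" if "0 \<le> t" for t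
    unfolding v_def[abs_def] using X_measurable[OF that] by measurable
  have vc: "continuous_on {0..} (\<lambda>t. v t \<omega>)" if "\<omega> \<in> space M" for \<omega>
    unfolding v_def by (intro continuous_intros slow_discountD(2)[OF g] X_continuous that)
  have cM: "(\<lambda>\<omega>. g (capped_time X A (Suc n) \<omega>) * min (X (capped_time X A (Suc n) \<omega>) \<omega>) K) \<in> borel_measurable M" for n
    using capped_measurable[OF A _ vM vc, of "Suc n"] by (simp add: v_def)
  have M: "payoff g K A \<in> borel_measurable M"
    by (rule borel_measurable_LIMSEQ_real[OF capped_payoff_tendsto[OF _ K g] cM])
  show "integrable M (payoff g K A)"
  proof (rule integrable_const_bound[where B = K, OF AE_I2 M])
    fix \<omega> assume "\<omega> \<in> space M"
    then show "norm (payoff g K A \<omega>) \<le> K"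
      using payoff_bounds[where \<tau> = "hitting_time X A", OF _ K g] hitting_time_nonneg[of X A] by simp
  qed
  show "(\<lambda>n. expectation (\<lambda>\<omega>. g (capped_time X A (Suc n) \<omega>) * min (X (capped_time X A (Suc n) \<omega>) \<omega>) K))
      \<longlonglongrightarrow> expectation (payoff g K A)"
  proof (rule integral_dominated_convergence[where w = "\<lambda>_. K", OF M cM])
    show "AE \<omega> in M. norm (g (capped_time X A (Suc n) \<omega>) * min (X (capped_time X A (Suc n) \<omega>) \<omega>) K) \<le> K" for n
    proof (rule AE_I2)
      fix \<omega> assume "\<omega> \<in> space M"
      then show "norm (g (capped_time X A (Suc n) \<omega>) * min (X (capped_time X A (Suc n) \<omega>) \<omega>) K) \<le> K"
        using payoff_bounds[where \<tau> = "\<lambda>\<omega>. ereal (capped_time X A (Suc n) \<omega>)", OF _ K g, of \<omega>]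
          capped_time_bounds[of "Suc n" X A \<omega>] by (simp add: discounted_payoff_def)
    qed
  qed (use capped_payoff_tendsto[OF _ K g] in auto)
qed

text \<open>For a discount that decays no faster than \<open>X\<close> grows, no closed set containing \<open>{K..}\<close> is
  better to wait for than \<open>{K..}\<close> itself, from any starting point up to \<open>K\<close>.\<close>

theorem payoff_le_threshold:
  assumes A: "closedin (top_of_set {0<..}) A" and KA: "{K..} \<subseteq> A" and K: "x \<le> K"
    and g: "slow_discount \<mu> g"
  shows "expectation (payoff g K A)
    \<le> expectation (payoff g K {K..})"
proof -
  have K0: "0 < K" using x_pos K by simp
  have B: "closedin (top_of_set {0<..}) {K..}" using K0 by (intro closed_subset) auto
  show ?thesis
    by (rule LIMSEQ_le[OF payoff_integrable(2)[OF A K0 g] payoff_integrable(2)[OF B K0 g]])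
      (use capped_mono[OF A KA K _ g] in auto)
qed

end

section \<open>Values of the threshold rule\<close>

lemma exp_gt_one_plus:
  fixes y :: real
  assumes "0 < y"
  shows "1 + y < exp y"
proof -
  have "0 < y\<^sup>2" using assms by simp
  then show ?thesis using exp_lower_Taylor_quadratic[of y] assms by linarith
qed

text \<open>Hyperbolic discounting at a rate equal to the growth rate of \<open>X\<close> is admissible in the
  comparison of hitting times: \<open>1 + \<beta> t \<le> (1 + \<beta> s) (1 + \<beta> (t - s))\<close>.\<close>

lemma hyperbolic_discount:
  fixes \<beta> :: real and g :: "real \<Rightarrow> real"
  assumes \<beta>: "0 < \<beta>" and g_def: "g = (\<lambda>t. 1 / (1 + \<beta> * t))"
  shows "slow_discount \<beta> g" and "0 < t \<Longrightarrow> g t < 1"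
proof -
  have pos: "0 < 1 + \<beta> * t" if "0 \<le> t" for t using \<beta> that by (simp add: add_pos_nonneg)
  have grow: "g s \<le> g t * exp (\<beta> * (t - s))" if "0 \<le> s" "s \<le> t" for s t
  proof -
    have "1 + \<beta> * t \<le> (1 + \<beta> * s) * (1 + \<beta> * (t - s))"
    proof -
      have "0 \<le> \<beta> * s * (\<beta> * (t - s))" using \<beta> that by simp
      then show ?thesis by (simp add: algebra_simps)
    qed
    also have "\<dots> \<le> (1 + \<beta> * s) * exp (\<beta> * (t - s))"
      using pos[OF that(1)] exp_ge_add_one_self[of "\<beta> * (t - s)"] by (intro mult_left_mono) auto
    finally show ?thesis using pos[of s] pos[of t] that by (simp add: g_def field_simps)
  qed
  have bounds: "0 \<le> g t \<and> g t \<le> 1" if "0 \<le> t" for t using pos[OF that] \<beta> that by (simp add: g_def divide_le_eq)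
  show "g t < 1" if "0 < t" using \<beta> that pos[of t] by (simp add: g_def)
  have "1 + \<beta> * t \<noteq> 0" if "t \<in> {0..}" for t using pos[of t] that by simp
  then have cont: "continuous_on {0..} g" unfolding g_def by (intro continuous_intros) auto
  have lim: "(g \<longlongrightarrow> 0) at_top"
    unfolding g_def
    by (intro tendsto_divide_0[OF tendsto_const] filterlim_at_top_imp_at_infinity
        filterlim_tendsto_add_at_top[OF tendsto_const] filterlim_tendsto_pos_mult_at_top[OF tendsto_const \<beta>]
        filterlim_ident)
  show "slow_discount \<beta> g" using grow bounds cont lim by (simp add: slow_discount_def g_def)
qed

lemma exponential_discount:
  fixes \<beta> :: real
  assumes \<beta>: "0 < \<beta>" and g_def: "g = (\<lambda>t. exp (- \<beta> * t))"
  shows "slow_discount \<beta> g"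
proof -
  have "filterlim (\<lambda>t. - \<beta> * t) at_bot at_top"
    using \<beta> by (intro filterlim_tendsto_neg_mult_at_bot[OF tendsto_const] filterlim_ident) auto
  then have "(g \<longlongrightarrow> 0) at_top" unfolding g_def by (rule filterlim_compose[OF exp_at_bot])
  moreover have "continuous_on {0..} g" unfolding g_def by (intro continuous_intros)
  ultimately show ?thesis using \<beta> by (simp add: slow_discount_def g_def algebra_simps flip: exp_add)
qed

context prob_space
begin

lemma expectation_le_const:
  fixes Y :: "'a \<Rightarrow> real"
  assumes "\<And>\<omega>. \<omega> \<in> space M \<Longrightarrow> Y \<omega> \<le> K" "0 \<le> K"
  shows "expectation Y \<le> K"
proof (cases "integrable M Y")
  case True
  then show ?thesis using integral_le_const[OF True] assms by (auto intro: AE_I2)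
next
  case False
  then show ?thesis using assms by (simp add: not_integrable_integral_eq)
qed

end

context started_gbm
begin

lemma near_start:
  assumes U: "open U" "x \<in> U"
  shows "AE \<omega> in M. \<exists>d>0. \<forall>s. 0 \<le> s \<longrightarrow> s < d \<longrightarrow> X s \<omega> \<in> U"
  using start AE_space
proof eventually_elim
  case (elim \<omega>)
  obtain e where e: "0 < e" "\<And>y. dist y x < e \<Longrightarrow> y \<in> U" using U by (auto simp: open_dist)
  obtain d where "0 < d" "\<And>s. 0 \<le> s \<Longrightarrow> dist s 0 < d \<Longrightarrow> dist (X s \<omega>) (X 0 \<omega>) < e"
    using X_continuous[OF elim(2)] e(1) unfolding continuous_on_iff by (metis atLeast_iff order_refl)
  then show ?case using e(2) elim(1) by (intro exI[of _ d]) auto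
qed

lemma hitting_time_pos:
  assumes A: "closedin (top_of_set {0<..}) A" and x: "x \<notin> A"
  shows "AE \<omega> in M. 0 < hitting_time X A \<omega>"
proof -
  obtain C where C: "closed C" "A = {0<..} \<inter> C" using A by (auto simp: closedin_closed)
  have "open (- C)" "x \<in> - C" using C x x_pos by auto
  from near_start[OF this] show ?thesis
  proof eventually_elim
    case (elim \<omega>)
    then obtain d where d: "0 < d" "\<And>s. 0 \<le> s \<Longrightarrow> s < d \<Longrightarrow> X s \<omega> \<in> - C" by blast
    have "ereal (d / 2) \<le> hitting_time X A \<omega>" using d C by (intro hitting_time_ge) auto
    then show ?case using d(1) by (metis ereal_less(2) half_gt_zero less_le_trans)
  qed
qed

lemma hitting_time_eq_0:
  assumes "0 < d" "\<And>s. 0 < s \<Longrightarrow> s < d \<Longrightarrow> X s \<omega> \<in> A"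
  shows "hitting_time X A \<omega> = 0"
proof -
  have le: "hitting_time X A \<omega> \<le> ereal s" if "0 < s" "s < d" for s
    using that assms by (intro hitting_time_le) auto
  have "hitting_time X A \<omega> \<le> ereal e" if "0 < e" for e
  proof -
    have "hitting_time X A \<omega> \<le> ereal (min e (d / 2))" using that assms(1) by (intro le) auto
    also have "\<dots> \<le> ereal e" by simp
    finally show ?thesis .
  qed
  then have "hitting_time X A \<omega> \<le> 0" by (intro ereal_le_epsilon2[rule_format, where y = 0]) simp
  then show ?thesis using hitting_time_nonneg[of X A \<omega>] by simp
qed

text \<open>Stopping immediately is waiting for the whole state space, which contains \<open>{K..}\<close>.\<close>

lemma start_le_threshold_value:
  assumes K: "x \<le> K"
    and g: "slow_discount \<mu> g"
  shows "x \<le> expectation (payoff g K {K..})"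
proof -
  have K0: "0 < K" using x_pos K by simp
  have A: "closedin (top_of_set {0<..}) {0<..}" by simp
  have AE: "AE \<omega> in M. payoff g K {0<..} \<omega> = x"
    using start AE_space
  proof eventually_elim
    case (elim \<omega>)
    have "hitting_time X {0<..} \<omega> = 0" by (rule hitting_time_eq_0[of 1]) (use X_pos[OF elim(2)] in auto)
    then show ?case using elim(1) K slow_discountD(1)[OF g] by (simp add: discounted_payoff_def)
  qed
  have "expectation (payoff g K {0<..}) = x"
    using payoff_integrable(1)[OF A K0 g]
    by (subst integral_cong_AE[OF _ _ AE]) (auto simp: prob_space)
  then show ?thesis
    using payoff_le_threshold[OF A _ K g] K0 by fastforce
qed

text \<open>At the boundary point \<open>K\<close> the path has to enter \<open>{K..}\<close> immediately. This follows from
  the comparison with immediate stopping, without a study of the oscillations of the path.\<close>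

lemma threshold_value_above:
  assumes K: "0 < K" "K \<le> x"
  defines "g \<equiv> \<lambda>t. 1 / (1 + \<mu> * t)"
  shows "K \<le> expectation (payoff g K {K..})"
proof (cases "x = K")
  case True
  then show ?thesis
    using start_le_threshold_value[OF _ hyperbolic_discount(1)[OF drift_pos g_def[THEN meta_eq_to_obj_eq]], of K] by simp
next
  case False
  note h = hyperbolic_discount[OF drift_pos g_def[THEN meta_eq_to_obj_eq]]
  have B: "closedin (top_of_set {0<..}) {K..}" using K(1) by (intro closed_subset) auto
  have "open {K<..}" "x \<in> {K<..}" using False K by auto
  from near_start[OF this]
  have AE: "AE \<omega> in M. payoff g K {K..} \<omega> = K"
  proof eventually_elim
    case (elim \<omega>)
    then obtain d where d: "0 < d" "\<And>s. 0 \<le> s \<Longrightarrow> s < d \<Longrightarrow> K < X s \<omega>" by auto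
    have "hitting_time X {K..} \<omega> = 0" by (rule hitting_time_eq_0[OF d(1)]) (use d(2) in \<open>auto intro: less_imp_le\<close>)
    then show ?case
      using d(2)[of 0] d(1) by (simp add: discounted_payoff_def g_def)
  qed
  have "expectation (payoff g K {K..}) = K"
    using payoff_integrable(1)[OF B K(1) h(1)]
    by (subst integral_cong_AE[OF _ _ AE]) (auto simp: prob_space)
  then show ?thesis by simp
qed

text \<open>The payoff never exceeds \<open>K\<close>, and outside a closed set there is a positive wait for it.\<close>

lemma value_less_outside:
  assumes A: "closedin (top_of_set {0<..}) A" and x: "x \<notin> A" and K: "0 < K"
  defines "g \<equiv> \<lambda>t. 1 / (1 + \<mu> * t)"
  shows "expectation (payoff g K A) < K"
proof -
  note h = hyperbolic_discount[OF drift_pos g_def[THEN meta_eq_to_obj_eq]]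
  have "AE \<omega> in M. payoff g K A \<omega> < K"
    using hitting_time_pos[OF A x] AE_space
  proof eventually_elim
    case (elim \<omega>)
    show ?case
    proof (cases "hitting_time X A \<omega> = \<infinity>")
      case False
      then obtain r where r: "hitting_time X A \<omega> = ereal r" "0 < r"
        using elim(1) by (cases "hitting_time X A \<omega>") auto
      have "g r * min (X r \<omega>) K \<le> g r * K" using slow_discountD(4)[OF h(1), of r] r(2) by (intro mult_left_mono) auto
      also have "\<dots> < 1 * K" using h(2)[of r] r(2) K by (intro mult_strict_right_mono) auto
      finally show ?thesis using r by (simp add: discounted_payoff_def)
    qed (use K in \<open>simp add: discounted_payoff_def\<close>)
  qed
  then have "expectation (payoff g K A) < expectation (\<lambda>_. K)"
    by (intro integral_less_AE_space payoff_integrable(1)[OF A K h(1)])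
      (auto simp: emeasure_space_1)
  then show ?thesis by (simp add: prob_space)
qed

text \<open>Under exponential discounting at the growth rate of \<open>X\<close>, waiting for the threshold is worth at
  least the starting point, and the hyperbolic discount factor is strictly larger at positive times.\<close>

lemma threshold_value_strict:
  assumes K: "x < K"
  defines "g \<equiv> \<lambda>t. 1 / (1 + \<mu> * t)"
  shows "x < expectation (payoff g K {K..})"
proof -
  define e where "e = (\<lambda>t. exp (- \<mu> * t))"
  note hg = hyperbolic_discount[OF drift_pos g_def[THEN meta_eq_to_obj_eq]]
  note he = exponential_discount[OF drift_pos e_def]
  have K0: "0 < K" using x_pos K by simp
  have B: "closedin (top_of_set {0<..}) {K..}" using K0 by (intro closed_subset) auto
  define Yg where "Yg = payoff g K {K..}"
  define Ye where "Ye = payoff e K {K..}"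
  have ig: "integrable M Yg" unfolding Yg_def by (rule payoff_integrable(1)[OF B K0 hg(1)])
  have ie: "integrable M Ye" unfolding Ye_def by (rule payoff_integrable(1)[OF B K0 he])
  have x: "x \<le> expectation Ye"
    unfolding Ye_def using K by (intro start_le_threshold_value he) simp
  have cmp: "Ye \<omega> \<le> Yg \<omega> \<and> (0 < hitting_time X {K..} \<omega> \<longrightarrow> Ye \<omega> = Yg \<omega> \<longrightarrow> Ye \<omega> = 0)"
    if \<omega>: "\<omega> \<in> space M" for \<omega>
  proof (cases "hitting_time X {K..} \<omega> = \<infinity>")
    case False
    then obtain r where r: "hitting_time X {K..} \<omega> = ereal r" "0 \<le> r"
      using hitting_time_nonneg[of X "{K..}" \<omega>] by (cases "hitting_time X {K..} \<omega>") auto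
    have pos: "0 < 1 + \<mu> * r" using drift_pos r(2) by (simp add: add_pos_nonneg)
    have m: "0 < min (X r \<omega>) K" using X_pos[OF \<omega> r(2)] K0 by simp
    have e_eq: "e r = 1 / exp (\<mu> * r)" by (simp add: e_def exp_minus inverse_eq_divide)
    have "e r \<le> g r"
      unfolding e_eq g_def using pos exp_ge_add_one_self[of "\<mu> * r"] by (intro divide_left_mono) auto
    moreover have "e r < g r" if "0 < r"
      unfolding e_eq g_def using pos exp_gt_one_plus[of "\<mu> * r"] drift_pos that
      by (intro divide_strict_left_mono) auto
    ultimately show ?thesis using m r by (auto simp: Ye_def Yg_def discounted_payoff_def)
  qed (simp add: Ye_def Yg_def discounted_payoff_def)
  show ?thesis
  proof (rule ccontr)
    assume "\<not> x < expectation (payoff g K {K..})"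
    then have le: "expectation Yg \<le> expectation Ye" using x by (simp add: Yg_def)
    have "expectation (\<lambda>\<omega>. Yg \<omega> - Ye \<omega>) = 0"
    proof (rule antisym)
      show "expectation (\<lambda>\<omega>. Yg \<omega> - Ye \<omega>) \<le> 0" using le ig ie by simp
      show "0 \<le> expectation (\<lambda>\<omega>. Yg \<omega> - Ye \<omega>)" by (intro integral_nonneg_AE AE_I2) (use cmp in auto)
    qed
    then have "AE \<omega> in M. Yg \<omega> - Ye \<omega> = 0"
      using integral_nonneg_eq_0_iff_AE[of M "\<lambda>\<omega>. Yg \<omega> - Ye \<omega>"] ig ie cmp by auto
    moreover have "AE \<omega> in M. 0 < hitting_time X {K..} \<omega>" using hitting_time_pos[OF B] K by simp
    ultimately have "AE \<omega> in M. Ye \<omega> = 0"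
      using AE_space
    proof eventually_elim
      case (elim \<omega>)
      then show ?case using cmp[OF elim(3)] by simp
    qed
    then have "expectation Ye = 0" by (simp add: integral_eq_zero_AE)
    then show False using x x_pos by simp
  qed
qed

section \<open>Stopping after a short delay\<close>

text \<open>The gain from the delay is of second order, since the discount and the growth cancel to first
  order.\<close>

lemma delay_upper_bound:
  assumes \<epsilon>: "0 < \<epsilon>" "\<mu> * \<epsilon> \<le> 1" and K: "0 < K"
  shows "expectation (\<lambda>\<omega>. 1 / (1 + \<mu> * \<epsilon>) * min (X \<epsilon> \<omega>) K) \<le> min x K + x * (\<mu> * \<epsilon>)\<^sup>2"
proof -
  define y where "y = \<mu> * \<epsilon>"
  have y: "0 < y" "y \<le> 1" using \<epsilon> drift_pos by (simp_all add: y_def)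
  have iX: "integrable M (X \<epsilon>)" and eX: "expectation (X \<epsilon>) = x * exp y"
    using moment[of \<epsilon> 1] \<epsilon> by (simp_all add: growth_rate_def y_def)
  have iM: "integrable M (\<lambda>\<omega>. min (X \<epsilon> \<omega>) K)" using iX by simp
  have "expectation (\<lambda>\<omega>. min (X \<epsilon> \<omega>) K) \<le> x * exp y"
    using integral_mono[OF iM iX] eX by simp
  moreover have "expectation (\<lambda>\<omega>. min (X \<epsilon> \<omega>) K) \<le> K" by (rule expectation_le_const) (use K in auto)
  ultimately have "expectation (\<lambda>\<omega>. min (X \<epsilon> \<omega>) K) \<le> min (x * exp y) K" by simp
  also have "\<dots> \<le> (min x K + x * y\<^sup>2) * (1 + y)"
  proof -
    have "exp y \<le> 1 + y + y\<^sup>2" using exp_bound[of y] y by simp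
    then have "x * exp y \<le> x * (1 + y + y\<^sup>2)" using x_pos by (intro mult_left_mono) auto
    also have "\<dots> \<le> x * ((1 + y\<^sup>2) * (1 + y))"
      using x_pos y by (intro mult_left_mono) (auto simp: algebra_simps power2_eq_square)
    finally have 1: "x * exp y \<le> (x + x * y\<^sup>2) * (1 + y)" by (simp add: algebra_simps)
    have "K * 1 \<le> (K + x * y\<^sup>2) * (1 + y)" using K y x_pos by (intro mult_mono) auto
    then show ?thesis using 1 by (auto simp: min_def)
  qed
  finally have "expectation (\<lambda>\<omega>. min (X \<epsilon> \<omega>) K) / (1 + y) \<le> min x K + x * y\<^sup>2"
    using y by (simp add: divide_le_eq)
  then show ?thesis by (simp add: y_def)
qed

text \<open>The gain from the delay beats the loss from capping the payoff at \<open>K\<close>, which is smaller than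
  every power of the delay. To see this, bound the loss by a moment whose order \<open>4 n + 1\<close> grows like
  the inverse square root of the delay \<open>1 / n\<^sup>2\<close>: the moments then stay comparable while the factor
  \<open>(x / K) ^ (4 n)\<close> decays geometrically in \<open>n\<close>.\<close>

lemma short_delay_gains:
  assumes K: "x < K"
  shows "eventually (\<lambda>n. x < expectation (\<lambda>\<omega>. 1 / (1 + \<mu> * (1 / (real n)\<^sup>2)) * min (X (1 / (real n)\<^sup>2) \<omega>) K)) sequentially"
proof -
  define E where "E = exp (5 * \<mu> + 10 * \<sigma>\<^sup>2)"
  define q where "q = x / K"
  have K0: "0 < K" using x_pos K by simp
  have q: "0 < q" "q < 1" using x_pos K by (simp_all add: q_def)
  have "(\<lambda>n. real n * q ^ n) \<longlonglongrightarrow> 0" using powser_times_n_limit_0[of q] q by simp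
  then have "(\<lambda>n. (real n * q ^ n) ^ 4 * E) \<longlonglongrightarrow> 0 ^ 4 * E" by (intro tendsto_intros)
  then have "eventually (\<lambda>n. (real n * q ^ n) ^ 4 * E < \<mu>\<^sup>2 / 2) sequentially"
    using drift_pos by (intro order_tendstoD(2)) auto
  then show ?thesis
    using eventually_gt_at_top[of 0]
  proof eventually_elim
    case (elim n)
    define \<epsilon> where "\<epsilon> = 1 / (real n)\<^sup>2"
    define p where "p = 4 * n + 1"
    define y where "y = \<mu> * \<epsilon>"
    have n1: "1 \<le> real n" using elim(2) by simp
    have \<epsilon>: "0 < \<epsilon>" using n1 by (simp add: \<epsilon>_def)
    have y: "0 < y" using \<epsilon> drift_pos by (simp add: y_def)
    have iX: "integrable M (X \<epsilon>)" and eX: "expectation (X \<epsilon>) = x * exp y"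
      using moment[of \<epsilon> 1] \<epsilon> by (simp_all add: growth_rate_def y_def)
    have iP: "integrable M (\<lambda>\<omega>. X \<epsilon> \<omega> ^ p)" and eP: "expectation (\<lambda>\<omega>. X \<epsilon> \<omega> ^ p) = x ^ p * exp (growth_rate p * \<epsilon>)"
      using moment[of \<epsilon> p] \<epsilon> by simp_all
    have rate: "growth_rate p * \<epsilon> \<le> 5 * \<mu> + 10 * \<sigma>\<^sup>2"
    proof -
      have n2: "real n \<le> (real n)\<^sup>2" "1 \<le> (real n)\<^sup>2" using n1 by (simp_all add: self_le_power)
      have "growth_rate p = (4 * real n + 1) * \<mu> + (8 * (real n)\<^sup>2 + 2 * real n) * \<sigma>\<^sup>2"
        by (simp add: growth_rate_def p_def power2_eq_square algebra_simps)
      also have "\<dots> \<le> (5 * (real n)\<^sup>2) * \<mu> + (10 * (real n)\<^sup>2) * \<sigma>\<^sup>2"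
      proof (intro add_mono mult_right_mono)
        show "4 * real n + 1 \<le> 5 * (real n)\<^sup>2" "8 * (real n)\<^sup>2 + 2 * real n \<le> 10 * (real n)\<^sup>2"
          using n2 by linarith+
      qed (use drift_pos in auto)
      also have "\<dots> = (5 * \<mu> + 10 * \<sigma>\<^sup>2) * (real n)\<^sup>2" by (simp add: algebra_simps)
      finally show ?thesis using n1 by (simp add: \<epsilon>_def divide_le_eq)
    qed
    have cap: "X \<epsilon> \<omega> - X \<epsilon> \<omega> ^ p / K ^ (4 * n) \<le> min (X \<epsilon> \<omega>) K" if "\<omega> \<in> space M" for \<omega>
    proof -
      have X0: "0 < X \<epsilon> \<omega>" using X_pos[OF that] \<epsilon> by simp
      show ?thesis
      proof (cases "X \<epsilon> \<omega> \<le> K")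
        case True
        then show ?thesis using X0 K0 by (simp add: min_absorb1)
      next
        case False
        then have "X \<epsilon> \<omega> * K ^ (4 * n) \<le> X \<epsilon> \<omega> * X \<epsilon> \<omega> ^ (4 * n)"
          using X0 K0 by (intro mult_left_mono power_mono) auto
        then have "X \<epsilon> \<omega> \<le> X \<epsilon> \<omega> ^ p / K ^ (4 * n)" using K0 by (simp add: p_def field_simps)
        then show ?thesis using False K0 by (simp add: min_def)
      qed
    qed
    have "x * exp y - x ^ p * exp (growth_rate p * \<epsilon>) / K ^ (4 * n) = expectation (\<lambda>\<omega>. X \<epsilon> \<omega> - X \<epsilon> \<omega> ^ p / K ^ (4 * n))"
      using iX iP eX eP by simp
    also have "\<dots> \<le> expectation (\<lambda>\<omega>. min (X \<epsilon> \<omega>) K)" using iX iP cap by (intro integral_mono) auto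
    finally have lower: "x * exp y - x ^ p * exp (growth_rate p * \<epsilon>) / K ^ (4 * n) \<le> expectation (\<lambda>\<omega>. min (X \<epsilon> \<omega>) K)" .
    have "x ^ p * exp (growth_rate p * \<epsilon>) / K ^ (4 * n) = x * (q ^ (4 * n) * exp (growth_rate p * \<epsilon>))"
      by (simp add: p_def q_def power_divide)
    also have "\<dots> \<le> x * (q ^ (4 * n) * E)"
      unfolding E_def using x_pos q rate by (intro mult_left_mono) auto
    also have "\<dots> < x * (y\<^sup>2 / 2)"
    proof (rule mult_strict_left_mono[OF _ x_pos])
      have "(real n) ^ 4 * (q ^ (4 * n) * E) < \<mu>\<^sup>2 / 2"
        using elim(1) by (simp add: power_mult_distrib power_mult[symmetric] mult_ac)
      then have "q ^ (4 * n) * E < \<mu>\<^sup>2 / 2 / (real n) ^ 4" using n1 by (simp add: less_divide_eq mult_ac)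
      also have "\<dots> = y\<^sup>2 / 2" by (simp add: y_def \<epsilon>_def power_divide power_mult_distrib flip: power_mult)
      finally show "q ^ (4 * n) * E < y\<^sup>2 / 2" .
    qed
    finally have "x * exp y - x * (y\<^sup>2 / 2) < expectation (\<lambda>\<omega>. min (X \<epsilon> \<omega>) K)" using lower by linarith
    moreover have "x * (1 + y) \<le> x * exp y - x * (y\<^sup>2 / 2)"
    proof -
      have "x * (1 + y + y\<^sup>2 / 2) \<le> x * exp y"
        using exp_lower_Taylor_quadratic[of y] y x_pos by (intro mult_left_mono) auto
      then show ?thesis by (simp add: algebra_simps)
    qed
    ultimately have "x * (1 + y) < expectation (\<lambda>\<omega>. min (X \<epsilon> \<omega>) K)" by linarith
    then have "x < expectation (\<lambda>\<omega>. min (X \<epsilon> \<omega>) K) / (1 + y)" using y by (simp add: less_divide_eq)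
    then show ?case by (simp add: y_def \<epsilon>_def)
  qed
qed

end

lemma hitting_time_from_ge: "ereal \<epsilon> \<le> hitting_time_from X \<epsilon> S \<omega>"
  unfolding hitting_time_from_def by (rule Inf_greatest) auto

section \<open>The equilibria\<close>

theorem proposition6p2:
  fixes P F :: "real \<Rightarrow> 'w measure"
    and W X :: "real \<Rightarrow> 'w \<Rightarrow> real"
    and \<mu> \<sigma> \<beta> K :: real
    and \<delta> f :: "real \<Rightarrow> real"
  assumes "\<sigma> > 0" and "\<mu> = \<beta>" and "\<beta> > 0" and "K > 0"
    and "\<And>x. x \<in> {0<..} \<Longrightarrow> brownian_motion (P x) F W"
    and "\<And>x. x \<in> {0<..} \<Longrightarrow> geometric_brownian_motion (P x) F W \<mu> \<sigma> X"
    and "\<And>x. x \<in> {0<..} \<Longrightarrow> AE \<omega> in P x. X 0 \<omega> = x"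
    and "\<delta> = (\<lambda>t. 1 / (1 + \<beta> * t))"
    and "f = (\<lambda>x. min x K)"
  shows "weak_equilibrium {0<..} P X \<delta> f {0<..} \<and>
    \<not> strong_equilibrium {0<..} P X \<delta> f {0<..} \<and>
    optimal_mild_equilibrium {0<..} P X \<delta> f {K..} \<and>
    (\<forall>S. optimal_mild_equilibrium {0<..} P X \<delta> f S \<longrightarrow> S = {K..}) \<and>
    strong_equilibrium {0<..} P X \<delta> f {K..}"
proof -
  have \<mu>: "\<mu> = \<beta>" "0 < \<mu>" and K: "0 < K" using assms by auto
  have \<delta>: "\<delta> = (\<lambda>t. 1 / (1 + \<mu> * t))" and f: "f = (\<lambda>y. min y K)" using assms by auto
  have started: "started_gbm (P x) F W \<mu> \<sigma> X x" if "0 < x" for x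
    using assms(5-7)[of x] that \<mu>(2)
    by (simp add: started_gbm_def started_gbm_axioms_def gbm_def gbm_axioms_def brownian_def)
  note h = hyperbolic_discount[OF \<mu>(2) \<delta>]
  have closed_K: "closedin (top_of_set {0<..}) {K..}" using K by (intro closed_subset) auto
  let ?J = "stopping_value P X \<delta> f"
  have J: "?J x A = prob_space.expectation (P x) (discounted_payoff X \<delta> (\<lambda>y. min y K) (hitting_time X A))" for x A
    by (simp add: stopping_value_def f)
  have payoff_le: "discounted_payoff X \<delta> f \<tau> \<omega> \<le> K" if "0 < x" "\<omega> \<in> space (P x)" "0 \<le> \<tau> \<omega>" for x \<omega> \<tau>
    using started_gbm.payoff_bounds[where \<tau> = \<tau>, OF started[OF that(1)] that(2) K h(1) that(3)] by (simp add: f)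
  have prob: "prob_space (P x)" if "0 < x" for x
    using assms(5)[of x] that by (simp add: brownian_motion_def)
  have J_le: "?J x A \<le> K" if "0 < x" for x A
    unfolding stopping_value_def
  proof (rule prob_space.expectation_le_const[OF prob[OF that]])
    show "discounted_payoff X \<delta> f (hitting_time X A) \<omega> \<le> K" if "\<omega> \<in> space (P x)" for \<omega>
      by (rule payoff_le[OF \<open>0 < x\<close> that hitting_time_nonneg])
  qed (use K in simp)
  have delayed_le: "delayed_value P X \<delta> f x \<epsilon> S \<le> K" if "0 < x" "0 < \<epsilon>" for x \<epsilon> S
    unfolding delayed_value_def
  proof (rule prob_space.expectation_le_const[OF prob[OF that(1)]])
    fix \<omega> assume "\<omega> \<in> space (P x)"
    moreover have "0 \<le> ereal \<epsilon>" using that(2) by simp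
    then have "0 \<le> hitting_time_from X \<epsilon> S \<omega>" by (rule order.trans[OF _ hitting_time_from_ge])
    ultimately show "discounted_payoff X \<delta> f (hitting_time_from X \<epsilon> S) \<omega> \<le> K" by (rule payoff_le[OF that(1)])
  qed (use K in simp)
  have J_below: "x < ?J x {K..}" if "0 < x" "x < K" for x
    using started_gbm.threshold_value_strict[OF started[OF that(1)] that(2)] unfolding J unfolding \<delta> .
  have J_above: "K \<le> ?J x {K..}" if "K \<le> x" for x
    using started_gbm.threshold_value_above[OF started K that] K that unfolding J unfolding \<delta> by simp
  have J_outside: "?J x A < K" if "0 < x" "closedin (top_of_set {0<..}) A" "x \<notin> A" for x A
    using started_gbm.value_less_outside[OF started[OF that(1)] that(2,3) K] unfolding J unfolding \<delta> .
  have J_mono: "?J x A \<le> ?J x {K..}" if "0 < x" "x \<le> K" "closedin (top_of_set {0<..}) A" "{K..} \<subseteq> A" for x A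
    unfolding J by (rule started_gbm.payoff_le_threshold[OF started[OF that(1)] that(3,4,2) h(1)])
  have mild_K: "mild_equilibrium {0<..} P X \<delta> f {K..}"
    unfolding mild_equilibrium_def
  proof (intro conjI ballI closed_K)
    show "f x \<le> ?J x {K..}" if "x \<in> {0<..} - {K..}" for x using J_below[of x] that by (auto simp: f)
    show "?J x {K..} \<le> f x" if "x \<in> {K..}" for x using J_le[of x "{K..}"] that K by (auto simp: f)
  qed
  \<comment> \<open>Above \<open>K\<close> the payoff is maximal, so waiting there only loses by discounting.\<close>
  have mild_superset: "{K..} \<subseteq> R" if R: "mild_equilibrium {0<..} P X \<delta> f R" for R
  proof
    fix y assume y: "y \<in> {K..}"
    then have y0: "0 < y" using K by auto
    show "y \<in> R"
    proof (rule ccontr)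
      assume "y \<notin> R"
      then have "f y \<le> ?J y R" "?J y R < K"
        using R y0 J_outside by (auto simp: mild_equilibrium_def)
      then show False using y by (simp add: f)
    qed
  qed
  have optimal: "?J x R \<le> ?J x {K..}" if R: "mild_equilibrium {0<..} P X \<delta> f R" and x: "0 < x" for R x
  proof (cases "x \<le> K")
    case True
    then show ?thesis using J_mono[OF x True _ mild_superset[OF R]] R by (simp add: mild_equilibrium_def)
  next
    case False
    then show ?thesis using J_above[of x] J_le[OF x, of R] by simp
  qed
  have 3: "optimal_mild_equilibrium {0<..} P X \<delta> f {K..}"
    using mild_K optimal by (auto simp: optimal_mild_equilibrium_def)
  have 4: "S = {K..}" if S: "optimal_mild_equilibrium {0<..} P X \<delta> f S" for S
  proof (rule antisym)
    have mS: "mild_equilibrium {0<..} P X \<delta> f S" using S by (simp add: optimal_mild_equilibrium_def)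
    show "{K..} \<subseteq> S" by (rule mild_superset[OF mS])
    show "S \<subseteq> {K..}"
    proof
      fix y assume y: "y \<in> S"
      have "S \<subseteq> {0<..}" using mS closedin_subset[of "top_of_set {0<..}" S] by (simp add: mild_equilibrium_def)
      then have y0: "0 < y" using y by auto
      show "y \<in> {K..}"
      proof (rule ccontr)
        assume "y \<notin> {K..}"
        then have yK: "y < K" by simp
        have "?J y {K..} \<le> ?J y S" using S mild_K y0 by (auto simp: optimal_mild_equilibrium_def)
        also have "\<dots> \<le> f y" using mS y by (simp add: mild_equilibrium_def)
        finally show False using J_below[OF y0 yK] yK by (simp add: f)
      qed
    qed
  qed
  have 5: "strong_equilibrium {0<..} P X \<delta> f {K..}"
    unfolding strong_equilibrium_def
  proof (intro conjI ballI closed_K)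
    show "f x \<le> ?J x {K..}" if "x \<in> {0<..} - {K..}" for x using J_below[of x] that by (auto simp: f)
    fix x assume x: "x \<in> {K..}"
    have "0 \<le> f x - delayed_value P X \<delta> f x \<epsilon> {K..}" if "0 < \<epsilon>" for \<epsilon>
      using delayed_le[of x \<epsilon> "{K..}"] x K that by (simp add: f)
    then show "\<exists>\<epsilon>>0. \<forall>\<epsilon>'. 0 < \<epsilon>' \<and> \<epsilon>' \<le> \<epsilon> \<longrightarrow> 0 \<le> f x - delayed_value P X \<delta> f x \<epsilon>' {K..}"
      by (intro exI[of _ 1]) auto
  qed
  \<comment> \<open>Stopping everywhere after a delay means stopping when the delay is over.\<close>
  have delayed: "delayed_value P X \<delta> f x \<epsilon> {0<..} = prob_space.expectation (P x) (\<lambda>\<omega>. 1 / (1 + \<mu> * \<epsilon>) * min (X \<epsilon> \<omega>) K)"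
    if x: "0 < x" and \<epsilon>: "0 < \<epsilon>" for x \<epsilon>
    unfolding delayed_value_def
  proof (rule Bochner_Integration.integral_cong[OF refl])
    fix \<omega> assume \<omega>: "\<omega> \<in> space (P x)"
    interpret started_gbm "P x" F W \<mu> \<sigma> X x by (rule started[OF x])
    have "hitting_time_from X \<epsilon> {0<..} \<omega> \<le> ereal \<epsilon>"
      unfolding hitting_time_from_def using X_pos[OF \<omega>, of \<epsilon>] \<epsilon> by (intro Inf_lower) auto
    then have "hitting_time_from X \<epsilon> {0<..} \<omega> = ereal \<epsilon>" using hitting_time_from_ge by (rule antisym)
    then show "discounted_payoff X \<delta> f (hitting_time_from X \<epsilon> {0<..}) \<omega> = 1 / (1 + \<mu> * \<epsilon>) * min (X \<epsilon> \<omega>) K"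
      by (simp add: discounted_payoff_def \<delta> f)
  qed
  have 1: "weak_equilibrium {0<..} P X \<delta> f {0<..}"
    unfolding weak_equilibrium_def
  proof (intro conjI ballI)
    fix x :: real assume "x \<in> {0<..}"
    then have x: "0 < x" by simp
    have lim: "((\<lambda>\<epsilon>. ereal (- (x * \<mu>\<^sup>2 * \<epsilon>))) \<longlongrightarrow> ereal (- (x * \<mu>\<^sup>2 * 0))) (at_right 0)"
      by (intro tendsto_intros)
    have "eventually (\<lambda>\<epsilon>. ereal (- (x * \<mu>\<^sup>2 * \<epsilon>)) \<le> ereal ((f x - delayed_value P X \<delta> f x \<epsilon> {0<..}) / \<epsilon>)) (at_right 0)"
      unfolding eventually_at_right_field
    proof (intro exI[of _ "1 / \<mu>"] conjI allI impI)
      fix \<epsilon> :: real assume \<epsilon>: "0 < \<epsilon>" "\<epsilon> < 1 / \<mu>"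
      then have "\<mu> * \<epsilon> \<le> 1" using \<mu>(2) by (simp add: field_simps)
      then have "delayed_value P X \<delta> f x \<epsilon> {0<..} \<le> f x + x * (\<mu> * \<epsilon>)\<^sup>2"
        unfolding delayed[OF x \<epsilon>(1)] unfolding f using started_gbm.delay_upper_bound[OF started[OF x] \<epsilon>(1) _ K] by simp
      then have "- (x * \<mu>\<^sup>2 * \<epsilon>) * \<epsilon> \<le> f x - delayed_value P X \<delta> f x \<epsilon> {0<..}"
        by (simp add: power2_eq_square algebra_simps)
      then show "ereal (- (x * \<mu>\<^sup>2 * \<epsilon>)) \<le> ereal ((f x - delayed_value P X \<delta> f x \<epsilon> {0<..}) / \<epsilon>)"
        using \<epsilon>(1) by (simp only: ereal_less_eq le_divide_eq if_True)
    qed (use \<mu>(2) in simp)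
    then have "Liminf (at_right 0) (\<lambda>\<epsilon>. ereal (- (x * \<mu>\<^sup>2 * \<epsilon>)))
        \<le> Liminf (at_right 0) (\<lambda>\<epsilon>. ereal ((f x - delayed_value P X \<delta> f x \<epsilon> {0<..}) / \<epsilon>))"
      by (rule Liminf_mono)
    then show "0 \<le> Liminf (at_right 0) (\<lambda>\<epsilon>. ereal ((f x - delayed_value P X \<delta> f x \<epsilon> {0<..}) / \<epsilon>))"
      using lim_imp_Liminf[OF trivial_limit_at_right_real lim] by (simp add: zero_ereal_def)
  qed auto
  have 2: "\<not> strong_equilibrium {0<..} P X \<delta> f {0<..}"
  proof
    assume "strong_equilibrium {0<..} P X \<delta> f {0<..}"
    moreover have x: "0 < K / 2" "K / 2 < K" using K by auto
    ultimately obtain \<epsilon> where \<epsilon>: "0 < \<epsilon>"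
      "\<And>\<epsilon>'. 0 < \<epsilon>' \<Longrightarrow> \<epsilon>' \<le> \<epsilon> \<Longrightarrow> 0 \<le> f (K / 2) - delayed_value P X \<delta> f (K / 2) \<epsilon>' {0<..}"
      unfolding strong_equilibrium_def by (metis greaterThan_iff)
    have "(\<lambda>n. (1 / real n)\<^sup>2) \<longlonglongrightarrow> 0\<^sup>2" by (intro tendsto_power lim_const_over_n)
    then have "eventually (\<lambda>n. (1 / real n)\<^sup>2 < \<epsilon>) sequentially" using \<epsilon>(1) by (intro order_tendstoD(2)) auto
    then have "eventually (\<lambda>n. False) sequentially"
      using started_gbm.short_delay_gains[OF started[OF x(1)] x(2)] eventually_gt_at_top[of 0]
    proof eventually_elim
      case (elim n)
      have n: "0 < 1 / (real n)\<^sup>2" "1 / (real n)\<^sup>2 \<le> \<epsilon>" using elim(1,3) by (simp_all add: power_divide)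
      show False
        using elim(2) \<epsilon>(2)[OF n] x(2) unfolding delayed[OF x(1) n(1)] by (simp add: f)
    qed
    then show False by simp
  qed
  show ?thesis using 1 2 3 4 5 by blast
qed

end
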